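(* Let $M_t^n\subset\mathbf{R}^N$ be an ancient mean curvature flow with finite entropy and fix $t<0$. For any (smooth) function $u$ on $M_t$, $$\frac{1}{-t}\int_{M_t}|x|^2\,u^2\,e^{\frac{|x|^2}{4t}}\le 4n\int_{M_t}u^2\,e^{\frac{|x|^2}{4t}}-4t\int_{M_t}\left(4\,|\nabla u|^2+u^2\,|\phi|^2\right)e^{\frac{|x|^2}{4t}},$$ where $\phi=\mathbf{H}+\frac{x^\perp}{2t}$.
   Context: Ancient mean curvature flow (MCF): a smooth one-parameter family of $n$-dimensional immersed submanifolds $M_t\subset\mathbf{R}^N$, existing for all $t<0$, whose points move by $\partial_t x=-\mathbf{H}$, i.e. $(\partial_t-\Delta_{M_t})x=0$ for the position vector $x$. The time slices are complete without boundary, may be non-compact, and the flow is proper (the part of the space-time track in a closed ball and a compact time interval is compact). Here $\mathbf{H}=-\mathrm{Tr}\,A$ is the mean curvature vector of $M_t$ ($A$ the second fundamental form, so $\Delta_{M_t}x=-\mathbf{H}$), $x^\perp$ is the normal part of $x$, and $\nabla$ is the gradient on $M_t$. Finite entropy means $\sup_t\lambda(M_t)<\infty$, where $\lambda(\Sigma)=\sup_{c>0,\,x_0\in\mathbf{R}^N}(4\pi)^{-n/2}\int_{c\Sigma+x_0}e^{-|x|^2/4}$. *)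

theory Defs
  imports "HOL-Analysis.Analysis"
begin

section \<open>Smooth maps and smooth manifolds\<close>

text \<open>Only used for open \<open>S\<close> in a finite-dimensional space, where it is the usual notion
  of a map of class \<open>C\<^sup>k\<close>.\<close>

primrec Ck_on :: "nat \<Rightarrow> 'a::euclidean_space set \<Rightarrow> ('a \<Rightarrow> 'b::euclidean_space) \<Rightarrow> bool" where
  "Ck_on 0 S f \<longleftrightarrow> continuous_on S f"
| "Ck_on (Suc k) S f \<longleftrightarrow> (\<forall>x\<in>S. f differentiable (at x)) \<and>
     (\<forall>v. Ck_on k S (\<lambda>x. frechet_derivative f (at x) v))"

definition smooth_on :: "'a::euclidean_space set \<Rightarrow> ('a \<Rightarrow> 'b::euclidean_space) \<Rightarrow> bool" where
  "smooth_on S f \<longleftrightarrow> (\<forall>k. Ck_on k S f)"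

text \<open>The abstract \<open>n\<close>-manifold without boundary underlying the immersions is a Hausdorff,
  second countable type \<open>'m\<close>, with \<open>n = CARD('n)\<close>. Its smooth structure is a set of local
  parametrizations \<open>(V, \<phi>)\<close>: homeomorphisms \<open>\<phi>\<close> from an open \<open>V \<subseteq> \<real>\<^sup>n\<close> onto an open part of \<open>'m\<close>
  (inverses of coordinate charts). The manifold may be non-compact or disconnected.\<close>

type_synonym ('m, 'n) atlas = "((real^'n) set \<times> (real^'n \<Rightarrow> 'm)) set"

definition smooth_atlas ::
  "('m::{t2_space,second_countable_topology}, 'n::finite) atlas \<Rightarrow> bool" where
  "smooth_atlas A \<longleftrightarrow>
     (\<Union>(V,\<phi>)\<in>A. \<phi> ` V) = UNIV \<and>
     (\<forall>(V,\<phi>)\<in>A. open V \<and> open (\<phi> ` V) \<and> homeomorphism V (\<phi> ` V) \<phi> (inv_into V \<phi>)) \<and>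
     (\<forall>(V,\<phi>)\<in>A. \<forall>(W,\<psi>)\<in>A. smooth_on {y\<in>V. \<phi> y \<in> \<psi> ` W} (inv_into W \<psi> \<circ> \<phi>))"

definition smooth_fun :: "('m, 'n::finite) atlas \<Rightarrow> ('m \<Rightarrow> real) \<Rightarrow> bool" where
  "smooth_fun A u \<longleftrightarrow> (\<forall>(V,\<phi>)\<in>A. smooth_on V (u \<circ> \<phi>))"

text \<open>Evaluation at \<open>p\<close> of a quantity \<open>Q \<phi> y\<close> given in a local parametrization \<open>\<phi>\<close> at the
  parameter \<open>y\<close> of \<open>p\<close>. It is applied only to quantities that do not depend on the
  parametrization, so the choice is immaterial.\<close>

definition at_point ::
  "('m, 'n::finite) atlas \<Rightarrow> ((real^'n \<Rightarrow> 'm) \<Rightarrow> real^'n \<Rightarrow> 'b) \<Rightarrow> 'm \<Rightarrow> 'b" where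
  "at_point A Q p =
     (let (V,\<phi>) = (SOME (V,\<phi>). (V,\<phi>) \<in> A \<and> p \<in> \<phi> ` V) in Q \<phi> (inv_into V \<phi> p))"


section \<open>Local geometry of a parametrized submanifold\<close>

text \<open>\<open>X\<close> is an immersion of an open subset of \<open>\<real>\<^sup>n\<close> into \<open>\<real>\<^sup>N\<close> with the induced metric
  \<open>g\<^sub>i\<^sub>j\<close>; all vectors, also tangent ones, are vectors of \<open>\<real>\<^sup>N\<close>.\<close>

definition pderiv_vec ::
  "'n::finite \<Rightarrow> (real^'n \<Rightarrow> 'b::real_normed_vector) \<Rightarrow> real^'n \<Rightarrow> 'b" where
  "pderiv_vec i f y = frechet_derivative f (at y) (axis i 1)"

definition metric_coeff :: "(real^'n::finite \<Rightarrow> real^'N::finite) \<Rightarrow> real^'n \<Rightarrow> real^'n^'n" where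
  "metric_coeff X y = (\<chi> i j. pderiv_vec i X y \<bullet> pderiv_vec j X y)"

definition inv_metric :: "(real^'n::finite \<Rightarrow> real^'N::finite) \<Rightarrow> real^'n \<Rightarrow> real^'n^'n" where
  "inv_metric X y = matrix_inv (metric_coeff X y)"

definition tangential_local ::
  "(real^'n::finite \<Rightarrow> real^'N::finite) \<Rightarrow> real^'n \<Rightarrow> real^'N \<Rightarrow> real^'N" where
  "tangential_local X y v =
     (\<Sum>i\<in>UNIV. \<Sum>j\<in>UNIV. (inv_metric X y $ i $ j * (v \<bullet> pderiv_vec i X y)) *\<^sub>R pderiv_vec j X y)"

definition normal_local ::
  "(real^'n::finite \<Rightarrow> real^'N::finite) \<Rightarrow> real^'n \<Rightarrow> real^'N \<Rightarrow> real^'N" where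
  "normal_local X y v = v - tangential_local X y v"

text \<open>The second fundamental form \<open>A(\<partial>\<^sub>i, \<partial>\<^sub>j)\<close> on coordinate vector fields.\<close>

definition second_fund_local ::
  "(real^'n::finite \<Rightarrow> real^'N::finite) \<Rightarrow> real^'n \<Rightarrow> 'n \<Rightarrow> 'n \<Rightarrow> real^'N" where
  "second_fund_local X y i j = normal_local X y (pderiv_vec i (pderiv_vec j X) y)"

text \<open>Sign convention \<open>H = - Tr A\<close>.\<close>

definition mean_curv_local ::
  "(real^'n::finite \<Rightarrow> real^'N::finite) \<Rightarrow> real^'n \<Rightarrow> real^'N" where
  "mean_curv_local X y =
     - (\<Sum>i\<in>UNIV. \<Sum>j\<in>UNIV. inv_metric X y $ i $ j *\<^sub>R second_fund_local X y i j)"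

definition gradient_local ::
  "(real^'n::finite \<Rightarrow> real^'N::finite) \<Rightarrow> (real^'n \<Rightarrow> real) \<Rightarrow> real^'n \<Rightarrow> real^'N" where
  "gradient_local X u y =
     (\<Sum>i\<in>UNIV. \<Sum>j\<in>UNIV. (inv_metric X y $ i $ j * pderiv_vec i u y) *\<^sub>R pderiv_vec j X y)"


section \<open>Immersed submanifolds\<close>

definition immersion ::
  "('m, 'n::finite) atlas \<Rightarrow> ('m \<Rightarrow> real^'N::finite) \<Rightarrow> bool" where
  "immersion A X \<longleftrightarrow> (\<forall>(V,\<phi>)\<in>A. smooth_on V (X \<circ> \<phi>) \<and>
     (\<forall>y\<in>V. inj (frechet_derivative (X \<circ> \<phi>) (at y))))"

definition normal_part ::
  "('m, 'n::finite) atlas \<Rightarrow> ('m \<Rightarrow> real^'N::finite) \<Rightarrow> 'm \<Rightarrow> real^'N \<Rightarrow> real^'N" where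
  "normal_part A X p v = at_point A (\<lambda>\<phi> y. normal_local (X \<circ> \<phi>) y v) p"

definition mean_curvature ::
  "('m, 'n::finite) atlas \<Rightarrow> ('m \<Rightarrow> real^'N::finite) \<Rightarrow> 'm \<Rightarrow> real^'N" where
  "mean_curvature A X p = at_point A (\<lambda>\<phi> y. mean_curv_local (X \<circ> \<phi>) y) p"

definition gradient ::
  "('m, 'n::finite) atlas \<Rightarrow> ('m \<Rightarrow> real^'N::finite) \<Rightarrow> ('m \<Rightarrow> real) \<Rightarrow> 'm \<Rightarrow> real^'N" where
  "gradient A X u p = at_point A (\<lambda>\<phi> y. gradient_local (X \<circ> \<phi>) (u \<circ> \<phi>) y) p"

text \<open>The \<open>n\<close>-dimensional volume of the induced metric, a measure on the parameter manifold, so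
  integrals over an immersed submanifold count multiplicity. It is the unique Borel measure given
  by \<open>\<surd>(det g) dy\<close> in every local parametrization; existence and uniqueness hold for every
  immersion, since a second countable manifold is covered by countably many parametrizations.\<close>

definition volume_measure ::
  "('m::{t2_space,second_countable_topology}, 'n::finite) atlas \<Rightarrow>
     ('m \<Rightarrow> real^'N::finite) \<Rightarrow> 'm measure" where
  "volume_measure A X = (THE \<mu>. sets \<mu> = sets borel \<and>
     (\<forall>(V,\<phi>)\<in>A. \<forall>E\<in>sets borel. E \<subseteq> \<phi> ` V \<longrightarrow>
        emeasure \<mu> E =
          (\<integral>\<^sup>+y\<in>{y\<in>V. \<phi> y \<in> E}. ennreal (sqrt (det (metric_coeff (X \<circ> \<phi>) y))) \<partial>lborel)))"

text \<open>Intrinsic distance: infimum of the lengths of piecewise \<open>C\<^sup>1\<close> curves, measured in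
  \<open>\<real>\<^sup>N\<close> along the immersion. The length is a nonnegative integral, since \<^const>\<open>valid_path\<close>
  allows curves of infinite length. Points in different components have distance \<open>\<infinity>\<close>.\<close>

definition curve_length :: "(real \<Rightarrow> real^'N::finite) \<Rightarrow> ennreal" where
  "curve_length c = (\<integral>\<^sup>+s\<in>{0..1}. ennreal (norm (vector_derivative c (at s))) \<partial>lborel)"

definition intrinsic_dist ::
  "('m::topological_space \<Rightarrow> real^'N::finite) \<Rightarrow> 'm \<Rightarrow> 'm \<Rightarrow> ennreal" where
  "intrinsic_dist X p q =
     (INF \<gamma>\<in>{\<gamma>. path \<gamma> \<and> pathstart \<gamma> = p \<and> pathfinish \<gamma> = q \<and> valid_path (X \<circ> \<gamma>)}.
        curve_length (X \<circ> \<gamma>))"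

definition complete_immersion :: "('m::topological_space \<Rightarrow> real^'N::finite) \<Rightarrow> bool" where
  "complete_immersion X \<longleftrightarrow>
     (\<forall>p::nat \<Rightarrow> 'm.
        (\<forall>e>0. \<exists>K. \<forall>i\<ge>K. \<forall>j\<ge>K. intrinsic_dist X (p i) (p j) < ennreal e) \<longrightarrow>
        (\<exists>q. p \<longlonglongrightarrow> q))"

text \<open>The integral over \<open>c \<Sigma> + x\<^sub>0\<close> is taken over the immersion \<open>c X + x\<^sub>0\<close>.\<close>

definition entropy ::
  "('m::{t2_space,second_countable_topology}, 'n::finite) atlas \<Rightarrow>
     ('m \<Rightarrow> real^'N::finite) \<Rightarrow> ennreal" where
  "entropy A X =
     (SUP (c,x\<^sub>0)\<in>{0<..} \<times> UNIV.
        ennreal ((4 * pi) powr (- real CARD('n) / 2)) *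
        (\<integral>\<^sup>+p. ennreal (exp (- (norm (c *\<^sub>R X p + x\<^sub>0))\<^sup>2 / 4))
           \<partial>volume_measure A (\<lambda>p. c *\<^sub>R X p + x\<^sub>0)))"


section \<open>Ancient mean curvature flows\<close>

text \<open>\<open>F t\<close> is the immersion whose image is \<open>M\<^sub>t\<close>; values for \<open>t \<ge> 0\<close> are irrelevant. As usual
  for immersed objects, the part of the space-time track in a set is taken in the parameter
  space, so properness says that \<open>(t, p) \<mapsto> (t, F t p)\<close> is a proper map.\<close>

definition ancient_mcf ::
  "('m::{t2_space,second_countable_topology}, 'n::finite) atlas \<Rightarrow>
     (real \<Rightarrow> 'm \<Rightarrow> real^'N::finite) \<Rightarrow> bool" where
  "ancient_mcf A F \<longleftrightarrow>
     smooth_atlas A \<and>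
     (\<forall>(V,\<phi>)\<in>A. smooth_on ({..<0} \<times> V) (\<lambda>(t,y). F t (\<phi> y))) \<and>
     (\<forall>t<0. immersion A (F t)) \<and>
     (\<forall>t<0. \<forall>p. ((\<lambda>s. F s p) has_vector_derivative - mean_curvature A (F t) p) (at t)) \<and>
     (\<forall>t<0. complete_immersion (F t)) \<and>
     (\<forall>a b z r. b < 0 \<longrightarrow> compact {(t,p). t \<in> {a..b} \<and> F t p \<in> cball z r})"

definition finite_entropy ::
  "('m::{t2_space,second_countable_topology}, 'n::finite) atlas \<Rightarrow>
     (real \<Rightarrow> 'm \<Rightarrow> real^'N::finite) \<Rightarrow> bool" where
  "finite_entropy A F \<longleftrightarrow> (SUP t\<in>{..<0}. entropy A (F t)) < \<infinity>"

definition shrinker_defect ::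
  "('m, 'n::finite) atlas \<Rightarrow> (real \<Rightarrow> 'm \<Rightarrow> real^'N::finite) \<Rightarrow> real \<Rightarrow> 'm \<Rightarrow> real^'N" where
  "shrinker_defect A F t p =
     mean_curvature A (F t) p + (1 / (2 * t)) *\<^sub>R normal_part A (F t) p (F t p)"

end

theory Submission
  imports Defs
begin

text \<open>
  Write \<open>x\<^sup>\<top>\<close> for the tangential part of the position vector and \<open>w = exp (|x|\<^sup>2 / 4t)\<close>. Since
  \<open>div (f x\<^sup>\<top>) = \<langle>\<nabla>f, x\<^sup>\<top>\<rangle> + f (n - \<langle>x, H\<rangle>)\<close>, integrating the divergence of \<open>\<chi> u\<^sup>2 w x\<^sup>\<top>\<close> and
  substituting \<open>H = \<phi> - x\<^sup>\<bottom> / 2t\<close> turns the claim into two completed squares. The cutoff \<open>\<chi>\<close> is a decreasing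
  function of \<open>|x|\<^sup>2\<close>, so the term \<open>\<langle>\<nabla>\<chi>, x\<^sup>\<top>\<rangle> u\<^sup>2 w\<close> has a favourable sign and can be dropped; hence no
  integrability is needed to remove the cutoff, only properness, which makes its support compact.
\<close>

section \<open>Change of variables for nonnegative integrals\<close>

text \<open>Put \<tau> = -t and split x = T + N into tangential and normal parts. The derivative of
  the Gaussian contributes -u^2 |T|^2 / 2\<tau>, and the part of H along N contributes -u^2 |N|^2 /
  2\<tau>; together they are -u^2 |x|^2 / 2\<tau>. Half of this pays for the cross terms 2u grad u
  \<bullet> T and -u^2 N \<bullet> \<phi>, at the price 4\<tau> |grad u|^2 + \<tau> u^2 |\<phi>|^2.
  The other half is the left-hand side, so the estimate first appears for u^2 |x|^2 / 4\<tau> and is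
  multiplied by 4 at the end; this is the origin of all constants. Most of the work lies in reaching
  this computation from the coordinate definitions: \<open>volume_measure\<close> is a definite
  description and says something only after existence and uniqueness are proved, and
  \<open>at_point\<close> picks an unspecified chart, so each quantity must be shown independent of
  the chart. The calculus is done in class C^1: the vector field is differentiated only once, and
  squares of positive parts, which are C^1 but not C^2, can then serve both as cutoff and as bump
  functions.\<close>

text \<open>The library states the change of variables formula only for index types of class
  \<^class>\<open>wellorder\<close>; it is carried over to an arbitrary finite index type through a well-ordered
  copy of that type.\<close>

typedef 'a wo_copy = "UNIV :: 'a set" morphisms from_wo to_wo ..

lemma bij_to_wo: "bij to_wo"
  by (metis bij_betw_def inj_on_def surj_def to_wo_inject from_wo_inverse UNIV_I)

lemma bij_from_wo: "bij from_wo"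
  by (metis bij_betw_def inj_on_def surj_def from_wo_inject to_wo_inverse UNIV_I)

lemma from_to_wo [simp]: "from_wo (to_wo x) = x"
  by (simp add: to_wo_inverse)

lemma to_from_wo [simp]: "to_wo (from_wo x) = x"
  by (simp add: from_wo_inverse)

instance wo_copy :: (finite) finite
  by standard (metis bij_betw_finite bij_to_wo finite)

instantiation wo_copy :: (finite) wellorder
begin

text \<open>Any injection into the natural numbers would give a well-order; \<open>to_nat\<close> is
  one, as a finite type is countable.\<close>

definition less_eq_wo_copy :: "'a wo_copy \<Rightarrow> 'a wo_copy \<Rightarrow> bool" where
  "x \<le> y \<longleftrightarrow> to_nat (from_wo x) \<le> to_nat (from_wo y)"

definition less_wo_copy :: "'a wo_copy \<Rightarrow> 'a wo_copy \<Rightarrow> bool" where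
  "x < y \<longleftrightarrow> to_nat (from_wo x) < to_nat (from_wo y)"

instance
proof
  fix P :: "'a wo_copy \<Rightarrow> bool" and a
  assume step: "\<And>x. (\<And>y. y < x \<Longrightarrow> P y) \<Longrightarrow> P x"
  show "P a"
    by (induction "to_nat (from_wo a)" arbitrary: a rule: less_induct)
      (use step in \<open>auto simp: less_wo_copy_def\<close>)
qed (auto simp: less_eq_wo_copy_def less_wo_copy_def from_wo_inject)

end

definition vec_to_wo :: "'b^'a::finite \<Rightarrow> 'b^('a wo_copy)" where
  "vec_to_wo x = (\<chi> i. x $ from_wo i)"

definition vec_from_wo :: "'b^('a wo_copy) \<Rightarrow> 'b^'a::finite" where
  "vec_from_wo x = (\<chi> i. x $ to_wo i)"

lemma vec_wo_inverse [simp]: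
  "vec_to_wo (vec_from_wo x) = x" "vec_from_wo (vec_to_wo y) = y"
  by (simp_all add: vec_to_wo_def vec_from_wo_def)

lemma vec_wo_inject:
  "vec_to_wo x = vec_to_wo y \<longleftrightarrow> x = y" "vec_from_wo x' = vec_from_wo y' \<longleftrightarrow> x' = y'"
  by (metis vec_wo_inverse(2), metis vec_wo_inverse(1))

lemma linear_vec_wo:
  "bounded_linear (vec_to_wo :: real^'a::finite \<Rightarrow> _)"
  "bounded_linear (vec_from_wo :: _ \<Rightarrow> real^'a::finite)"
  by (auto intro!: linear_conv_bounded_linear[THEN iffD1] linearI
      simp: vec_to_wo_def vec_from_wo_def vec_eq_iff)

lemma continuous_on_vec_wo:
  "continuous_on S (vec_to_wo :: real^'a::finite \<Rightarrow> _)"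
  "continuous_on S' (vec_from_wo :: _ \<Rightarrow> real^'a::finite)"
  using linear_vec_wo by (auto intro: linear_continuous_on)

lemma measurable_vec_wo [measurable]:
  "(vec_to_wo :: real^'a::finite \<Rightarrow> _) \<in> borel_measurable borel"
  "(vec_from_wo :: _ \<Rightarrow> real^'a::finite) \<in> borel_measurable borel"
  by (auto intro: borel_measurable_continuous_onI continuous_on_vec_wo)

lemma prod_Basis_vec: "(\<Prod>b\<in>Basis. (x :: real^'a::finite) \<bullet> b) = (\<Prod>i\<in>UNIV. x $ i)"
proof -
  have "(\<Prod>b\<in>Basis. x \<bullet> b) = (\<Prod>b\<in>(\<lambda>i. axis i 1) ` UNIV. x \<bullet> b)"
    by (rule prod.cong) (auto simp: Basis_vec_def)
  also have "\<dots> = (\<Prod>i\<in>UNIV. x $ i)"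
    by (subst prod.reindex) (auto simp: inj_on_def axis_eq_axis inner_axis)
  finally show ?thesis .
qed

text \<open>Relabelling the coordinates takes boxes to boxes with the same edge lengths, and
  Lebesgue measure is determined by its values on boxes.\<close>

lemma distr_lborel_vec_to_wo:
  "distr lborel borel (vec_to_wo :: real^'a::finite \<Rightarrow> _) = lborel"
proof (rule lborel_eqI[symmetric])
  fix l u :: "real^('a wo_copy)"
  assume le: "\<And>b. b \<in> Basis \<Longrightarrow> l \<bullet> b \<le> u \<bullet> b"
  have "vec_to_wo -` box l u = box (vec_from_wo l) (vec_from_wo u)"
    by (auto simp: box_def Basis_vec_def inner_axis vec_to_wo_def vec_from_wo_def)
      (metis to_from_wo from_to_wo)+
  moreover have "vec_from_wo l \<bullet> b \<le> vec_from_wo u \<bullet> b" if "b \<in> Basis" for b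
  proof -
    obtain i where b: "b = axis i 1" using \<open>b \<in> Basis\<close> by (auto simp: Basis_vec_def)
    then show ?thesis using le[of "axis (to_wo i) 1"] by (simp add: vec_from_wo_def inner_axis)
  qed
  moreover have "(\<Prod>b\<in>Basis. (vec_from_wo u - vec_from_wo l) \<bullet> b) = (\<Prod>b\<in>Basis. (u - l) \<bullet> b)"
    unfolding prod_Basis_vec
    by (subst prod.reindex_bij_betw[OF bij_to_wo, symmetric]) (simp add: vec_from_wo_def)
  ultimately show "emeasure (distr lborel borel vec_to_wo) (box l u)
      = ennreal (\<Prod>b\<in>Basis. (u - l) \<bullet> b)"
    by (subst emeasure_distr) auto
qed simp

lemma nn_integral_lborel_vec_to_wo:
  assumes [measurable]: "f \<in> borel_measurable borel"
  shows "(\<integral>\<^sup>+x. f (vec_to_wo (x :: real^'a::finite)) \<partial>lborel) = (\<integral>\<^sup>+x. f x \<partial>lborel)"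
  by (subst distr_lborel_vec_to_wo[symmetric], subst nn_integral_distr) auto

text \<open>Conjugation by the relabelling is a sign-preserving bijection between the permutations
  of the two index types, so the Leibniz sums agree term by term.\<close>

lemma det_reindex_wo:
  fixes B :: "real^'a^'a::finite"
  shows "det (\<chi> i j. B $ from_wo i $ from_wo j) = det B"
proof -
  have b: "bij_betw (map_permutation UNIV (to_wo :: 'a \<Rightarrow> _)) {p. p permutes UNIV} {p. p permutes UNIV}"
  proof (rule bij_betwI[where g = "map_permutation UNIV from_wo"])
    show "map_permutation UNIV (to_wo :: 'a \<Rightarrow> _) \<in> {p. p permutes UNIV} \<rightarrow> {p. p permutes UNIV}"
      by (auto intro!: map_permutation_permutes bij_to_wo)
    show "map_permutation UNIV (from_wo :: _ \<Rightarrow> 'a) \<in> {p. p permutes UNIV} \<rightarrow> {p. p permutes UNIV}"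
      by (auto intro!: map_permutation_permutes bij_from_wo)
  next
    fix p :: "'a \<Rightarrow> 'a" assume "p \<in> {p. p permutes UNIV}"
    then show "map_permutation UNIV from_wo (map_permutation UNIV to_wo p) = p"
      by (intro map_permutation_compose_inv bij_to_wo) auto
  next
    fix p :: "'a wo_copy \<Rightarrow> 'a wo_copy" assume "p \<in> {p. p permutes UNIV}"
    then show "map_permutation UNIV to_wo (map_permutation UNIV from_wo p) = p"
      by (intro map_permutation_compose_inv bij_from_wo) auto
  qed
  have inj: "inj (to_wo :: 'a \<Rightarrow> _)" using bij_to_wo by (rule bij_is_inj)
  have "det (\<chi> i j. B $ from_wo i $ from_wo j)
    = (\<Sum>p\<in>{p. p permutes (UNIV :: 'a set)}. of_int (sign (map_permutation UNIV to_wo p)) *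
        (\<Prod>i\<in>UNIV. B $ from_wo i $ from_wo (map_permutation UNIV to_wo p i)))"
    unfolding det_def by (subst sum.reindex_bij_betw[OF b, symmetric]) simp
  also have "\<dots> = det B"
    unfolding det_def
  proof (rule sum.cong[OF refl])
    fix p :: "'a \<Rightarrow> 'a" assume p: "p \<in> {p. p permutes UNIV}"
    have "(\<Prod>i\<in>UNIV. B $ from_wo i $ from_wo (map_permutation UNIV to_wo p i))
      = (\<Prod>i\<in>UNIV. B $ i $ p i)"
      by (subst prod.reindex_bij_betw[OF bij_to_wo, symmetric])
        (simp add: map_permutation_apply[OF inj])
    then show "of_int (sign (map_permutation UNIV to_wo p)) *
        (\<Prod>i\<in>UNIV. B $ from_wo i $ from_wo (map_permutation UNIV to_wo p i))
        = of_int (sign p) * (\<Prod>i\<in>UNIV. B $ i $ p i)"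
      using p sign_map_permutation[OF inj] by auto
  qed
  finally show ?thesis .
qed

text \<open>The classical formula compares finite integrals. For nonnegative integrands, having the
  value \<open>r\<close> is a \<open>has_integral\<close> statement on each side, and the formula
  makes the two statements equivalent for every real \<open>r\<close>. So if one side is finite, the
  other has the same value, and otherwise both are infinite.\<close>

lemma nn_integral_change_of_variables_wellorder:
  fixes g :: "real^'n::{finite,wellorder} \<Rightarrow> real^'n::_" and f :: "real^'n::_ \<Rightarrow> real"
  assumes S: "S \<in> sets borel" 
    and der: "\<And>x. x \<in> S \<Longrightarrow> (g has_derivative g' x) (at x)"
    and inj: "inj_on g S"
    and nonneg: "\<And>y. y \<in> g ` S \<Longrightarrow> 0 \<le> f y"
    and f: "(\<lambda>y. indicator (g ` S) y * f y) \<in> borel_measurable borel"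
    and fg: "(\<lambda>x. indicator S x * (\<bar>det (matrix (g' x))\<bar> * f (g x))) \<in> borel_measurable borel"
  shows "(\<integral>\<^sup>+y. ennreal (indicator (g ` S) y * f y) \<partial>lborel)
    = (\<integral>\<^sup>+x. ennreal (indicator S x * (\<bar>det (matrix (g' x))\<bar> * f (g x))) \<partial>lborel)"
proof -
  let ?F = "\<lambda>y. indicator (g ` S) y * f y"
  let ?G = "\<lambda>x. \<bar>det (matrix (g' x))\<bar> * f (g x)"
  have key: "(f has_integral r) (g ` S) \<longleftrightarrow> (?G has_integral r) S" for r
  proof -
    have "S \<in> sets lebesgue" using S by simp
    moreover have "\<And>x. x \<in> S \<Longrightarrow> (g has_derivative g' x) (at x within S)"
      using der has_derivative_at_withinI by blast
    \<comment> \<open>The formula is for vector-valued integrands, so \<open>f\<close> is passed as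
      a map into \<open>real^1\<close>.\<close>
    ultimately have 1: "?G absolutely_integrable_on S \<and> integral S ?G = r \<longleftrightarrow>
        f absolutely_integrable_on (g ` S) \<and> integral (g ` S) f = r"
      using has_absolute_integral_change_of_variables[OF _ _ inj, of g' "\<lambda>x. vec (f x) :: real^1" "vec r"]
      unfolding absolutely_integrable_on_1_iff integral_on_1_eq by (auto simp: vec_eq_iff)
    have 2: "h absolutely_integrable_on T \<and> integral T h = r \<longleftrightarrow> (h has_integral r) T"
      if "\<And>x. x \<in> T \<Longrightarrow> 0 \<le> h x" for h :: "real^'n::_ \<Rightarrow> real" and T
      using nonnegative_absolutely_integrable_1[of h T] that
      by (auto simp: has_integral_iff absolutely_integrable_on_def)
    show ?thesis using 1 2[of "g ` S" f] 2[of S ?G] nonneg by auto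
  qed
  have nn: "(\<integral>\<^sup>+y. ennreal (indicator T y * h y) \<partial>lborel) = ennreal r \<longleftrightarrow> (h has_integral r) T"
    if "\<And>x. x \<in> T \<Longrightarrow> 0 \<le> h x" "(\<lambda>y. indicator T y * h y) \<in> borel_measurable borel" "0 \<le> r"
    for h :: "real^'n::_ \<Rightarrow> real" and T r
  proof -
    have *: "(\<lambda>x. if x \<in> T then h x else 0) = (\<lambda>x. indicator T x * h x)" by auto
    have "(h has_integral r) T \<longleftrightarrow> ((\<lambda>x. indicator T x * h x) has_integral r) UNIV"
      using has_integral_restrict_UNIV[of T h r] unfolding * by simp
    moreover have "0 \<le> indicator T x * h x" for x using that(1) by (auto simp: indicator_def)
    ultimately show ?thesis
      using nn_integral_has_integral[OF that(2) _ _ that(3)] nn_integral_has_integral_lborel[OF that(2), of r]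
      by blast
  qed
  show ?thesis (is "?L = ?R")
  proof (cases "?L = \<infinity> \<and> ?R = \<infinity>")
    case False
    then obtain r where r: "r \<ge> 0" "?L = ennreal r \<or> ?R = ennreal r"
      by (cases ?L; cases ?R) auto
    have "?L = ennreal r \<longleftrightarrow> (f has_integral r) (g ` S)"
      using nonneg by (intro nn f r)
    moreover have "?R = ennreal r \<longleftrightarrow> (?G has_integral r) S"
      using nonneg by (intro nn fg r) simp
    ultimately have "?L = ennreal r \<longleftrightarrow> ?R = ennreal r" by (simp only: key)
    with r(2) show ?thesis by argo
  qed auto
qed

lemma nn_integral_change_of_variables:
  fixes g :: "real^'n::finite \<Rightarrow> real^'n" and f :: "real^'n \<Rightarrow> real"
  assumes S: "S \<in> sets borel" 
    and der: "\<And>x. x \<in> S \<Longrightarrow> (g has_derivative g' x) (at x)"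
    and inj: "inj_on g S"
    and nonneg: "\<And>y. y \<in> g ` S \<Longrightarrow> 0 \<le> f y"
    and f: "(\<lambda>y. indicator (g ` S) y * f y) \<in> borel_measurable borel"
    and fg: "(\<lambda>x. indicator S x * (\<bar>det (matrix (g' x))\<bar> * f (g x))) \<in> borel_measurable borel"
  shows "(\<integral>\<^sup>+y. ennreal (indicator (g ` S) y * f y) \<partial>lborel)
    = (\<integral>\<^sup>+x. ennreal (indicator S x * (\<bar>det (matrix (g' x))\<bar> * f (g x))) \<partial>lborel)"
proof -
  define h where "h = (\<lambda>z. vec_to_wo (g (vec_from_wo z)))"
  define h' where "h' = (\<lambda>z v. vec_to_wo (g' (vec_from_wo z) (vec_from_wo v)))"
  define T where "T = vec_from_wo -` S"
  have im: "h ` T = vec_from_wo -` (g ` S)"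
  proof (intro set_eqI iffI)
    fix z assume "z \<in> vec_from_wo -` (g ` S)"
    then obtain x where "x \<in> S" "vec_from_wo z = g x" by auto
    then have "vec_to_wo x \<in> T" by (simp add: T_def)
    moreover have "z = h (vec_to_wo x)"
      using \<open>vec_from_wo z = g x\<close> vec_wo_inverse(1)[of z] by (simp add: h_def)
    ultimately show "z \<in> h ` T" by blast
  qed (auto simp: h_def T_def)
  have mat: "matrix (h' z) = (\<chi> i j. matrix (g' (vec_from_wo z)) $ from_wo i $ from_wo j)" for z
  proof -
    have "vec_from_wo (axis j 1) = (axis (from_wo j) 1 :: real^'n)" for j
      by (auto simp: vec_from_wo_def axis_def vec_eq_iff)
    then show ?thesis unfolding h'_def matrix_def vec_to_wo_def by simp
  qed
  have det: "det (matrix (h' z)) = det (matrix (g' (vec_from_wo z)))" for z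
    unfolding mat by (rule det_reindex_wo)
  have T: "T \<in> sets borel" unfolding T_def using measurable_sets[OF measurable_vec_wo(2) S] by simp
  have derh: "(h has_derivative h' z) (at z)" if "z \<in> T" for z
  proof -
    have "(g has_derivative g' (vec_from_wo z)) (at (vec_from_wo z))"
      using der that by (simp add: T_def)
    then have "((\<lambda>z. g (vec_from_wo z)) has_derivative (\<lambda>v. g' (vec_from_wo z) (vec_from_wo v))) (at z)"
      by (rule has_derivative_compose[rotated])
        (rule bounded_linear.has_derivative[OF linear_vec_wo(2) has_derivative_ident])
    then show ?thesis
      unfolding h_def h'_def by (rule bounded_linear.has_derivative[OF linear_vec_wo(1)])
  qed
  have injh: "inj_on h T"
    unfolding h_def T_def
  proof (rule inj_onI)
    fix x y assume "x \<in> vec_from_wo -` S" "y \<in> vec_from_wo -` S"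
      "vec_to_wo (g (vec_from_wo x)) = vec_to_wo (g (vec_from_wo y))"
    then show "x = y" using inj by (simp add: vec_wo_inject inj_on_eq_iff)
  qed
  have m1: "(\<lambda>y. indicator (h ` T) y * f (vec_from_wo y)) \<in> borel_measurable borel"
    using measurable_compose[OF measurable_vec_wo(2) f] by (simp add: im indicator_def)
  have m2: "(\<lambda>x. indicator T x * (\<bar>det (matrix (h' x))\<bar> * f (vec_from_wo (h x)))) \<in> borel_measurable borel"
    using measurable_compose[OF measurable_vec_wo(2) fg] by (simp add: T_def det h_def indicator_def)
  have "(\<integral>\<^sup>+y. ennreal (indicator (h ` T) y * f (vec_from_wo y)) \<partial>lborel)
    = (\<integral>\<^sup>+x. ennreal (indicator T x * (\<bar>det (matrix (h' x))\<bar> * f (vec_from_wo (h x)))) \<partial>lborel)"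
    by (rule nn_integral_change_of_variables_wellorder[OF T derh injh _ m1 m2])
      (use nonneg im in auto)
  moreover have "(\<integral>\<^sup>+y. ennreal (indicator (h ` T) y * f (vec_from_wo y)) \<partial>lborel)
    = (\<integral>\<^sup>+y. ennreal (indicator (g ` S) y * f y) \<partial>lborel)"
    using m1 by (subst nn_integral_lborel_vec_to_wo[symmetric]) (auto simp: im indicator_def)
  moreover have "(\<integral>\<^sup>+x. ennreal (indicator T x * (\<bar>det (matrix (h' x))\<bar> * f (vec_from_wo (h x)))) \<partial>lborel)
    = (\<integral>\<^sup>+x. ennreal (indicator S x * (\<bar>det (matrix (g' x))\<bar> * f (g x))) \<partial>lborel)"
    using m2 by (subst nn_integral_lborel_vec_to_wo[symmetric]) (auto simp: T_def det h_def indicator_def)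
  ultimately show ?thesis by simp
qed

section \<open>Functions of class \<open>C\<^sup>1\<close>\<close>

text \<open>This is \<open>Ck_on\<close> at order one. In finite dimensions continuity of every
  directional derivative amounts to continuity of the derivative as an operator, and operator norms
  are avoided.\<close>

definition C1_on :: "'a::euclidean_space set \<Rightarrow> ('a \<Rightarrow> 'b::euclidean_space) \<Rightarrow> bool" where
  "C1_on S f \<longleftrightarrow> (\<forall>x\<in>S. f differentiable (at x)) \<and>
     (\<forall>v. continuous_on S (\<lambda>x. frechet_derivative f (at x) v))"

lemma C1_onI:
  assumes "\<And>x. x \<in> S \<Longrightarrow> (f has_derivative f' x) (at x)"
    and "\<And>v. continuous_on S (\<lambda>x. f' x v)"
  shows "C1_on S f"
proof -
  have "frechet_derivative f (at x) = f' x" if "x \<in> S" for x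
    using assms(1)[OF that] by (metis frechet_derivative_at)
  then have "continuous_on S (\<lambda>x. frechet_derivative f (at x) v)" for v
    using assms(2)[of v] by (simp cong: continuous_on_cong)
  then show ?thesis using assms(1) by (auto simp: C1_on_def differentiable_def)
qed

lemma C1_on_has_derivative:
  "C1_on S f \<Longrightarrow> x \<in> S \<Longrightarrow> (f has_derivative frechet_derivative f (at x)) (at x)"
  by (simp add: C1_on_def flip: frechet_derivative_works)

lemma C1_on_continuous_derivative:
  "C1_on S f \<Longrightarrow> continuous_on S (\<lambda>x. frechet_derivative f (at x) v)"
  by (simp add: C1_on_def)

lemma C1_on_continuous_on: "C1_on S f \<Longrightarrow> continuous_on S f"
  by (meson C1_on_has_derivative continuous_at_imp_continuous_on has_derivative_continuous)

lemma C1_on_subset: "C1_on S f \<Longrightarrow> T \<subseteq> S \<Longrightarrow> C1_on T f"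
  unfolding C1_on_def by (auto intro: continuous_on_subset)

lemma C1_on_cong:
  assumes "C1_on S f" "open S" "\<And>x. x \<in> S \<Longrightarrow> g x = f x"
  shows "C1_on S g"
proof (rule C1_onI)
  fix x assume "x \<in> S"
  then show "(g has_derivative frechet_derivative f (at x)) (at x)"
    using has_derivative_transform_within_open[OF C1_on_has_derivative[OF assms(1)] assms(2)] assms(3)
    by metis
qed (use assms in \<open>auto intro: C1_on_continuous_derivative\<close>)

lemma C1_on_Un:
  assumes "C1_on S f" "C1_on T f" "open S" "open T"
  shows "C1_on (S \<union> T) f"
  using assms unfolding C1_on_def by (auto intro: continuous_on_open_Un)

lemma C1_on_const [simp, intro]: "C1_on S (\<lambda>x. c)"
  by (rule C1_onI[where f' = "\<lambda>_ _. 0"]) auto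

lemma C1_on_add [intro]:
  assumes "C1_on S f" "C1_on S g" shows "C1_on S (\<lambda>x. f x + g x)"
proof (rule C1_onI)
  show "((\<lambda>x. f x + g x) has_derivative
      (\<lambda>v. frechet_derivative f (at x) v + frechet_derivative g (at x) v)) (at x)" if "x \<in> S" for x
    using that assms by (intro has_derivative_add C1_on_has_derivative)
qed (use assms in \<open>auto intro!: continuous_intros C1_on_continuous_derivative\<close>)

lemma C1_on_bilinear:
  fixes prod :: "'b::euclidean_space \<Rightarrow> 'c::euclidean_space \<Rightarrow> 'd::euclidean_space"
  assumes "bounded_bilinear prod" "C1_on S f" "C1_on S g"
  shows "C1_on S (\<lambda>x. prod (f x) (g x))"
proof (rule C1_onI)
  show "((\<lambda>x. prod (f x) (g x)) has_derivative
      (\<lambda>v. prod (f x) (frechet_derivative g (at x) v) + prod (frechet_derivative f (at x) v) (g x))) (at x)"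
    if "x \<in> S" for x
    using that assms by (intro bounded_bilinear.FDERIV C1_on_has_derivative)
  show "continuous_on S (\<lambda>x. prod (f x) (frechet_derivative g (at x) v)
      + prod (frechet_derivative f (at x) v) (g x))" for v
    by (intro continuous_on_add bounded_bilinear.continuous_on[OF assms(1)]
        C1_on_continuous_derivative C1_on_continuous_on assms)
qed

lemmas C1_on_mult [intro] = C1_on_bilinear[OF bounded_bilinear_mult[where 'a = real]]
  and C1_on_inner [intro] = C1_on_bilinear[OF bounded_bilinear_inner]
  and C1_on_scaleR [intro] = C1_on_bilinear[OF bounded_bilinear_scaleR]

lemma C1_on_minus [intro]: "C1_on S f \<Longrightarrow> C1_on S (\<lambda>x. - f x)"
  using C1_on_scaleR[OF C1_on_const[of S "-1"]] by simp

lemma C1_on_diff [intro]: "C1_on S f \<Longrightarrow> C1_on S g \<Longrightarrow> C1_on S (\<lambda>x. f x - g x)"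
  using C1_on_add[OF _ C1_on_minus] by simp

lemma C1_on_sum [intro]: "(\<And>i. i \<in> I \<Longrightarrow> C1_on S (f i)) \<Longrightarrow> C1_on S (\<lambda>x. \<Sum>i\<in>I. f i x)"
  by (induction I rule: infinite_finite_induct) (auto intro!: C1_on_add)

lemma C1_on_prod [intro]:
  fixes f :: "_ \<Rightarrow> _ \<Rightarrow> real"
  shows "(\<And>i. i \<in> I \<Longrightarrow> C1_on S (f i)) \<Longrightarrow> C1_on S (\<lambda>x. \<Prod>i\<in>I. f i x)"
  by (induction I rule: infinite_finite_induct) (auto intro!: C1_on_mult)

lemma C1_on_compose:
  assumes g: "C1_on S g" and f: "C1_on T f" and ST: "g ` S \<subseteq> T"
  shows "C1_on S (\<lambda>x. f (g x))"
proof (rule C1_onI)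
  let ?f' = "\<lambda>x. frechet_derivative f (at (g x))" and ?g' = "\<lambda>x. frechet_derivative g (at x)"
  have f': "(f has_derivative ?f' x) (at (g x))" if "x \<in> S" for x
    using that ST by (intro C1_on_has_derivative[OF f]) auto
  show "((\<lambda>x. f (g x)) has_derivative (\<lambda>v. ?f' x (?g' x v))) (at x)" if "x \<in> S" for x
    using f'[OF that] by (rule has_derivative_compose[OF C1_on_has_derivative[OF g that]])
  fix v
  \<comment> \<open>The definition controls the derivative of \<open>f\<close> in fixed directions,
    while here the direction varies with \<open>x\<close>; expanding in the basis reduces to fixed
    ones.\<close>
  have eq: "(\<Sum>b\<in>Basis. (?g' x v \<bullet> b) *\<^sub>R ?f' x b) = ?f' x (?g' x v)" if "x \<in> S" for x
  proof -
    interpret linear "?f' x"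
      using f'[OF that] by (rule has_derivative_linear)
    show ?thesis
      by (subst (2) euclidean_representation[of "?g' x v", symmetric]) (simp add: sum scale)
  qed
  have "continuous_on S (\<lambda>x. ?f' x b)" for b
    using continuous_on_compose2[OF C1_on_continuous_derivative[OF f] C1_on_continuous_on[OF g] ST]
    by simp
  then have "continuous_on S (\<lambda>x. \<Sum>b\<in>Basis. (?g' x v \<bullet> b) *\<^sub>R ?f' x b)"
    by (intro continuous_intros C1_on_continuous_derivative[OF g])
  then show "continuous_on S (\<lambda>x. ?f' x (?g' x v))"
    using eq by (simp cong: continuous_on_cong)
qed

lemma C1_on_real:
  fixes f :: "real \<Rightarrow> real"
  assumes "\<And>x. x \<in> S \<Longrightarrow> (f has_real_derivative f' x) (at x)" and "continuous_on S f'"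
  shows "C1_on S f"
  by (rule C1_onI[where f' = "\<lambda>x v. f' x * v"])
    (use assms in \<open>auto intro!: continuous_intros simp: has_field_derivative_def\<close>)

lemma C1_on_divide [intro]:
  assumes "C1_on S f" "C1_on S g" "\<And>x. x \<in> S \<Longrightarrow> g x \<noteq> 0"
  shows "C1_on S (\<lambda>x. f x / g x :: real)"
proof -
  have "C1_on (- {0}) (\<lambda>x. inverse x :: real)"
    by (rule C1_on_real[where f' = "\<lambda>x. - (inverse x ^ 2)"])
      (auto intro!: derivative_eq_intros continuous_intros simp: power2_eq_square)
  then have "C1_on S (\<lambda>x. inverse (g x))"
    by (rule C1_on_compose[OF assms(2)]) (use assms(3) in auto)
  then show ?thesis
    unfolding divide_inverse by (intro C1_on_mult assms(1))
qed

lemma C1_on_sqrt [intro]: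
  assumes "C1_on S g" "\<And>x. x \<in> S \<Longrightarrow> 0 < g x"
  shows "C1_on S (\<lambda>x. sqrt (g x))"
proof -
  have "C1_on {0<..} sqrt"
    by (rule C1_on_real[where f' = "\<lambda>x. inverse (sqrt x) / 2"])
      (auto intro!: derivative_eq_intros continuous_intros)
  then show ?thesis
    by (rule C1_on_compose[OF assms(1)]) (use assms(2) in auto)
qed

text \<open>Squaring removes the corner at 0, where the difference quotient is bounded by the
  absolute value of the increment. Every compactly supported function of the proof is built from
  this one.\<close>

lemma has_real_derivative_square_pos_part:
  "((\<lambda>s :: real. (max 0 s)\<^sup>2) has_real_derivative 2 * max 0 s) (at s)"
proof (cases "s = 0")
  case True
  have "((\<lambda>h. (max 0 (0 + h))\<^sup>2 / h) \<longlongrightarrow> 0) (at (0::real))"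
  proof (rule tendsto_0_le[where K = 1])
    show "((\<lambda>h. \<bar>h\<bar>) \<longlongrightarrow> 0) (at (0::real))" by (auto intro!: tendsto_eq_intros)
    show "\<forall>\<^sub>F h in at (0::real). norm ((max 0 (0 + h))\<^sup>2 / h) \<le> norm \<bar>h\<bar> * 1"
      by (intro always_eventually) (auto simp: max_def power2_eq_square)
  qed
  then show ?thesis using True by (simp add: DERIV_def)
next
  case False
  show ?thesis
  proof (cases "s > 0")
    case True
    have "((\<lambda>s :: real. s\<^sup>2) has_real_derivative 2 * s) (at s)"
      by (auto intro!: derivative_eq_intros)
    then have "((\<lambda>s :: real. (max 0 s)\<^sup>2) has_real_derivative 2 * s) (at s)"
      by (rule has_field_derivative_transform_within_open[where S = "{0<..}"]) (use True in auto)
    then show ?thesis using True by simp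
  next
    case False
    have "((\<lambda>s :: real. 0) has_real_derivative 0) (at s)" by simp
    then have "((\<lambda>s :: real. (max 0 s)\<^sup>2) has_real_derivative 0) (at s)"
      by (rule has_field_derivative_transform_within_open[where S = "{..<0}"])
        (use False \<open>s \<noteq> 0\<close> in auto)
    then show ?thesis using False by simp
  qed
qed

lemma C1_on_square_pos_part:
  assumes "C1_on S f" shows "C1_on S (\<lambda>x. (max 0 (f x :: real))\<^sup>2)"
proof (rule C1_on_compose[OF assms])
  show "C1_on UNIV (\<lambda>s :: real. (max 0 s)\<^sup>2)"
    by (rule C1_on_real[OF has_real_derivative_square_pos_part]) (intro continuous_intros)
qed simp

section \<open>Determinants and inverses of matrix-valued functions\<close>

lemma C1_on_det [intro]:
  fixes G :: "'a::euclidean_space \<Rightarrow> real^'n^'n::finite"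
  assumes "\<And>i j. C1_on S (\<lambda>x. G x $ i $ j)"
  shows "C1_on S (\<lambda>x. det (G x))"
  unfolding det_def by (intro C1_on_sum C1_on_mult C1_on_prod C1_on_const assms)

lemma matrix_inv_right_left:
  fixes B :: "real^'n^'n::finite"
  assumes "det B \<noteq> 0"
  shows "B ** matrix_inv B = mat 1" and "matrix_inv B ** B = mat 1"
proof -
  have "\<exists>B'. B ** B' = mat 1 \<and> B' ** B = mat 1"
    using assms by (simp add: invertible_det_nz[symmetric] invertible_def)
  from someI_ex[OF this] show "B ** matrix_inv B = mat 1" and "matrix_inv B ** B = mat 1"
    by (simp_all add: matrix_inv_def)
qed

text \<open>By Cramer's rule the entries of the inverse are quotients of polynomials in the entries
  of the matrix, so the inverse metric inherits class C^1 from the closure properties above.\<close>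

lemma matrix_inv_cramer:
  fixes B :: "real^'n^'n::finite"
  assumes "det B \<noteq> 0"
  shows "matrix_inv B $ k $ j = det (\<chi> p q. if q = k then axis j 1 $ p else B $ p $ q) / det B"
proof -
  have "B *v (matrix_inv B *v axis j 1) = axis j 1"
    using matrix_inv_right_left(1)[OF assms] by (simp add: matrix_vector_mul_assoc)
  then have "matrix_inv B *v axis j 1 =
      (\<chi> k. det (\<chi> p q. if q = k then axis j 1 $ p else B $ p $ q) / det B)"
    using cramer[OF assms] by blast
  then have "(matrix_inv B *v axis j 1) $ k = det (\<chi> p q. if q = k then axis j 1 $ p else B $ p $ q) / det B"
    by simp
  then show ?thesis
    by (simp add: matrix_vector_mult_basis column_def)
qed

lemma C1_on_matrix_inv [intro]:
  fixes G :: "'a::euclidean_space \<Rightarrow> real^'n^'n::finite"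
  assumes "\<And>i j. C1_on S (\<lambda>x. G x $ i $ j)" "open S" "\<And>x. x \<in> S \<Longrightarrow> det (G x) \<noteq> 0"
  shows "C1_on S (\<lambda>x. matrix_inv (G x) $ k $ j)"
proof (rule C1_on_cong[OF _ assms(2) matrix_inv_cramer[OF assms(3)]])
  show "C1_on S (\<lambda>x. det (\<chi> p q. if q = k then axis j 1 $ p else G x $ p $ q) / det (G x))"
  proof (intro C1_on_divide C1_on_det assms)
    show "C1_on S (\<lambda>x. (\<chi> p q. if q = k then axis j 1 $ p else G x $ p $ q) $ p $ q)" for p q
      using assms(1) by (cases "q = k") auto
  qed
qed

text \<open>Jacobi's formula. The Leibniz sum differentiates to a sum of determinants in which row i
  is replaced by its derivative. As the matrix is invertible, that row is a combination of the rows
  of \<open>G x\<close>, with coefficients from row i of \<open>G' v ** matrix_inv (G x)\<close>,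
  and the determinant sees only the coefficient of row i itself.\<close>

lemma has_derivative_det:
  fixes G :: "'a::real_normed_vector \<Rightarrow> real^'n^'n::finite"
  assumes G: "\<And>i j. ((\<lambda>x. G x $ i $ j) has_derivative (\<lambda>v. G' v $ i $ j)) (at x)"
    and nz: "det (G x) \<noteq> 0"
  shows "((\<lambda>x. det (G x)) has_derivative
    (\<lambda>v. det (G x) * (\<Sum>i\<in>UNIV. \<Sum>j\<in>UNIV. G' v $ i $ j * matrix_inv (G x) $ j $ i))) (at x)"
proof -
  have row: "(\<Sum>p | p permutes UNIV. of_int (sign p) * (G' v $ i $ p i * (\<Prod>k\<in>UNIV - {i}. G x $ k $ p k)))
      = det (G x) * (\<Sum>j\<in>UNIV. G' v $ i $ j * matrix_inv (G x) $ j $ i)" (is "?L = _") for v i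
  proof -
    let ?c = "\<chi> k. \<Sum>j\<in>UNIV. G' v $ i $ j * matrix_inv (G x) $ j $ k"
    have "(\<Sum>k\<in>UNIV. (\<Sum>j\<in>UNIV. G' v $ i $ j * matrix_inv (G x) $ j $ k) * G x $ k $ l) = G' v $ i $ l" for l
    proof -
      have "(\<Sum>k\<in>UNIV. (\<Sum>j\<in>UNIV. G' v $ i $ j * matrix_inv (G x) $ j $ k) * G x $ k $ l)
        = ((G' v ** matrix_inv (G x)) ** G x) $ i $ l"
        by (simp add: matrix_matrix_mult_def)
      also have "\<dots> = G' v $ i $ l"
        by (simp add: matrix_inv_right_left(2)[OF nz] flip: matrix_mul_assoc)
      finally show ?thesis .
    qed
    then have c: "(\<Sum>k\<in>UNIV. ?c $ k *s row k (G x)) = G' v $ i"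
      by (simp add: vec_eq_iff row_def)
    have "?L = det (\<chi> k. if k = i then G' v $ i else row k (G x))"
      unfolding det_def
    proof (rule sum.cong[OF refl])
      fix p :: "'n \<Rightarrow> 'n"
      show "of_int (sign p) * (G' v $ i $ p i * (\<Prod>k\<in>UNIV - {i}. G x $ k $ p k))
        = of_int (sign p) * (\<Prod>k\<in>UNIV. (\<chi> k. if k = i then G' v $ i else row k (G x)) $ k $ p k)"
        by (subst (2) prod.remove[of _ i]) (auto intro!: prod.cong simp: row_def)
    qed
    also have "\<dots> = det (G x) * ?c $ i"
      using cramer_lemma_transpose[of i ?c "G x"] unfolding c by (simp add: mult.commute)
    finally show ?thesis by simp
  qed
  have "((\<lambda>x. det (G x)) has_derivative
     (\<lambda>v. \<Sum>p | p permutes UNIV. of_int (sign p) *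
        (\<Sum>i\<in>UNIV. G' v $ i $ p i * (\<Prod>k\<in>UNIV - {i}. G x $ k $ p k)))) (at x)"
    unfolding det_def by (auto intro!: derivative_eq_intros G)
  moreover have "(\<Sum>p | p permutes UNIV. of_int (sign p) *
        (\<Sum>i\<in>UNIV. G' v $ i $ p i * (\<Prod>k\<in>UNIV - {i}. G x $ k $ p k)))
      = det (G x) * (\<Sum>i\<in>UNIV. \<Sum>j\<in>UNIV. G' v $ i $ j * matrix_inv (G x) $ j $ i)" for v
    unfolding sum_distrib_left
    by (subst sum.swap) (simp add: row[unfolded sum_distrib_left])
  ultimately show ?thesis by simp
qed

section \<open>Smooth maps and symmetry of second derivatives\<close>

lemma smooth_on_imp_C1_on: "smooth_on S f \<Longrightarrow> C1_on S f"
  unfolding smooth_on_def C1_on_def by (metis Ck_on.simps)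

lemma smooth_on_derivative:
  assumes "smooth_on S f" shows "smooth_on S (\<lambda>x. frechet_derivative f (at x) v)"
  using assms unfolding smooth_on_def by (metis Ck_on.simps(2))

lemma smooth_on_pderiv_vec: "smooth_on S f \<Longrightarrow> smooth_on S (pderiv_vec i f)"
  unfolding pderiv_vec_def[abs_def] by (rule smooth_on_derivative)

text \<open>The mean value theorem is used twice: along \<open>v\<close> for the increment in
  direction \<open>w\<close>, then along \<open>w\<close> for the derivative in direction
  \<open>v\<close>. The left-hand side is symmetric in \<open>v\<close> and \<open>w\<close>, which
  is what makes mixed derivatives agree.\<close>

lemma mixed_difference:
  fixes f :: "'a::real_normed_vector \<Rightarrow> real"
  assumes h: "0 < h"
    and S: "\<And>s t. 0 \<le> s \<Longrightarrow> s \<le> h \<Longrightarrow> 0 \<le> t \<Longrightarrow> t \<le> h \<Longrightarrow> y + s *\<^sub>R v + t *\<^sub>R w \<in> S"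
    and f': "\<And>x. x \<in> S \<Longrightarrow> (f has_derivative f' x) (at x)"
    and f'': "\<And>x. x \<in> S \<Longrightarrow> ((\<lambda>x. f' x v) has_derivative f'' x) (at x)"
  obtains s t where "0 < s" "s < h" "0 < t" "t < h"
    "f (y + h *\<^sub>R v + h *\<^sub>R w) - f (y + h *\<^sub>R v) - f (y + h *\<^sub>R w) + f y
      = h * (h * f'' (y + s *\<^sub>R v + t *\<^sub>R w) w)"
proof -
  have "\<exists>s. 0 < s \<and> s < h \<and>
     (f (y + h *\<^sub>R v + h *\<^sub>R w) - f (y + h *\<^sub>R v + 0 *\<^sub>R w)) - (f (y + 0 *\<^sub>R v + h *\<^sub>R w) - f (y + 0 *\<^sub>R v + 0 *\<^sub>R w))
     = (h - 0) * (f' (y + s *\<^sub>R v + h *\<^sub>R w) v - f' (y + s *\<^sub>R v + 0 *\<^sub>R w) v)"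
  proof (rule MVT2[OF h])
    fix s assume s: "0 \<le> s" "s \<le> h"
    have D: "((\<lambda>s. f (y + s *\<^sub>R v + r *\<^sub>R w)) has_real_derivative f' (y + s *\<^sub>R v + r *\<^sub>R w) v) (at s)"
      if "0 \<le> r" "r \<le> h" for r
    proof -
      have F: "(f has_derivative f' (y + s *\<^sub>R v + r *\<^sub>R w)) (at (y + s *\<^sub>R v + r *\<^sub>R w))"
        using s that by (intro f' S)
      then interpret linear "f' (y + s *\<^sub>R v + r *\<^sub>R w)" by (rule has_derivative_linear)
      have "((\<lambda>s. y + s *\<^sub>R v + r *\<^sub>R w) has_derivative (\<lambda>d. d *\<^sub>R v)) (at s)"
        by (auto intro!: derivative_eq_intros)
      from has_derivative_compose[OF this F] show ?thesis
        by (simp add: has_field_derivative_def scale mult_commute_abs)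
    qed
    show "((\<lambda>s. f (y + s *\<^sub>R v + h *\<^sub>R w) - f (y + s *\<^sub>R v + 0 *\<^sub>R w)) has_real_derivative
        f' (y + s *\<^sub>R v + h *\<^sub>R w) v - f' (y + s *\<^sub>R v + 0 *\<^sub>R w) v) (at s)"
      using h by (intro DERIV_diff D) auto
  qed
  then obtain s where s: "0 < s" "s < h"
    and eq1: "f (y + h *\<^sub>R v + h *\<^sub>R w) - f (y + h *\<^sub>R v) - f (y + h *\<^sub>R w) + f y
      = h * (f' (y + s *\<^sub>R v + h *\<^sub>R w) v - f' (y + s *\<^sub>R v + 0 *\<^sub>R w) v)"
    by auto
  have "\<exists>t. 0 < t \<and> t < h \<and>
     f' (y + s *\<^sub>R v + h *\<^sub>R w) v - f' (y + s *\<^sub>R v + 0 *\<^sub>R w) v = (h - 0) * f'' (y + s *\<^sub>R v + t *\<^sub>R w) w"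
  proof (rule MVT2[OF h])
    fix t assume t: "0 \<le> t" "t \<le> h"
    have F: "((\<lambda>x. f' x v) has_derivative f'' (y + s *\<^sub>R v + t *\<^sub>R w)) (at (y + s *\<^sub>R v + t *\<^sub>R w))"
      using s t by (intro f'' S) auto
    then interpret linear "f'' (y + s *\<^sub>R v + t *\<^sub>R w)" by (rule has_derivative_linear)
    have "((\<lambda>t. y + s *\<^sub>R v + t *\<^sub>R w) has_derivative (\<lambda>d. d *\<^sub>R w)) (at t)"
      by (auto intro!: derivative_eq_intros)
    from has_derivative_compose[OF this F]
    show "((\<lambda>t. f' (y + s *\<^sub>R v + t *\<^sub>R w) v) has_real_derivative f'' (y + s *\<^sub>R v + t *\<^sub>R w) w) (at t)"
      by (simp add: has_field_derivative_def scale mult_commute_abs)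
  qed
  then show thesis using that s eq1 by auto
qed

text \<open>Both orders of differentiation express the same second difference over a small
  parallelogram. By continuity each value is within \<open>e\<close> of its value at
  \<open>y\<close>, and \<open>e\<close> is half of the supposed gap.\<close>

lemma mixed_derivatives_eq:
  fixes f :: "'a::euclidean_space \<Rightarrow> real"
  assumes "open S" "y \<in> S"
    and f': "\<And>x. x \<in> S \<Longrightarrow> (f has_derivative f' x) (at x)"
    and fv: "\<And>x. x \<in> S \<Longrightarrow> ((\<lambda>x. f' x v) has_derivative fv x) (at x)"
    and fw: "\<And>x. x \<in> S \<Longrightarrow> ((\<lambda>x. f' x w) has_derivative fw x) (at x)"
    and cv: "continuous_on S (\<lambda>x. fv x w)" and cw: "continuous_on S (\<lambda>x. fw x v)"
  shows "fv y w = fw y v"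
proof (rule ccontr)
  assume ne: "fv y w \<noteq> fw y v"
  define e where "e = \<bar>fv y w - fw y v\<bar> / 2"
  have e: "e > 0" using ne by (simp add: e_def)
  have "isCont (\<lambda>x. fv x w) y" "isCont (\<lambda>x. fw x v) y"
    using cv cw assms(1,2) by (auto simp: continuous_on_eq_continuous_at)
  then have lims: "((\<lambda>x. fv x w) \<longlongrightarrow> fv y w) (nhds y)" "((\<lambda>x. fw x v) \<longlongrightarrow> fw y v) (nhds y)"
    unfolding isCont_def tendsto_at_iff_tendsto_nhds[of "\<lambda>x. fv x w"]
      tendsto_at_iff_tendsto_nhds[of "\<lambda>x. fw x v"] by auto
  then have "\<forall>\<^sub>F x in nhds y. x \<in> S \<and> dist (fv x w) (fv y w) < e \<and> dist (fw x v) (fw y v) < e"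
    using e assms(1,2)
    by (intro eventually_conj eventually_nhds_in_open tendstoD lims)
  then obtain r where r: "r > 0" "\<And>x. dist x y < r \<Longrightarrow> x \<in> S \<and> dist (fv x w) (fv y w) < e \<and> dist (fw x v) (fw y v) < e"
    unfolding eventually_nhds_metric by auto
  \<comment> \<open>With sides \<open>h *\<^sub>R v\<close> and \<open>h *\<^sub>R w\<close> the
    parallelogram stays within \<open>h * c = r / 2\<close> of \<open>y\<close>; the summand 1 keeps
    \<open>c\<close> positive if both directions vanish.\<close>
  define c where "c = norm v + norm w + 1"
  define h where "h = r / (2 * c)"
  have pos: "c > 0" by (simp add: c_def add_nonneg_pos)
  then have h: "h > 0" using r by (simp add: h_def)
  have near: "dist (y + s *\<^sub>R v + t *\<^sub>R w) y < r" if "0 \<le> s" "s \<le> h" "0 \<le> t" "t \<le> h" for s t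
  proof -
    have "dist (y + s *\<^sub>R v + t *\<^sub>R w) y \<le> s * norm v + t * norm w"
      using norm_triangle_ineq[of "s *\<^sub>R v" "t *\<^sub>R w"] that by (simp add: dist_norm algebra_simps)
    also have "\<dots> \<le> h * norm v + h * norm w"
      using that by (intro add_mono mult_right_mono) auto
    also have "\<dots> \<le> h * c" using h by (simp add: c_def algebra_simps)
    also have "\<dots> = r / 2" using pos by (simp add: h_def)
    finally show ?thesis using r by simp
  qed
  have near': "dist (y + t *\<^sub>R w + s *\<^sub>R v) y < r" if "0 \<le> s" "s \<le> h" "0 \<le> t" "t \<le> h" for s t
    using near[OF that] by (simp add: ac_simps)
  obtain s t where st: "0 < s" "s < h" "0 < t" "t < h"
    "f (y + h *\<^sub>R v + h *\<^sub>R w) - f (y + h *\<^sub>R v) - f (y + h *\<^sub>R w) + f y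
      = h * (h * fv (y + s *\<^sub>R v + t *\<^sub>R w) w)"
  proof (rule mixed_difference[OF h, where S = S and f = f and f' = f' and f'' = fv and y = y and v = v and w = w])
    show "y + s *\<^sub>R v + t *\<^sub>R w \<in> S" if "0 \<le> s" "s \<le> h" "0 \<le> t" "t \<le> h" for s t
      using near[OF that] r(2) by blast
  qed (use f' fv in auto)
  obtain t' s' where st': "0 < t'" "t' < h" "0 < s'" "s' < h"
    "f (y + h *\<^sub>R w + h *\<^sub>R v) - f (y + h *\<^sub>R w) - f (y + h *\<^sub>R v) + f y
      = h * (h * fw (y + t' *\<^sub>R w + s' *\<^sub>R v) v)"
  proof (rule mixed_difference[OF h, where S = S and f = f and f' = f' and f'' = fw and y = y and v = w and w = v])
    show "y + t *\<^sub>R w + s *\<^sub>R v \<in> S" if "0 \<le> t" "t \<le> h" "0 \<le> s" "s \<le> h" for t s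
      using near'[OF that(3,4,1,2)] r(2) by blast
  qed (use f' fw in auto)
  have "h * (h * fv (y + s *\<^sub>R v + t *\<^sub>R w) w) = h * (h * fw (y + t' *\<^sub>R w + s' *\<^sub>R v) v)"
    unfolding st(5)[symmetric] st'(5)[symmetric] by (simp add: ac_simps)
  then have eq: "fw (y + t' *\<^sub>R w + s' *\<^sub>R v) v = fv (y + s *\<^sub>R v + t *\<^sub>R w) w" using h by simp
  have "dist (fv (y + s *\<^sub>R v + t *\<^sub>R w) w) (fv y w) < e"
    using r(2) near st by (meson less_imp_le)
  moreover have "dist (fv (y + s *\<^sub>R v + t *\<^sub>R w) w) (fw y v) < e"
    unfolding eq[symmetric] using r(2) near' st' by (meson less_imp_le)
  ultimately have "dist (fv y w) (fw y v) < 2 * e"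
    using dist_triangle3[of "fv y w" "fw y v" "fv (y + s *\<^sub>R v + t *\<^sub>R w) w"] by linarith
  then show False by (simp add: e_def dist_real_def)
qed

lemma pderiv_vec_commute:
  fixes X :: "real^'n::finite \<Rightarrow> 'b::euclidean_space"
  assumes X: "smooth_on S X" and S: "open S" "y \<in> S"
  shows "pderiv_vec i (pderiv_vec j X) y = pderiv_vec j (pderiv_vec i X) y"
proof (rule euclidean_eqI)
  fix b :: 'b
  have d: "(pderiv_vec k X has_derivative frechet_derivative (pderiv_vec k X) (at x)) (at x)"
    if "x \<in> S" for k x
    using C1_on_has_derivative[OF smooth_on_imp_C1_on[OF smooth_on_pderiv_vec[OF X]] that] .
  have d': "((\<lambda>x. frechet_derivative X (at x) (axis k 1) \<bullet> b) has_derivative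
      (\<lambda>v. frechet_derivative (pderiv_vec k X) (at x) v \<bullet> b)) (at x)" if "x \<in> S" for k x
    using bounded_linear.has_derivative[OF bounded_linear_inner_left d[OF that]]
    by (simp add: pderiv_vec_def[abs_def])
  have c: "continuous_on S (\<lambda>x. frechet_derivative (pderiv_vec k X) (at x) v \<bullet> b)" for k v
    by (intro continuous_intros C1_on_continuous_derivative smooth_on_imp_C1_on smooth_on_pderiv_vec X)
  show "pderiv_vec i (pderiv_vec j X) y \<bullet> b = pderiv_vec j (pderiv_vec i X) y \<bullet> b"
    using mixed_derivatives_eq[OF S, of "\<lambda>x. X x \<bullet> b" "\<lambda>x v. frechet_derivative X (at x) v \<bullet> b", OF _ d' d' c c]
      bounded_linear.has_derivative[OF bounded_linear_inner_left C1_on_has_derivative[OF smooth_on_imp_C1_on[OF X]]]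
    by (auto simp: pderiv_vec_def[of _ "pderiv_vec _ X"])
qed

section \<open>Derivatives of compactly supported functions integrate to zero\<close>

lemma frechet_derivative_eq_0:
  assumes "open S" "x \<in> S" "\<And>y. y \<in> S \<Longrightarrow> f y = 0"
  shows "frechet_derivative f (at x) = (\<lambda>_. 0)"
proof -
  have "(f has_derivative (\<lambda>_. 0)) (at x)"
    by (rule has_derivative_transform_within_open[OF has_derivative_const[of 0] assms(1,2)])
      (simp add: assms(3))
  then show ?thesis by (metis frechet_derivative_at)
qed

text \<open>By translation invariance the difference quotients of \<open>h\<close> in direction \<open>e\<close> have integral \<open>0\<close>.\<close>

lemma integral_derivative_eq_0:
  fixes h :: "'a::euclidean_space \<Rightarrow> real"
  assumes h: "C1_on UNIV h" and K: "compact K" and out: "\<And>x. x \<notin> K \<Longrightarrow> h x = 0"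
  shows "integrable lborel (\<lambda>x. frechet_derivative h (at x) e)"
    and "(\<integral>x. frechet_derivative h (at x) e \<partial>lborel) = 0"
proof -
  define D where "D = (\<lambda>x. frechet_derivative h (at x) e)"
  have cont: "continuous_on UNIV D" and conth: "continuous_on UNIV h"
    using h C1_on_continuous_derivative C1_on_continuous_on unfolding D_def by auto
  have D0: "D x = 0" if "x \<notin> K" for x
    using frechet_derivative_eq_0[of "- K" x h] out that K
    by (simp add: D_def compact_imp_closed open_Compl)
  have int_cs: "integrable lborel g" if "continuous_on UNIV g" "\<And>x. x \<notin> K \<Longrightarrow> g x = 0" for g :: "'a \<Rightarrow> real"
  proof -
    have "integrable lborel (\<lambda>x. indicator K x *\<^sub>R g x)"
      using that K by (intro borel_integrable_compact) (auto intro: continuous_on_subset)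
    also have "(\<lambda>x. indicator K x *\<^sub>R g x) = g" using that(2) by (auto simp: indicator_def fun_eq_iff)
    finally show ?thesis .
  qed
  have intD: "integrable lborel D" and inth: "integrable lborel h"
    using int_cs cont conth D0 out by auto
  \<comment> \<open>All quotients below have step size in (0, 1], so this compact set contains the
    support of each of them. On it the mean value theorem bounds them by \<open>B\<close>, which
    yields a dominating function.\<close>
  define K' where "K' = (\<lambda>(x, s). x - s *\<^sub>R e) ` (K \<times> {0..1})"
  have K': "compact K'"
    unfolding K'_def case_prod_unfold using K
    by (intro compact_continuous_image compact_Times continuous_intros) auto
  obtain B where B: "\<And>x. \<bar>D x\<bar> \<le> B" "0 \<le> B"
  proof -
    have "bounded (D ` K)"
      using K cont by (intro compact_imp_bounded compact_continuous_image) (auto intro: continuous_on_subset)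
    then obtain B where "\<And>x. x \<in> K \<Longrightarrow> \<bar>D x\<bar> \<le> B" by (auto simp: bounded_iff)
    then have "\<bar>D x\<bar> \<le> max B 0" for x using D0[of x] by (cases "x \<in> K") (auto simp: le_max_iff_disj)
    then show ?thesis using that[of "max B 0"] by auto
  qed
  define q where "q = (\<lambda>n x. (h (x + inverse (real (Suc n)) *\<^sub>R e) - h x) / inverse (real (Suc n)))"
  have line: "((\<lambda>s. h (x + s *\<^sub>R e)) has_real_derivative D (x + s *\<^sub>R e)) (at s)" for x s
  proof -
    have F: "(h has_derivative frechet_derivative h (at (x + s *\<^sub>R e))) (at (x + s *\<^sub>R e))"
      using h by (rule C1_on_has_derivative) simp
    then interpret linear "frechet_derivative h (at (x + s *\<^sub>R e))" by (rule has_derivative_linear)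
    have "((\<lambda>s. x + s *\<^sub>R e) has_derivative (\<lambda>d. d *\<^sub>R e)) (at s)"
      by (auto intro!: derivative_eq_intros)
    from has_derivative_compose[OF this F] show ?thesis
      by (simp add: has_field_derivative_def scale mult_commute_abs D_def)
  qed
  have lim: "(\<lambda>n. q n x) \<longlonglongrightarrow> D x" for x
  proof -
    have "((\<lambda>s. (h (x + s *\<^sub>R e) - h x) / s) \<longlongrightarrow> D x) (at 0)"
      using line[of x 0] unfolding DERIV_def by simp
    moreover have "filterlim (\<lambda>n. inverse (real (Suc n))) (at 0) sequentially"
      using LIMSEQ_inverse_real_of_nat by (auto simp: filterlim_at)
    ultimately show ?thesis unfolding q_def by (rule filterlim_compose)
  qed
  have bound: "norm (q n x) \<le> B * indicator K' x" for n x
  proof (cases "x \<in> K'")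
    case True
    let ?r = "inverse (real (Suc n))"
    have r: "0 < ?r" by simp
    from MVT2[OF r, of "\<lambda>s. h (x + s *\<^sub>R e)" "\<lambda>s. D (x + s *\<^sub>R e)"] line
    obtain z where "h (x + ?r *\<^sub>R e) - h (x + 0 *\<^sub>R e) = (?r - 0) * D (x + z *\<^sub>R e)" by auto
    then have "q n x = D (x + z *\<^sub>R e)" by (simp add: q_def)
    then show ?thesis using B True by simp
  next
    case False
    have "x \<notin> K" using False unfolding K'_def by (force simp: image_iff)
    moreover have "x + inverse (real (Suc n)) *\<^sub>R e \<notin> K"
    proof
      assume "x + inverse (real (Suc n)) *\<^sub>R e \<in> K"
      then have "x \<in> K'" unfolding K'_def
        by (intro image_eqI[where x = "(x + inverse (real (Suc n)) *\<^sub>R e, inverse (real (Suc n)))"])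
          (auto simp: inverse_le_1_iff)
      with False show False ..
    qed
    ultimately show ?thesis using out False by (simp add: q_def)
  qed
  have intq: "(\<integral>x. q n x \<partial>lborel) = 0" for n
  proof -
    let ?c = "inverse (real (Suc n)) *\<^sub>R e"
    have eq: "distr lborel borel ((+) ?c) = lborel" by (rule lborel_distr_plus)
    have hm: "h \<in> borel_measurable borel" using conth by (rule borel_measurable_continuous_onI)
    have "integrable lborel (\<lambda>x. h (?c + x))"
      using inth hm by (subst (asm) eq[symmetric]) (simp add: integrable_distr_eq)
    moreover have "(\<integral>x. h (?c + x) \<partial>lborel) = (\<integral>x. h x \<partial>lborel)"
      by (subst (2) eq[symmetric]) (simp add: integral_distr hm)
    ultimately show ?thesis
      using inth by (simp add: q_def add.commute)
  qed
  have "(\<lambda>n. \<integral>x. q n x \<partial>lborel) \<longlonglongrightarrow> (\<integral>x. D x \<partial>lborel)"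
  proof (rule integral_dominated_convergence)
    show "integrable lborel (\<lambda>x. B * indicator K' x)"
      using borel_integrable_compact[OF K', of "\<lambda>_. B"] by (simp add: mult.commute)
    show "D \<in> borel_measurable lborel" using intD by auto
    have "h \<in> borel_measurable borel" using conth by (rule borel_measurable_continuous_onI)
    then show "q n \<in> borel_measurable lborel" for n unfolding q_def by measurable
  qed (use lim bound in auto)
  then have "(\<integral>x. D x \<partial>lborel) = 0" unfolding intq by (simp add: LIMSEQ_const_iff)
  then show "integrable lborel (\<lambda>x. frechet_derivative h (at x) e)"
    and "(\<integral>x. frechet_derivative h (at x) e \<partial>lborel) = 0"
    using intD unfolding D_def by auto
qed

section \<open>Linear immersions\<close>

definition gram :: "(real^'n::finite \<Rightarrow> real^'N::finite) \<Rightarrow> real^'n^'n" where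
  "gram L = (\<chi> i j. L (axis i 1) \<bullet> L (axis j 1))"

text \<open>The vector in the range of \<open>L\<close> whose inner product with each
  \<open>L (axis i 1)\<close> is \<open>c i\<close>. Tangential projections and gradients are both
  of this form, so they share one uniqueness argument and one transformation rule.\<close>

definition riesz :: "(real^'n::finite \<Rightarrow> real^'N::finite) \<Rightarrow> ('n \<Rightarrow> real) \<Rightarrow> real^'N" where
  "riesz L c = (\<Sum>i\<in>UNIV. \<Sum>j\<in>UNIV. (matrix_inv (gram L) $ i $ j * c i) *\<^sub>R L (axis j 1))"

lemma metric_coeff_gram: "metric_coeff X y = gram (frechet_derivative X (at y))"
  by (simp add: metric_coeff_def gram_def pderiv_vec_def)

lemma tangential_local_riesz:
  "tangential_local X y v = riesz (frechet_derivative X (at y)) (\<lambda>i. v \<bullet> frechet_derivative X (at y) (axis i 1))"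
  by (simp add: tangential_local_def riesz_def inv_metric_def metric_coeff_gram pderiv_vec_def)

lemma gradient_local_riesz:
  "gradient_local X u y = riesz (frechet_derivative X (at y)) (\<lambda>i. frechet_derivative u (at y) (axis i 1))"
  by (simp add: gradient_local_def riesz_def inv_metric_def metric_coeff_gram pderiv_vec_def)

lemma linear_axis_expansion:
  fixes L :: "real^'n::finite \<Rightarrow> 'b::real_vector"
  assumes "linear L" shows "L w = (\<Sum>i\<in>UNIV. w $ i *\<^sub>R L (axis i 1))"
proof -
  interpret linear L by fact
  have "w = (\<Sum>i\<in>UNIV. w $ i *\<^sub>R axis i 1)"
    using basis_expansion[of w] by (simp add: scalar_mult_eq_scaleR)
  then have "L w = L (\<Sum>i\<in>UNIV. w $ i *\<^sub>R axis i 1)" by simp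
  then show ?thesis by (simp add: sum scale)
qed

lemma matrix_inv_eqI:
  fixes B C :: "real^'n^'n::finite"
  assumes "B ** C = mat 1" shows "matrix_inv B = C"
proof -
  have "det B \<noteq> 0" using assms by (metis det_I det_mul mult_zero_left zero_neq_one)
  then show ?thesis
    by (metis assms matrix_inv_right_left(2) matrix_mul_assoc matrix_mul_lid matrix_mul_rid)
qed

lemma matrix_inv_symmetric:
  fixes B :: "real^'n^'n::finite"
  assumes "transpose B = B" "det B \<noteq> 0" shows "matrix_inv B $ i $ j = matrix_inv B $ j $ i"
proof -
  have "B ** transpose (matrix_inv B) = mat 1"
    using matrix_inv_right_left(2)[OF assms(2)] assms(1)
    by (metis matrix_transpose_mul transpose_mat)
  then have "matrix_inv B = transpose (matrix_inv B)" by (rule matrix_inv_eqI)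
  from arg_cong[OF this, of "\<lambda>C. C $ i $ j"] show ?thesis by (simp add: transpose_def)
qed

locale linear_immersion =
  fixes L :: "real^'n::finite \<Rightarrow> real^'N::finite"
  assumes linear: "linear L" and inj: "inj L"
begin

lemma gram_quadratic: "w \<bullet> (gram L *v w) = L w \<bullet> L w"
proof -
  have "w \<bullet> (gram L *v w) = (\<Sum>i\<in>UNIV. \<Sum>j\<in>UNIV. w $ i * (gram L $ i $ j * w $ j))"
    by (simp add: inner_vec_def matrix_vector_mult_def sum_distrib_left)
  also have "\<dots> = L w \<bullet> L w"
    unfolding linear_axis_expansion[OF linear, of w]
    by (simp add: gram_def inner_sum_left inner_sum_right sum_distrib_left ac_simps inner_commute)
  finally show ?thesis .
qed

lemma det_gram_pos: "0 < det (gram L)"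
proof -
  \<comment> \<open>no convex combination of the identity and the Gram matrix is singular\<close>
  have nz: "det ((1 - s) *\<^sub>R mat 1 + s *\<^sub>R gram L) \<noteq> 0" if s: "0 \<le> s" "s \<le> 1" for s
  proof
    assume "det ((1 - s) *\<^sub>R mat 1 + s *\<^sub>R gram L) = 0"
    then obtain w where w: "w \<noteq> 0" "((1 - s) *\<^sub>R mat 1 + s *\<^sub>R gram L) *v w = 0"
      by (metis invertible_det_nz matrix_left_invertible_ker invertible_left_inverse)
    have "0 = w \<bullet> (((1 - s) *\<^sub>R mat 1 + s *\<^sub>R gram L) *v w)" using w by simp
    also have "\<dots> = (1 - s) * (w \<bullet> w) + s * (L w \<bullet> L w)"
      by (simp add: matrix_vector_mult_add_rdistrib scaleR_matrix_vector_assoc[symmetric]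
          inner_add_right gram_quadratic)
    finally have eq: "(1 - s) * (w \<bullet> w) + s * (L w \<bullet> L w) = 0" by simp
    have "L w \<noteq> 0" using w(1) inj linear by (metis injD linear_0)
    then have "0 < L w \<bullet> L w" "0 < w \<bullet> w" using w by auto
    moreover have "0 \<le> (1 - s) * (w \<bullet> w)" "0 \<le> s * (L w \<bullet> L w)" using s by auto
    ultimately have "(1 - s) * (w \<bullet> w) = 0" "s * (L w \<bullet> L w) = 0" using eq by linarith+
    with \<open>0 < L w \<bullet> L w\<close> \<open>0 < w \<bullet> w\<close> show False by auto
  qed
  \<comment> \<open>The determinant equals 1 at the identity, so a nonpositive value at the Gram
    matrix would force a zero on the segment between them.\<close>
  have cont: "continuous_on {0..1} (\<lambda>s. det ((1 - s) *\<^sub>R mat 1 + s *\<^sub>R gram L))"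
    unfolding det_def by (auto intro!: continuous_intros)
  show ?thesis
  proof (rule ccontr)
    assume "\<not> 0 < det (gram L)"
    then have "\<exists>s\<ge>0. s \<le> 1 \<and> det ((1 - s) *\<^sub>R mat 1 + s *\<^sub>R gram L) = 0"
      using IVT2'[OF _ _ _ cont, of 0] by auto
    then show False using nz by blast
  qed
qed

lemma det_gram_nz: "det (gram L) \<noteq> 0"
  using det_gram_pos by simp

lemma gram_sym: "transpose (gram L) = gram L"
  by (simp add: gram_def transpose_def inner_commute)

lemma matrix_inv_gram:
  "(\<Sum>j\<in>UNIV. matrix_inv (gram L) $ i $ j * (L (axis j 1) \<bullet> L (axis k 1))) = of_bool (i = k)"
  using arg_cong[OF matrix_inv_right_left(2)[OF det_gram_nz], of "\<lambda>B. B $ i $ k"]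
  by (simp add: matrix_matrix_mult_def gram_def mat_def)

lemma riesz_eq: "riesz L c = L (\<chi> j. \<Sum>i\<in>UNIV. matrix_inv (gram L) $ i $ j * c i)"
  unfolding riesz_def
  by (subst linear_axis_expansion[OF linear], subst sum.swap) (simp add: scaleR_sum_left)

lemma riesz_range: "riesz L c \<in> range L"
  unfolding riesz_eq by simp

lemma riesz_inner_axis: "riesz L c \<bullet> L (axis k 1) = c k"
proof -
  have "riesz L c \<bullet> L (axis k 1)
    = (\<Sum>i\<in>UNIV. c i * (\<Sum>j\<in>UNIV. matrix_inv (gram L) $ i $ j * (L (axis j 1) \<bullet> L (axis k 1))))"
    by (simp add: riesz_def inner_sum_left sum_distrib_left mult.assoc mult.left_commute)
  also have "\<dots> = c k"
    unfolding matrix_inv_gram by (simp add: of_bool_def if_distrib sum.delta cong: if_cong)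
  finally show ?thesis .
qed

lemma riesz_inner: "riesz L c \<bullet> L w = (\<Sum>i\<in>UNIV. c i * w $ i)"
  by (subst linear_axis_expansion[OF linear])
    (simp add: inner_sum_right riesz_inner_axis mult.commute)

text \<open>The difference of two candidates lies in the range of \<open>L\<close> and is orthogonal
  to it, hence to itself.\<close>

lemma riesz_unique:
  assumes "p \<in> range L" "\<And>i. p \<bullet> L (axis i 1) = c i"
  shows "p = riesz L c"
proof -
  obtain a b where ab: "p = L a" "riesz L c = L b" using assms(1) riesz_range[of c] by auto
  have eq: "p - riesz L c = L (a - b)" using ab linear by (simp add: linear_diff)
  have "(p - riesz L c) \<bullet> L w = 0" for w
    by (subst linear_axis_expansion[OF linear])
      (simp add: inner_sum_right inner_diff_left riesz_inner_axis assms(2))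
  from this[of "a - b"] show ?thesis unfolding eq[symmetric] by simp
qed

lemma riesz_add: "riesz L (\<lambda>i. c i + d i) = riesz L c + riesz L d"
  by (simp add: riesz_def sum.distrib algebra_simps)

lemma riesz_scale: "riesz L (\<lambda>i. r * c i) = r *\<^sub>R riesz L c"
  by (simp add: riesz_def scaleR_sum_right mult.left_commute)

text \<open>The orthogonal projection onto the complement of the range of \<open>L\<close>: the
  subtracted vector has the same inner products with that range as \<open>v\<close>.\<close>

definition nrm :: "real^'N \<Rightarrow> real^'N" where
  "nrm v = v - riesz L (\<lambda>i. v \<bullet> L (axis i 1))"

lemma linear_nrm: "linear nrm"
  unfolding nrm_def
  by (rule linearI) (simp_all add: inner_add_left riesz_add riesz_scale algebra_simps)

lemma nrm_range [simp]: "nrm (L w) = 0"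
  unfolding nrm_def using riesz_unique[of "L w" "\<lambda>i. L w \<bullet> L (axis i 1)"] by simp

lemma nrm_orthogonal: "nrm v \<bullet> L w = 0"
proof -
  have "nrm v \<bullet> L (axis i 1) = 0" for i by (simp add: nrm_def inner_diff_left riesz_inner_axis)
  then show ?thesis by (subst linear_axis_expansion[OF linear]) (simp add: inner_sum_right)
qed

lemma nrm_inner: "nrm v \<bullet> w = nrm v \<bullet> nrm w"
  using riesz_range[of "\<lambda>i. w \<bullet> L (axis i 1)"] nrm_orthogonal[of v]
  by (auto simp: nrm_def[of w] inner_diff_right)

lemma nrm_self_adjoint: "nrm v \<bullet> w = v \<bullet> nrm w"
  by (metis nrm_inner inner_commute)

section \<open>Change of basis in the domain\<close>

lemma linear_immersion_comp:
  fixes T :: "real^'n \<Rightarrow> real^'n"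
  assumes "linear T" "inj T" shows "linear_immersion (\<lambda>v. L (T v))"
  using linear_compose[OF assms(1) linear] assms(2) inj
  unfolding linear_immersion_def by (auto simp: inj_def o_def)

lemma gram_comp:
  fixes T :: "real^'n \<Rightarrow> real^'n"
  assumes "linear T" shows "gram (\<lambda>v. L (T v)) = transpose (matrix T) ** gram L ** matrix T"
proof -
  have "L (T (axis i 1)) \<bullet> L (T (axis j 1))
     = (\<Sum>k\<in>UNIV. (\<Sum>l\<in>UNIV. T (axis i 1) $ l * (L (axis l 1) \<bullet> L (axis k 1))) * T (axis j 1) $ k)" for i j
    unfolding linear_axis_expansion[OF linear, of "T _"]
    by (simp add: inner_sum_left inner_sum_right sum_distrib_right sum_distrib_left ac_simps)
  then show ?thesis
    by (simp add: gram_def vec_eq_iff matrix_matrix_mult_def transpose_def matrix_def)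
qed

lemma det_gram_comp:
  fixes T :: "real^'n \<Rightarrow> real^'n"
  assumes "linear T" shows "det (gram (\<lambda>v. L (T v))) = (det (matrix T))\<^sup>2 * det (gram L)"
  by (simp add: gram_comp[OF assms] det_mul det_transpose power2_eq_square)

text \<open>The contravariance of the inverse metric. With M the matrix of \<open>T\<close> and G, H
  the old and new Gram matrices, \<open>H = M\<^sup>T G M\<close>. Multiplying
  \<open>G M H\<^sup>-\<^sup>1 M\<^sup>T\<close> by \<open>M\<^sup>T\<close> on the left therefore
  gives \<open>M\<^sup>T\<close>, and cancelling this invertible factor shows that
  \<open>M H\<^sup>-\<^sup>1 M\<^sup>T\<close> inverts G.\<close>

lemma matrix_inv_gram_comp:
  fixes T :: "real^'n \<Rightarrow> real^'n"
  assumes T: "linear T" "inj T"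
  shows "matrix T ** matrix_inv (gram (\<lambda>v. L (T v))) ** transpose (matrix T) = matrix_inv (gram L)"
proof -
  let ?M = "matrix T" and ?H = "gram (\<lambda>v. L (T v))"
  interpret LT: linear_immersion "\<lambda>v. L (T v)" using T by (rule linear_immersion_comp)
  have "det ?M \<noteq> 0" using T by (simp add: det_nz_iff_inj)
  then have 1: "transpose ?M ** matrix_inv (transpose ?M) = mat 1" "matrix_inv (transpose ?M) ** transpose ?M = mat 1"
    by (simp_all add: matrix_inv_right_left)
  have "transpose ?M ** (gram L ** (?M ** matrix_inv ?H ** transpose ?M))
    = (?H ** matrix_inv ?H) ** transpose ?M"
    unfolding gram_comp[OF T(1)] by (simp only: matrix_mul_assoc)
  also have "\<dots> = transpose ?M" by (simp add: matrix_inv_right_left LT.det_gram_nz)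
  finally have "matrix_inv (transpose ?M) ** (transpose ?M ** (gram L ** (?M ** matrix_inv ?H ** transpose ?M)))
    = mat 1" by (simp add: 1)
  then have "gram L ** (?M ** matrix_inv ?H ** transpose ?M) = mat 1"
    by (simp add: matrix_mul_assoc 1)
  then show ?thesis by (metis matrix_inv_eqI)
qed

text \<open>The metric trace of a bilinear form does not depend on the coordinates. Once the four
  sums are reordered, the coefficient of \<open>b k l\<close> is an entry of the product in
  \<open>matrix_inv_gram_comp\<close>. Vector values are allowed because the second fundamental form
  is vector-valued.\<close>

lemma trace_comp:
  fixes T :: "real^'n \<Rightarrow> real^'n"
    and b :: "'n \<Rightarrow> 'n \<Rightarrow> 'b::real_vector"
  assumes T: "linear T" "inj T"
  shows "(\<Sum>i\<in>UNIV. \<Sum>j\<in>UNIV. matrix_inv (gram (\<lambda>v. L (T v))) $ i $ j *\<^sub>R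
      (\<Sum>k\<in>UNIV. \<Sum>l\<in>UNIV. (T (axis i 1) $ k * T (axis j 1) $ l) *\<^sub>R b k l))
    = (\<Sum>k\<in>UNIV. \<Sum>l\<in>UNIV. matrix_inv (gram L) $ k $ l *\<^sub>R b k l)" (is "?lhs = _")
proof -
  let ?H = "matrix_inv (gram (\<lambda>v. L (T v)))"
  have "?lhs = (\<Sum>i\<in>UNIV. \<Sum>j\<in>UNIV. \<Sum>k\<in>UNIV. \<Sum>l\<in>UNIV.
       (?H $ i $ j * (T (axis i 1) $ k * T (axis j 1) $ l)) *\<^sub>R b k l)"
    by (simp add: scaleR_sum_right)
  also have "\<dots> = (\<Sum>i\<in>UNIV. \<Sum>k\<in>UNIV. \<Sum>j\<in>UNIV. \<Sum>l\<in>UNIV.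
       (?H $ i $ j * (T (axis i 1) $ k * T (axis j 1) $ l)) *\<^sub>R b k l)"
    by (rule sum.cong[OF refl], rule sum.swap)
  also have "\<dots> = (\<Sum>k\<in>UNIV. \<Sum>i\<in>UNIV. \<Sum>j\<in>UNIV. \<Sum>l\<in>UNIV.
       (?H $ i $ j * (T (axis i 1) $ k * T (axis j 1) $ l)) *\<^sub>R b k l)"
    by (rule sum.swap)
  also have "\<dots> = (\<Sum>k\<in>UNIV. \<Sum>i\<in>UNIV. \<Sum>l\<in>UNIV. \<Sum>j\<in>UNIV.
       (?H $ i $ j * (T (axis i 1) $ k * T (axis j 1) $ l)) *\<^sub>R b k l)"
    by (rule sum.cong[OF refl], rule sum.cong[OF refl], rule sum.swap)
  also have "\<dots> = (\<Sum>k\<in>UNIV. \<Sum>l\<in>UNIV. \<Sum>i\<in>UNIV. \<Sum>j\<in>UNIV.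
       (?H $ i $ j * (T (axis i 1) $ k * T (axis j 1) $ l)) *\<^sub>R b k l)"
    by (rule sum.cong[OF refl], rule sum.swap)
  also have "\<dots> = (\<Sum>k\<in>UNIV. \<Sum>l\<in>UNIV. \<Sum>j\<in>UNIV. \<Sum>i\<in>UNIV.
       (?H $ i $ j * (T (axis i 1) $ k * T (axis j 1) $ l)) *\<^sub>R b k l)"
    by (rule sum.cong[OF refl], rule sum.cong[OF refl], rule sum.swap)
  also have "\<dots> = (\<Sum>k\<in>UNIV. \<Sum>l\<in>UNIV. (matrix T ** ?H ** transpose (matrix T)) $ k $ l *\<^sub>R b k l)"
    by (simp add: matrix_matrix_mult_def transpose_def matrix_def scaleR_sum_left sum_distrib_right
        sum_distrib_left ac_simps)
  also have "\<dots> = (\<Sum>k\<in>UNIV. \<Sum>l\<in>UNIV. matrix_inv (gram L) $ k $ l *\<^sub>R b k l)"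
    by (simp add: matrix_inv_gram_comp[OF T])
  finally show ?thesis .
qed

end

section \<open>Parametrized submanifolds\<close>

lemma pderiv_vec_eqI: "(f has_derivative f') (at y) \<Longrightarrow> pderiv_vec i f y = f' (axis i 1)"
  unfolding pderiv_vec_def by (metis frechet_derivative_at)

locale param_immersion =
  fixes V :: "(real^'n::finite) set" and X :: "real^'n \<Rightarrow> real^'N::finite"
  assumes open_V: "open V" and smooth_X: "smooth_on V X"
    and inj_deriv: "y \<in> V \<Longrightarrow> inj (frechet_derivative X (at y))"
begin

abbreviation "L y \<equiv> frechet_derivative X (at y)"

lemma X_deriv: "y \<in> V \<Longrightarrow> (X has_derivative L y) (at y)"
  by (rule C1_on_has_derivative[OF smooth_on_imp_C1_on[OF smooth_X]])

lemma linear_immersion_L: "y \<in> V \<Longrightarrow> linear_immersion (L y)"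
  using has_derivative_linear[OF X_deriv] inj_deriv by (simp add: linear_immersion_def)

lemma L_axis: "L y (axis i 1) = pderiv_vec i X y"
  by (simp add: pderiv_vec_def)

lemma pX_deriv:
  "y \<in> V \<Longrightarrow> (pderiv_vec i X has_derivative frechet_derivative (pderiv_vec i X) (at y)) (at y)"
  by (rule C1_on_has_derivative[OF smooth_on_imp_C1_on[OF smooth_on_pderiv_vec[OF smooth_X]]])

lemma C1_X: "C1_on V X"
  by (rule smooth_on_imp_C1_on[OF smooth_X])

lemma C1_pX: "C1_on V (pderiv_vec i X)"
  by (rule smooth_on_imp_C1_on[OF smooth_on_pderiv_vec[OF smooth_X]])

lemma continuous_on_ppX: "continuous_on V (pderiv_vec j (pderiv_vec i X))"
  by (intro C1_on_continuous_on smooth_on_imp_C1_on smooth_on_pderiv_vec smooth_X)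

lemma C1_metric: "C1_on V (\<lambda>y. metric_coeff X y $ i $ j)"
  by (simp add: metric_coeff_def) (intro C1_on_inner C1_pX)

lemma det_metric_pos: "y \<in> V \<Longrightarrow> 0 < det (metric_coeff X y)"
  unfolding metric_coeff_gram by (intro linear_immersion.det_gram_pos linear_immersion_L)

lemma C1_volume: "C1_on V (\<lambda>y. sqrt (det (metric_coeff X y)))"
  by (intro C1_on_sqrt C1_on_det C1_metric det_metric_pos)

lemma C1_inv_metric: "C1_on V (\<lambda>y. inv_metric X y $ i $ j)"
  unfolding inv_metric_def
  by (intro C1_on_matrix_inv C1_metric open_V) (use det_metric_pos in force)

lemma inv_metric_gram: "inv_metric X y = matrix_inv (gram (L y))"
  by (simp add: inv_metric_def metric_coeff_gram)

text \<open>The coefficients of the tangential part of the position in the basis of coordinate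
  vectors. Times the volume density they form the vector field in parameter space whose Euclidean
  divergence is computed below.\<close>

definition coord :: "'n \<Rightarrow> real^'n \<Rightarrow> real" where
  "coord j y = (\<Sum>i\<in>UNIV. inv_metric X y $ i $ j * (X y \<bullet> pderiv_vec i X y))"

lemma C1_coord: "C1_on V (coord j)"
  unfolding coord_def[abs_def] by (intro C1_on_sum C1_on_mult C1_inv_metric C1_on_inner C1_X C1_pX)

lemma tangential_coord: "tangential_local X y (X y) = (\<Sum>j\<in>UNIV. coord j y *\<^sub>R pderiv_vec j X y)"
  unfolding tangential_local_def coord_def by (subst sum.swap) (simp add: scaleR_sum_left)

lemma normal_local_nrm: "y \<in> V \<Longrightarrow> normal_local X y v = linear_immersion.nrm (L y) v"
  by (simp add: linear_immersion.nrm_def[OF linear_immersion_L] normal_local_def tangential_local_riesz)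

lemma normal_local_orthogonal:
  assumes "y \<in> V" shows "normal_local X y v \<bullet> L y w = 0"
  by (simp add: assms normal_local_nrm linear_immersion.nrm_orthogonal[OF linear_immersion_L])

lemma tangential_local_coords: 
  assumes "y \<in> V" shows "tangential_local X y (X y) = L y (\<chi> j. coord j y)"
  unfolding tangential_coord
  by (subst linear_axis_expansion[OF linear_immersion.linear[OF linear_immersion_L[OF assms]]])
    (simp add: L_axis)

lemma normal_local_tangential_inner:
  assumes "y \<in> V" shows "normal_local X y v \<bullet> tangential_local X y w = 0"
proof -
  obtain u where "tangential_local X y w = L y u"
    unfolding tangential_local_riesz
    using linear_immersion.riesz_range[OF linear_immersion_L[OF assms]] by blast
  then show ?thesis by (simp add: normal_local_orthogonal[OF assms])
qed

lemma gradient_local_inner: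
  assumes "y \<in> V" "(f has_derivative f') (at y)" shows "gradient_local X f y \<bullet> L y w = f' w"
proof -
  have f': "frechet_derivative f (at y) = f'" using assms(2) by (metis frechet_derivative_at)
  have "f' w = (\<Sum>i\<in>UNIV. w $ i *\<^sub>R f' (axis i 1))"
    by (rule linear_axis_expansion[OF has_derivative_linear[OF assms(2)]])
  then show ?thesis
    unfolding gradient_local_riesz f' linear_immersion.riesz_inner[OF linear_immersion_L[OF assms(1)]]
    by (simp add: mult.commute)
qed

lemma mean_curv_local_nrm:
  assumes "y \<in> V"
  shows "mean_curv_local X y = - (\<Sum>k\<in>UNIV. \<Sum>l\<in>UNIV. matrix_inv (gram (L y)) $ k $ l *\<^sub>R
    linear_immersion.nrm (L y) (pderiv_vec k (pderiv_vec l X) y))"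
  unfolding mean_curv_local_def second_fund_local_def inv_metric_gram normal_local_nrm[OF assms] ..

lemma mean_curv_local_normal:
  assumes "y \<in> V" shows "mean_curv_local X y \<bullet> tangential_local X y w = 0"
  unfolding mean_curv_local_def second_fund_local_def
  by (simp add: inner_sum_left normal_local_tangential_inner[OF assms])

lemma inv_metric_contract:
  assumes "y \<in> V"
  shows "(\<Sum>i\<in>UNIV. inv_metric X y $ k $ i * (pderiv_vec j X y \<bullet> pderiv_vec i X y)) = of_bool (k = j)"
  using linear_immersion.matrix_inv_gram[OF linear_immersion_L[OF assms], of k j]
  by (simp add: inv_metric_gram L_axis inner_commute)

lemma inv_metric_sym: "y \<in> V \<Longrightarrow> inv_metric X y $ i $ j = inv_metric X y $ j $ i"
  unfolding inv_metric_gram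
  by (intro matrix_inv_symmetric linear_immersion.gram_sym linear_immersion.det_gram_nz linear_immersion_L)

text \<open>Jacobi's formula and the chain rule for the root give half the metric trace of the
  derivative of the metric. The product rule splits that derivative into two terms, which contribute
  equally since the inverse metric is symmetric, and this cancels the half.\<close>

lemma pderiv_volume:
  assumes y: "y \<in> V"
  shows "pderiv_vec j (\<lambda>y. sqrt (det (metric_coeff X y))) y = sqrt (det (metric_coeff X y)) *
     (\<Sum>k\<in>UNIV. \<Sum>i\<in>UNIV. inv_metric X y $ k $ i * (pderiv_vec j (pderiv_vec k X) y \<bullet> pderiv_vec i X y))"
proof -
  let ?g = "metric_coeff X y"
  let ?b = "\<lambda>k i. pderiv_vec j (pderiv_vec k X) y \<bullet> pderiv_vec i X y"
  define G' where "G' = (\<lambda>v. \<chi> i k. pderiv_vec i X y \<bullet> frechet_derivative (pderiv_vec k X) (at y) v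
      + frechet_derivative (pderiv_vec i X) (at y) v \<bullet> pderiv_vec k X y)"
  have "((\<lambda>y. metric_coeff X y $ i $ k) has_derivative (\<lambda>v. G' v $ i $ k)) (at y)" for i k
    unfolding metric_coeff_def G'_def by (simp, rule has_derivative_inner) (intro pX_deriv y)+
  then have D: "((\<lambda>y. det (metric_coeff X y)) has_derivative
    (\<lambda>v. det ?g * (\<Sum>i\<in>UNIV. \<Sum>k\<in>UNIV. G' v $ i $ k * inv_metric X y $ k $ i))) (at y)"
    unfolding inv_metric_def using det_metric_pos[OF y] by (intro has_derivative_det) auto
  have G': "G' (axis j 1) $ i $ k = ?b k i + ?b i k" for i k
    by (simp add: G'_def pderiv_vec_def[of _ "pderiv_vec _ X"] inner_commute)
  have "(\<Sum>i\<in>UNIV. \<Sum>k\<in>UNIV. G' (axis j 1) $ i $ k * inv_metric X y $ k $ i)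
    = (\<Sum>i\<in>UNIV. \<Sum>k\<in>UNIV. inv_metric X y $ k $ i * ?b k i)
      + (\<Sum>i\<in>UNIV. \<Sum>k\<in>UNIV. inv_metric X y $ i $ k * ?b i k)"
    unfolding G' by (simp add: sum.distrib algebra_simps inv_metric_sym[OF y])
  also have "(\<Sum>i\<in>UNIV. \<Sum>k\<in>UNIV. inv_metric X y $ k $ i * ?b k i)
      = (\<Sum>i\<in>UNIV. \<Sum>k\<in>UNIV. inv_metric X y $ i $ k * ?b i k)"
    by (rule sum.swap)
  finally have eq: "(\<Sum>i\<in>UNIV. \<Sum>k\<in>UNIV. G' (axis j 1) $ i $ k * inv_metric X y $ k $ i)
    = 2 * (\<Sum>i\<in>UNIV. \<Sum>k\<in>UNIV. inv_metric X y $ i $ k * ?b i k)" by simp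
  have "((\<lambda>y. sqrt (det (metric_coeff X y))) has_derivative
    (\<lambda>v. (det ?g * (\<Sum>i\<in>UNIV. \<Sum>k\<in>UNIV. G' v $ i $ k * inv_metric X y $ k $ i)) * (inverse (sqrt (det ?g)) / 2))) (at y)"
    using DERIV_real_sqrt[OF det_metric_pos[OF y]] D
    by (rule DERIV_compose_FDERIV)
  from pderiv_vec_eqI[OF this, of j]
  have "pderiv_vec j (\<lambda>y. sqrt (det (metric_coeff X y))) y
      = det ?g / sqrt (det ?g) * (\<Sum>i\<in>UNIV. \<Sum>k\<in>UNIV. inv_metric X y $ i $ k * ?b i k)"
    unfolding eq by (simp add: field_simps)
  then show ?thesis using det_metric_pos[OF y] by (simp add: real_div_sqrt)
qed

text \<open>The normal part \<open>N\<close> of the position is orthogonal to each \<open>\<partial>\<^sub>i X\<close>; differentiating this relation and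
  contracting with the inverse metric avoids any derivative of the inverse metric.\<close>

lemma divergence_identity:
  assumes y: "y \<in> V"
  shows "(\<Sum>j\<in>UNIV. pderiv_vec j (\<lambda>y. sqrt (det (metric_coeff X y)) * coord j y) y)
    = sqrt (det (metric_coeff X y)) * (real CARD('n) - X y \<bullet> mean_curv_local X y)"
proof -
  let ?E = "\<lambda>i. pderiv_vec i X y" and ?X2 = "\<lambda>k i. pderiv_vec k (pderiv_vec i X) y"
  let ?g = "\<lambda>k i. inv_metric X y $ k $ i" and ?a = "\<lambda>j. coord j y"
  let ?da = "\<lambda>k j. pderiv_vec k (coord j) y" and ?J = "sqrt (det (metric_coeff X y))"
  define N where "N = (\<lambda>z. X z - (\<Sum>j\<in>UNIV. coord j z *\<^sub>R pderiv_vec j X z))"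
  have N: "N z = normal_local X z (X z)" for z
    by (simp add: N_def normal_local_def tangential_coord)
  have dcoord: "(coord j has_derivative frechet_derivative (coord j) (at y)) (at y)" for j
    by (rule C1_on_has_derivative[OF C1_coord y])
  have 1: "?E k \<bullet> ?E i + N y \<bullet> ?X2 k i
      = (\<Sum>j\<in>UNIV. ?da k j * (?E j \<bullet> ?E i)) + (\<Sum>j\<in>UNIV. ?a j * (?X2 k j \<bullet> ?E i))" for k i
  proof -
    have D: "((\<lambda>z. N z \<bullet> pderiv_vec i X z) has_derivative (\<lambda>v. N y \<bullet> frechet_derivative (pderiv_vec i X) (at y) v
      + (L y v - (\<Sum>j\<in>UNIV. coord j y *\<^sub>R frechet_derivative (pderiv_vec j X) (at y) v
        + frechet_derivative (coord j) (at y) v *\<^sub>R pderiv_vec j X y)) \<bullet> pderiv_vec i X y)) (at y)"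
      unfolding N_def
      by (intro has_derivative_inner has_derivative_diff has_derivative_sum has_derivative_scaleR
          dcoord pX_deriv X_deriv y)
    have D0: "((\<lambda>z. N z \<bullet> pderiv_vec i X z) has_derivative (\<lambda>_. 0)) (at y)"
      by (rule has_derivative_transform_within_open[OF has_derivative_const[of 0] open_V y])
        (simp add: N normal_local_orthogonal flip: L_axis)
    have "N y \<bullet> frechet_derivative (pderiv_vec i X) (at y) (axis k 1)
      + (L y (axis k 1) - (\<Sum>j\<in>UNIV. coord j y *\<^sub>R frechet_derivative (pderiv_vec j X) (at y) (axis k 1)
        + frechet_derivative (coord j) (at y) (axis k 1) *\<^sub>R pderiv_vec j X y)) \<bullet> pderiv_vec i X y = 0"
      by (rule fun_cong[OF has_derivative_unique[OF D D0]])
    then show ?thesis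
      by (simp add: L_axis inner_diff_left inner_add_left inner_sum_left sum.distrib
          pderiv_vec_def[of _ "pderiv_vec _ X"] pderiv_vec_def[of _ "coord _"])
  qed
  \<comment> \<open>Contracting \<open>1\<close> gives on the left the dimension and a trace of
    second derivatives against \<open>N\<close>. On the right it gives the divergence of the
    coefficients and, after the order of differentiation is exchanged, the logarithmic derivative of
    the volume density along them.\<close>
  have "(\<Sum>k\<in>UNIV. \<Sum>i\<in>UNIV. ?g k i * (?E k \<bullet> ?E i + N y \<bullet> ?X2 k i))
    = (\<Sum>k\<in>UNIV. \<Sum>i\<in>UNIV. ?g k i * (\<Sum>j\<in>UNIV. ?da k j * (?E j \<bullet> ?E i)))
      + (\<Sum>k\<in>UNIV. \<Sum>i\<in>UNIV. ?g k i * (\<Sum>j\<in>UNIV. ?a j * (?X2 k j \<bullet> ?E i)))"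
    unfolding 1 by (simp add: sum.distrib distrib_left)
  moreover have "(\<Sum>k\<in>UNIV. \<Sum>i\<in>UNIV. ?g k i * (?E k \<bullet> ?E i + N y \<bullet> ?X2 k i))
    = real CARD('n) + N y \<bullet> (\<Sum>k\<in>UNIV. \<Sum>i\<in>UNIV. ?g k i *\<^sub>R ?X2 k i)"
    by (simp add: sum.distrib distrib_left inv_metric_contract[OF y] inner_sum_right)
  moreover have "(\<Sum>k\<in>UNIV. \<Sum>i\<in>UNIV. ?g k i * (\<Sum>j\<in>UNIV. ?da k j * (?E j \<bullet> ?E i)))
    = (\<Sum>k\<in>UNIV. ?da k k)"
  proof (rule sum.cong[OF refl])
    fix k
    have "(\<Sum>i\<in>UNIV. ?g k i * (\<Sum>j\<in>UNIV. ?da k j * (?E j \<bullet> ?E i)))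
      = (\<Sum>i\<in>UNIV. \<Sum>j\<in>UNIV. ?da k j * (?g k i * (?E j \<bullet> ?E i)))"
      by (simp add: sum_distrib_left ac_simps)
    also have "\<dots> = (\<Sum>j\<in>UNIV. ?da k j * (\<Sum>i\<in>UNIV. ?g k i * (?E j \<bullet> ?E i)))"
      by (subst sum.swap) (simp add: sum_distrib_left)
    also have "\<dots> = ?da k k"
      unfolding inv_metric_contract[OF y] by (simp add: of_bool_def if_distrib cong: if_cong)
    finally show "(\<Sum>i\<in>UNIV. ?g k i * (\<Sum>j\<in>UNIV. ?da k j * (?E j \<bullet> ?E i))) = ?da k k" .
  qed
  moreover have "(\<Sum>k\<in>UNIV. \<Sum>i\<in>UNIV. ?g k i * (\<Sum>j\<in>UNIV. ?a j * (?X2 k j \<bullet> ?E i)))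
    = (\<Sum>j\<in>UNIV. ?a j * (\<Sum>k\<in>UNIV. \<Sum>i\<in>UNIV. ?g k i * (?X2 j k \<bullet> ?E i)))"
  proof -
    have "(\<Sum>k\<in>UNIV. \<Sum>i\<in>UNIV. ?g k i * (\<Sum>j\<in>UNIV. ?a j * (?X2 k j \<bullet> ?E i)))
      = (\<Sum>k\<in>UNIV. \<Sum>i\<in>UNIV. \<Sum>j\<in>UNIV. ?a j * (?g k i * (?X2 k j \<bullet> ?E i)))"
      by (simp add: sum_distrib_left ac_simps)
    also have "\<dots> = (\<Sum>k\<in>UNIV. \<Sum>j\<in>UNIV. \<Sum>i\<in>UNIV. ?a j * (?g k i * (?X2 k j \<bullet> ?E i)))"
      by (rule sum.cong[OF refl], rule sum.swap)
    also have "\<dots> = (\<Sum>j\<in>UNIV. \<Sum>k\<in>UNIV. \<Sum>i\<in>UNIV. ?a j * (?g k i * (?X2 k j \<bullet> ?E i)))"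
      by (rule sum.swap)
    finally show ?thesis
      by (simp add: sum_distrib_left pderiv_vec_commute[OF smooth_X open_V y])
  qed
  \<comment> \<open>The normal projection is self-adjoint, so it moves from the position to the
    second derivatives and turns them into the second fundamental form. The minus sign is the
    convention H = -Tr A.\<close>
  moreover have "N y \<bullet> (\<Sum>k\<in>UNIV. \<Sum>i\<in>UNIV. ?g k i *\<^sub>R ?X2 k i) = - (X y \<bullet> mean_curv_local X y)"
  proof -
    interpret Ly: linear_immersion "L y" using y by (rule linear_immersion_L)
    have "N y \<bullet> v = X y \<bullet> Ly.nrm v" for v
      by (simp add: N normal_local_nrm[OF y] Ly.nrm_self_adjoint)
    then show ?thesis
      by (simp add: mean_curv_local_nrm[OF y] linear_sum[OF Ly.linear_nrm] linear_cmul[OF Ly.linear_nrm]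
          inv_metric_gram)
  qed
  moreover define S where "S = (\<lambda>j. \<Sum>k\<in>UNIV. \<Sum>i\<in>UNIV. ?g k i * (?X2 j k \<bullet> ?E i))"
  ultimately have trace: "real CARD('n) - X y \<bullet> mean_curv_local X y
    = (\<Sum>k\<in>UNIV. ?da k k) + (\<Sum>j\<in>UNIV. ?a j * S j)"
    by simp
  have vol: "pderiv_vec j (\<lambda>y. sqrt (det (metric_coeff X y))) y = ?J * S j" for j
    unfolding S_def by (rule pderiv_volume[OF y])
  have "pderiv_vec j (\<lambda>y. sqrt (det (metric_coeff X y)) * coord j y) y = ?J * ?da j j + ?J * S j * ?a j" for j
    unfolding vol[symmetric]
    using pderiv_vec_eqI[OF has_derivative_mult[OF C1_on_has_derivative[OF C1_volume y] dcoord[of j]], of j]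
    by (simp add: pderiv_vec_def)
  then have "(\<Sum>j\<in>UNIV. pderiv_vec j (\<lambda>y. sqrt (det (metric_coeff X y)) * coord j y) y)
    = (\<Sum>j\<in>UNIV. ?J * ?da j j + ?J * S j * ?a j)"
    by simp
  also have "\<dots> = ?J * ((\<Sum>k\<in>UNIV. ?da k k) + (\<Sum>j\<in>UNIV. ?a j * S j))"
    by (simp add: sum.distrib sum_distrib_left distrib_left mult.commute mult.left_commute)
  finally show ?thesis unfolding trace .
qed

lemma divergence_identity_scaled:
  assumes y: "y \<in> V" and f: "C1_on V f"
  shows "(\<Sum>j\<in>UNIV. pderiv_vec j (\<lambda>y. f y * (sqrt (det (metric_coeff X y)) * coord j y)) y)
    = sqrt (det (metric_coeff X y)) * (gradient_local X f y \<bullet> tangential_local X y (X y)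
        + f y * (real CARD('n) - X y \<bullet> mean_curv_local X y))"
proof -
  let ?F = "\<lambda>j y. sqrt (det (metric_coeff X y)) * coord j y"
  have fd: "(f has_derivative frechet_derivative f (at y)) (at y)"
    by (rule C1_on_has_derivative[OF f y])
  have "C1_on V (?F j)" for j
    by (intro C1_on_mult C1_volume C1_coord)
  then have "pderiv_vec j (\<lambda>y. f y * ?F j y) y = f y * pderiv_vec j (?F j) y + pderiv_vec j f y * ?F j y" for j
    using pderiv_vec_eqI[OF has_derivative_mult[OF fd C1_on_has_derivative[OF _ y]], of "?F j" j]
    by (simp add: pderiv_vec_def)
  then have "(\<Sum>j\<in>UNIV. pderiv_vec j (\<lambda>y. f y * ?F j y) y)
    = f y * (\<Sum>j\<in>UNIV. pderiv_vec j (?F j) y) + sqrt (det (metric_coeff X y)) * (\<Sum>j\<in>UNIV. coord j y * pderiv_vec j f y)"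
    by (simp add: sum.distrib sum_distrib_left ac_simps)
  moreover have "gradient_local X f y \<bullet> tangential_local X y (X y) = (\<Sum>j\<in>UNIV. coord j y * pderiv_vec j f y)"
    unfolding tangential_local_coords[OF y] gradient_local_inner[OF y fd]
    by (subst linear_axis_expansion[OF has_derivative_linear[OF fd]]) (simp add: pderiv_vec_def)
  ultimately show ?thesis
    unfolding divergence_identity[OF y] by (simp add: algebra_simps)
qed

section \<open>Continuity of the local quantities\<close>

lemma continuous_on_normal_local:
  assumes "continuous_on V v" shows "continuous_on V (\<lambda>y. normal_local X y (v y))"
  unfolding normal_local_def tangential_local_def
  by (rule continuous_on_diff[OF assms], rule continuous_on_sum, rule continuous_on_sum,
      rule continuous_on_scaleR, rule continuous_on_mult[OF C1_on_continuous_on[OF C1_inv_metric]],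
      rule continuous_on_inner[OF assms]) (rule C1_on_continuous_on[OF C1_pX])+

lemma continuous_on_mean_curv_local: "continuous_on V (mean_curv_local X)"
  unfolding mean_curv_local_def second_fund_local_def
  by (rule continuous_on_minus, rule continuous_on_sum, rule continuous_on_sum,
      rule continuous_on_scaleR[OF C1_on_continuous_on[OF C1_inv_metric]],
      rule continuous_on_normal_local, rule continuous_on_ppX)

lemma continuous_on_gradient_local:
  assumes "C1_on V f" shows "continuous_on V (gradient_local X f)"
  unfolding gradient_local_def pderiv_vec_def[of _ f]
  by (rule continuous_on_sum, rule continuous_on_sum, rule continuous_on_scaleR,
      rule continuous_on_mult[OF C1_on_continuous_on[OF C1_inv_metric]],
      rule C1_on_continuous_derivative[OF assms], rule C1_on_continuous_on[OF C1_pX])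

end

section \<open>Change of the local parametrization\<close>

locale reparametrization = X: param_immersion V X + Y: param_immersion W Y
  for V :: "(real^'n::finite) set" and X :: "real^'n \<Rightarrow> real^'N::finite" and W and Y :: "real^'n \<Rightarrow> real^'N" +
  fixes U :: "(real^'n) set" and \<tau> :: "real^'n \<Rightarrow> real^'n"
  assumes open_U: "open U" and UW: "U \<subseteq> W" and \<tau>_UV: "\<tau> ` U \<subseteq> V" and smooth_\<tau>: "smooth_on U \<tau>"
    and Y_eq: "z \<in> U \<Longrightarrow> Y z = X (\<tau> z)"
begin

abbreviation "T y \<equiv> frechet_derivative \<tau> (at y)"

lemma \<tau>_deriv: "y \<in> U \<Longrightarrow> (\<tau> has_derivative T y) (at y)"
  by (rule C1_on_has_derivative[OF smooth_on_imp_C1_on[OF smooth_\<tau>]])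

lemma \<tau>_in: "y \<in> U \<Longrightarrow> \<tau> y \<in> V"
  using \<tau>_UV by auto

lemma deriv_comp:
  fixes f g :: "real^'n \<Rightarrow> 'b::real_normed_vector"
  assumes "y \<in> U" "f differentiable at (\<tau> y)" "\<And>z. z \<in> U \<Longrightarrow> g z = f (\<tau> z)"
  shows "frechet_derivative g (at y) = (\<lambda>v. frechet_derivative f (at (\<tau> y)) (T y v))"
proof -
  have "(f has_derivative frechet_derivative f (at (\<tau> y))) (at (\<tau> y))"
    using assms(2) by (simp add: frechet_derivative_works)
  from has_derivative_compose[OF \<tau>_deriv[OF assms(1)] this]
  have "(g has_derivative (\<lambda>v. frechet_derivative f (at (\<tau> y)) (T y v))) (at y)"
    by (rule has_derivative_transform_within_open[OF _ open_U assms(1)]) (simp add: assms(3))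
  then show ?thesis by (metis frechet_derivative_at)
qed

lemma Y_deriv:
  assumes "y \<in> U" shows "Y.L y = (\<lambda>v. X.L (\<tau> y) (T y v))"
  using assms X.X_deriv[OF \<tau>_in] Y_eq by (intro deriv_comp) (auto simp: differentiable_def)

lemma linear_T: "y \<in> U \<Longrightarrow> linear (T y)"
  using \<tau>_deriv by (rule has_derivative_linear)

text \<open>The derivative of \<open>Y\<close> is injective and factors through \<open>T y\<close>;
  together with equality of dimensions this makes the transition map a local change of
  coordinates.\<close>

lemma inj_T:
  assumes "y \<in> U" shows "inj (T y)"
  using Y.inj_deriv[of y] UW assms by (auto simp: Y_deriv inj_def)

lemma surj_T:
  assumes "y \<in> U" shows "surj (T y)"
  using linear_T inj_T assms by (metis linear_injective_imp_surjective)

lemma volume_factor: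
  assumes "y \<in> U"
  shows "sqrt (det (metric_coeff Y y)) = \<bar>det (matrix (T y))\<bar> * sqrt (det (metric_coeff X (\<tau> y)))"
  unfolding metric_coeff_gram Y_deriv[OF assms]
  by (simp add: linear_immersion.det_gram_comp[OF X.linear_immersion_L[OF \<tau>_in[OF assms]] linear_T[OF assms]] real_sqrt_mult)

text \<open>Since \<open>T y\<close> is onto, both parametrizations have the same tangent space, and
  a tangent vector is determined by the functional it represents there.\<close>

lemma riesz_reparam:
  assumes y: "y \<in> U" and c: "\<And>v. c v = d (T y v)" and d: "linear d"
  shows "riesz (Y.L y) (\<lambda>i. c (axis i 1)) = riesz (X.L (\<tau> y)) (\<lambda>i. d (axis i 1))"
proof -
  interpret LX: linear_immersion "X.L (\<tau> y)" using \<tau>_in[OF y] by (rule X.linear_immersion_L)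
  interpret LY: linear_immersion "Y.L y" using y UW by (intro Y.linear_immersion_L) auto
  show ?thesis
  proof (rule LY.riesz_unique[symmetric])
    obtain w where "riesz (X.L (\<tau> y)) (\<lambda>i. d (axis i 1)) = X.L (\<tau> y) w" using LX.riesz_range by blast
    then show "riesz (X.L (\<tau> y)) (\<lambda>i. d (axis i 1)) \<in> range (Y.L y)"
      using surjD[OF surj_T[OF y], of w] by (auto simp: Y_deriv[OF y])
    show "riesz (X.L (\<tau> y)) (\<lambda>i. d (axis i 1)) \<bullet> Y.L y (axis i 1) = c (axis i 1)" for i
      unfolding Y_deriv[OF y] LX.riesz_inner c
      by (subst (2) linear_axis_expansion[OF d]) (simp add: mult.commute)
  qed
qed

lemma normal_local_reparam:
  assumes y: "y \<in> U" shows "normal_local Y y v = normal_local X (\<tau> y) v"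
proof -
  have "riesz (Y.L y) (\<lambda>i. v \<bullet> Y.L y (axis i 1)) = riesz (X.L (\<tau> y)) (\<lambda>i. v \<bullet> X.L (\<tau> y) (axis i 1))"
  proof (rule riesz_reparam[OF y])
    show "v \<bullet> Y.L y w = v \<bullet> X.L (\<tau> y) (T y w)" for w by (simp add: Y_deriv[OF y])
    show "linear (\<lambda>w. v \<bullet> X.L (\<tau> y) w)"
      using has_derivative_inner_right[OF X.X_deriv[OF \<tau>_in[OF y]], of v] by (rule has_derivative_linear)
  qed
  then show ?thesis by (simp add: normal_local_def tangential_local_riesz)
qed

lemma gradient_local_reparam:
  assumes y: "y \<in> U" and f: "f differentiable at (\<tau> y)" and g: "\<And>z. z \<in> U \<Longrightarrow> g z = f (\<tau> z)"
  shows "gradient_local Y g y = gradient_local X f (\<tau> y)"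
  unfolding gradient_local_riesz
  by (rule riesz_reparam[OF y]) (use f in \<open>simp_all add: deriv_comp[OF y f g] linear_frechet_derivative\<close>)

text \<open>The second derivatives of X \<circ> \<tau> contain an extra term with second derivatives
  of \<tau>, but this term is tangential and the normal projection removes it. What remains
  transforms as a bilinear form, so \<open>trace_comp\<close> applies.\<close>

lemma mean_curv_local_reparam:
  assumes y: "y \<in> U" shows "mean_curv_local Y y = mean_curv_local X (\<tau> y)"
proof -
  have yW: "y \<in> W" using y UW by auto
  interpret LX: linear_immersion "X.L (\<tau> y)" using \<tau>_in[OF y] by (rule X.linear_immersion_L)
  have nrm_eq: "linear_immersion.nrm (Y.L y) v = LX.nrm v" for v
    using normal_local_reparam[OF y, of v] Y.normal_local_nrm[OF yW] X.normal_local_nrm[OF \<tau>_in[OF y]] by simp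
  let ?t = "\<lambda>i k. T y (axis i 1) $ k"
  have "LX.nrm (pderiv_vec i (pderiv_vec j Y) y)
    = (\<Sum>k\<in>UNIV. \<Sum>l\<in>UNIV. (?t i k * ?t j l) *\<^sub>R LX.nrm (pderiv_vec k (pderiv_vec l X) (\<tau> y)))" for i j
  proof -
    let ?T2 = "frechet_derivative (\<lambda>z. T z (axis j 1)) (at y)"
    let ?X2 = "\<lambda>l. frechet_derivative (pderiv_vec l X) (at (\<tau> y))"
    have eq: "pderiv_vec j Y z = (\<Sum>l\<in>UNIV. T z (axis j 1) $ l *\<^sub>R pderiv_vec l X (\<tau> z))" if "z \<in> U" for z
      unfolding X.L_axis[symmetric] Y.L_axis[symmetric] Y_deriv[OF that]
      by (rule linear_axis_expansion[OF has_derivative_linear[OF X.X_deriv[OF \<tau>_in[OF that]]]])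
    have T2: "((\<lambda>z. T z (axis j 1) $ l) has_derivative (\<lambda>v. ?T2 v $ l)) (at y)" for l
      by (rule bounded_linear.has_derivative[OF bounded_linear_vec_nth])
        (rule C1_on_has_derivative[OF smooth_on_imp_C1_on[OF smooth_on_derivative[OF smooth_\<tau>]] y])
    have "((\<lambda>z. \<Sum>l\<in>UNIV. T z (axis j 1) $ l *\<^sub>R pderiv_vec l X (\<tau> z)) has_derivative
      (\<lambda>v. \<Sum>l\<in>UNIV. ?t j l *\<^sub>R ?X2 l (T y v) + ?T2 v $ l *\<^sub>R pderiv_vec l X (\<tau> y))) (at y)"
      by (intro has_derivative_sum has_derivative_scaleR T2
          has_derivative_compose[OF \<tau>_deriv[OF y] X.pX_deriv[OF \<tau>_in[OF y]]])
    then have "(pderiv_vec j Y has_derivative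
      (\<lambda>v. \<Sum>l\<in>UNIV. ?t j l *\<^sub>R ?X2 l (T y v) + ?T2 v $ l *\<^sub>R pderiv_vec l X (\<tau> y))) (at y)"
      by (rule has_derivative_transform_within_open[OF _ open_U y]) (simp add: eq)
    then have "pderiv_vec i (pderiv_vec j Y) y
      = (\<Sum>l\<in>UNIV. ?t j l *\<^sub>R ?X2 l (T y (axis i 1)) + ?T2 (axis i 1) $ l *\<^sub>R pderiv_vec l X (\<tau> y))"
      by (rule pderiv_vec_eqI)
    then have "LX.nrm (pderiv_vec i (pderiv_vec j Y) y)
      = (\<Sum>l\<in>UNIV. ?t j l *\<^sub>R LX.nrm (?X2 l (T y (axis i 1))))"
      by (simp add: linear_sum[OF LX.linear_nrm] linear_add[OF LX.linear_nrm] linear_cmul[OF LX.linear_nrm]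
          flip: X.L_axis)
    also have "\<dots> = (\<Sum>l\<in>UNIV. \<Sum>k\<in>UNIV. (?t i k * ?t j l) *\<^sub>R LX.nrm (pderiv_vec k (pderiv_vec l X) (\<tau> y)))"
    proof (rule sum.cong[OF refl])
      fix l
      have "?X2 l (T y (axis i 1)) = (\<Sum>k\<in>UNIV. ?t i k *\<^sub>R pderiv_vec k (pderiv_vec l X) (\<tau> y))"
        unfolding pderiv_vec_def[of _ "pderiv_vec l X"]
        by (rule linear_axis_expansion[OF has_derivative_linear[OF X.pX_deriv[OF \<tau>_in[OF y]]]])
      then show "?t j l *\<^sub>R LX.nrm (?X2 l (T y (axis i 1)))
        = (\<Sum>k\<in>UNIV. (?t i k * ?t j l) *\<^sub>R LX.nrm (pderiv_vec k (pderiv_vec l X) (\<tau> y)))"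
        by (simp add: linear_sum[OF LX.linear_nrm] linear_cmul[OF LX.linear_nrm] scaleR_sum_right mult.commute)
    qed
    also have "\<dots> = (\<Sum>k\<in>UNIV. \<Sum>l\<in>UNIV. (?t i k * ?t j l) *\<^sub>R LX.nrm (pderiv_vec k (pderiv_vec l X) (\<tau> y)))"
      by (rule sum.swap)
    finally show ?thesis .
  qed
  then show ?thesis
    unfolding Y.mean_curv_local_nrm[OF yW] X.mean_curv_local_nrm[OF \<tau>_in[OF y]] nrm_eq
    unfolding Y_deriv[OF y]
    by (simp only: LX.trace_comp[OF linear_T[OF y] inj_T[OF y]])
qed

end

section \<open>Immersed manifolds\<close>

definition C1_fun :: "('m, 'n::finite) atlas \<Rightarrow> ('m \<Rightarrow> real) \<Rightarrow> bool" where
  "C1_fun A f \<longleftrightarrow> (\<forall>(V,\<phi>)\<in>A. C1_on V (f \<circ> \<phi>))"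

lemma C1_funD: "C1_fun A f \<Longrightarrow> (V, \<phi>) \<in> A \<Longrightarrow> C1_on V (f \<circ> \<phi>)"
  by (auto simp: C1_fun_def)

lemma C1_fun_mult: "C1_fun A f \<Longrightarrow> C1_fun A g \<Longrightarrow> C1_fun A (\<lambda>p. f p * g p)"
  unfolding C1_fun_def o_def by (auto intro: C1_on_mult)

lemma C1_fun_sum: "(\<And>i. i \<in> I \<Longrightarrow> C1_fun A (f i)) \<Longrightarrow> C1_fun A (\<lambda>p. \<Sum>i\<in>I. f i p)"
  unfolding C1_fun_def o_def by (auto intro!: C1_on_sum)

lemma smooth_fun_imp_C1_fun: "smooth_fun A f \<Longrightarrow> C1_fun A f"
  unfolding C1_fun_def smooth_fun_def by (auto intro: smooth_on_imp_C1_on)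

locale immersed_manifold =
  fixes A :: "('m::{t2_space,second_countable_topology}, 'n::finite) atlas"
    and X :: "'m \<Rightarrow> real^'N::finite"
  assumes atlas: "smooth_atlas A" and immersion: "immersion A X"
begin

section \<open>Charts and transition maps\<close>

lemma chart_cover: obtains V \<phi> y where "(V, \<phi>) \<in> A" "y \<in> V" "p = \<phi> y"
proof -
  have "p \<in> (\<Union>(V,\<phi>)\<in>A. \<phi> ` V)" using atlas by (simp add: smooth_atlas_def)
  then show ?thesis using that by auto
qed

lemma chart_props:
  assumes "(V, \<phi>) \<in> A"
  shows "open V" "open (\<phi> ` V)" "homeomorphism V (\<phi> ` V) \<phi> (inv_into V \<phi>)"
proof -
  have "\<forall>(V,\<phi>)\<in>A. open V \<and> open (\<phi> ` V) \<and> homeomorphism V (\<phi> ` V) \<phi> (inv_into V \<phi>)"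
    using atlas unfolding smooth_atlas_def by (elim conjE)
  from bspec[OF this assms] show "open V" "open (\<phi> ` V)" "homeomorphism V (\<phi> ` V) \<phi> (inv_into V \<phi>)"
    by simp_all
qed

lemma chart_inj: "(V, \<phi>) \<in> A \<Longrightarrow> inj_on \<phi> V"
  by (rule inj_on_inverseI[where g = "inv_into V \<phi>"]) (rule homeomorphism_apply1[OF chart_props(3)])

lemma chart_continuous: "(V, \<phi>) \<in> A \<Longrightarrow> continuous_on V \<phi>"
  using chart_props(3) by (auto simp: homeomorphism_def)

lemma chart_inv_continuous: "(V, \<phi>) \<in> A \<Longrightarrow> continuous_on (\<phi> ` V) (inv_into V \<phi>)"
  using chart_props(3) by (auto simp: homeomorphism_def)

lemma chart_open_image:
  assumes "(V, \<phi>) \<in> A" "open S" "S \<subseteq> V" shows "open (\<phi> ` S)"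
proof -
  have "\<phi> ` S = \<phi> ` V \<inter> inv_into V \<phi> -` S"
    using assms(3) chart_inj[OF assms(1)] by (auto simp: image_iff subset_iff)
  then show ?thesis
    using continuous_on_open_vimage[OF chart_props(2)[OF assms(1)]] chart_inv_continuous[OF assms(1)] assms(2)
    by (metis Int_commute)
qed

lemma chart_immersion: "(V, \<phi>) \<in> A \<Longrightarrow> param_immersion V (X \<circ> \<phi>)"
  using immersion chart_props(1) by unfold_locales (auto simp: immersion_def)

lemma chart_change:
  assumes "(V, \<phi>) \<in> A" "(W, \<psi>) \<in> A"
  shows "reparametrization V (X \<circ> \<phi>) W (X \<circ> \<psi>) {z\<in>W. \<psi> z \<in> \<phi> ` V} (inv_into V \<phi> \<circ> \<psi>)"
proof -
  interpret P: param_immersion V "X \<circ> \<phi>" using assms(1) by (rule chart_immersion)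
  interpret Q: param_immersion W "X \<circ> \<psi>" using assms(2) by (rule chart_immersion)
  show ?thesis
  proof
    have "{z\<in>W. \<psi> z \<in> \<phi> ` V} = \<psi> -` (\<phi> ` V) \<inter> W" by auto
    then show "open {z\<in>W. \<psi> z \<in> \<phi> ` V}"
      using continuous_on_open_vimage[OF chart_props(1)[OF assms(2)]] chart_continuous[OF assms(2)]
        chart_props(2)[OF assms(1)] by metis
    show "smooth_on {z\<in>W. \<psi> z \<in> \<phi> ` V} (inv_into V \<phi> \<circ> \<psi>)"
    proof -
      have "\<forall>(V,\<phi>)\<in>A. \<forall>(W,\<psi>)\<in>A. smooth_on {y\<in>V. \<phi> y \<in> \<psi> ` W} (inv_into W \<psi> \<circ> \<phi>)"
        using atlas unfolding smooth_atlas_def by (elim conjE)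
      from bspec[OF this assms(2)] have "\<forall>(V,\<phi>)\<in>A. smooth_on {z\<in>W. \<psi> z \<in> \<phi> ` V} (inv_into V \<phi> \<circ> \<psi>)"
        by simp
      from bspec[OF this assms(1)] show ?thesis by simp
    qed
  qed (auto simp: f_inv_into_f inv_into_into)
qed

text \<open>The chart selected by \<open>at_point\<close> is unknown. A quantity that agrees in
  \<open>\<phi>\<close> and in every other chart around the same point may be computed in
  \<open>\<phi>\<close>.\<close>

lemma at_point_eq:
  assumes A: "(V, \<phi>) \<in> A" and y: "y \<in> V"
    and Q: "\<And>W \<psi> z. (W, \<psi>) \<in> A \<Longrightarrow> z \<in> W \<Longrightarrow> \<psi> z \<in> \<phi> ` V \<Longrightarrow> Q \<psi> z = Q \<phi> (inv_into V \<phi> (\<psi> z))"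
  shows "at_point A Q (\<phi> y) = Q \<phi> y"
proof -
  have ex: "\<exists>c. case c of (W, \<psi>) \<Rightarrow> (W, \<psi>) \<in> A \<and> \<phi> y \<in> \<psi> ` W"
    using A y by (intro exI[of _ "(V, \<phi>)"]) auto
  obtain W \<psi> where c: "(SOME (W,\<psi>). (W,\<psi>) \<in> A \<and> \<phi> y \<in> \<psi> ` W) = (W, \<psi>)" by fastforce
  have W: "(W, \<psi>) \<in> A" "\<phi> y \<in> \<psi> ` W"
    using someI_ex[OF ex] unfolding c by auto
  have "at_point A Q (\<phi> y) = Q \<psi> (inv_into W \<psi> (\<phi> y))"
    unfolding at_point_def c by simp
  also have "\<dots> = Q \<phi> (inv_into V \<phi> (\<psi> (inv_into W \<psi> (\<phi> y))))"
    using W y by (intro Q) (auto simp: f_inv_into_f intro: inv_into_into)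
  also have "\<dots> = Q \<phi> y"
    using W y chart_inj[OF A] by (simp add: f_inv_into_f)
  finally show ?thesis .
qed

section \<open>Geometric quantities in a chart, and their continuity on the manifold\<close>

lemma mean_curvature_chart:
  assumes "(V, \<phi>) \<in> A" "y \<in> V" shows "mean_curvature A X (\<phi> y) = mean_curv_local (X \<circ> \<phi>) y"
  unfolding mean_curvature_def
proof (rule at_point_eq[OF assms])
  fix W \<psi> z assume "(W, \<psi>) \<in> A" "z \<in> W" "\<psi> z \<in> \<phi> ` V"
  then show "mean_curv_local (X \<circ> \<psi>) z = mean_curv_local (X \<circ> \<phi>) (inv_into V \<phi> (\<psi> z))"
    using reparametrization.mean_curv_local_reparam[OF chart_change[OF assms(1)]] by simp
qed

lemma normal_part_chart:
  assumes "(V, \<phi>) \<in> A" "y \<in> V" shows "normal_part A X (\<phi> y) v = normal_local (X \<circ> \<phi>) y v"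
  unfolding normal_part_def
proof (rule at_point_eq[OF assms])
  fix W \<psi> z assume "(W, \<psi>) \<in> A" "z \<in> W" "\<psi> z \<in> \<phi> ` V"
  then show "normal_local (X \<circ> \<psi>) z v = normal_local (X \<circ> \<phi>) (inv_into V \<phi> (\<psi> z)) v"
    using reparametrization.normal_local_reparam[OF chart_change[OF assms(1)]] by simp
qed

lemma gradient_chart:
  assumes "(V, \<phi>) \<in> A" "y \<in> V" "C1_fun A f"
  shows "gradient A X f (\<phi> y) = gradient_local (X \<circ> \<phi>) (f \<circ> \<phi>) y"
  unfolding gradient_def
proof (rule at_point_eq[OF assms(1,2)])
  fix W \<psi> z assume W: "(W, \<psi>) \<in> A" "z \<in> W" "\<psi> z \<in> \<phi> ` V"
  have "(f \<circ> \<phi>) differentiable at ((inv_into V \<phi> \<circ> \<psi>) z)"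
    using C1_funD[OF assms(3,1)] W by (simp add: C1_on_def inv_into_into)
  then show "gradient_local (X \<circ> \<psi>) (f \<circ> \<psi>) z = gradient_local (X \<circ> \<phi>) (f \<circ> \<phi>) (inv_into V \<phi> (\<psi> z))"
    using reparametrization.gradient_local_reparam[OF chart_change[OF assms(1) W(1)], of z "f \<circ> \<phi>" "f \<circ> \<psi>"] W
    by (simp add: f_inv_into_f)
qed

lemma continuous_on_charts:
  fixes h :: "'m \<Rightarrow> 'b::topological_space"
  assumes "\<And>V \<phi>. (V, \<phi>) \<in> A \<Longrightarrow> continuous_on V (h \<circ> \<phi>)"
  shows "continuous_on UNIV h"
proof -
  have "continuous_on (\<Union>c\<in>A. snd c ` fst c) h"
  proof (rule continuous_on_open_UN)
    fix c assume "c \<in> A"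
    obtain V \<phi> where c: "c = (V, \<phi>)" by (cases c)
    with \<open>c \<in> A\<close> have A: "(V, \<phi>) \<in> A" by simp
    show "open (snd c ` fst c)" using chart_props(2)[OF A] by (simp add: c)
    have "continuous_on (\<phi> ` V) ((h \<circ> \<phi>) \<circ> inv_into V \<phi>)"
      by (rule continuous_on_compose[OF chart_inv_continuous[OF A]])
        (use assms[OF A] in \<open>auto intro: continuous_on_subset simp: inv_into_into\<close>)
    then show "continuous_on (snd c ` fst c) h"
      by (simp add: c f_inv_into_f cong: continuous_on_cong)
  qed
  also have "(\<Union>c\<in>A. snd c ` fst c) = UNIV"
    using atlas by (simp add: smooth_atlas_def case_prod_unfold)
  finally show ?thesis .
qed

lemma C1_fun_continuous: "C1_fun A f \<Longrightarrow> continuous_on UNIV f"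
  by (auto intro!: continuous_on_charts C1_on_continuous_on dest: C1_funD)

lemma continuous_X: "continuous_on UNIV X"
  by (rule continuous_on_charts) (metis chart_immersion C1_on_continuous_on param_immersion.C1_X)

lemma continuous_mean_curvature: "continuous_on UNIV (mean_curvature A X)"
proof (rule continuous_on_charts)
  fix V \<phi> assume A: "(V, \<phi>) \<in> A"
  show "continuous_on V (mean_curvature A X \<circ> \<phi>)"
    using param_immersion.continuous_on_mean_curv_local[OF chart_immersion[OF A]]
    by (simp add: mean_curvature_chart[OF A] cong: continuous_on_cong)
qed

lemma continuous_normal_position: "continuous_on UNIV (\<lambda>p. normal_part A X p (X p))"
proof (rule continuous_on_charts)
  fix V \<phi> assume A: "(V, \<phi>) \<in> A"
  have "continuous_on V (X \<circ> \<phi>)"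
    using C1_on_continuous_on[OF param_immersion.C1_X[OF chart_immersion[OF A]]] .
  from param_immersion.continuous_on_normal_local[OF chart_immersion[OF A] this]
  show "continuous_on V ((\<lambda>p. normal_part A X p (X p)) \<circ> \<phi>)"
    by (simp add: normal_part_chart[OF A] cong: continuous_on_cong)
qed

lemma continuous_gradient:
  assumes "C1_fun A f" shows "continuous_on UNIV (gradient A X f)"
proof (rule continuous_on_charts)
  fix V \<phi> assume A: "(V, \<phi>) \<in> A"
  show "continuous_on V (gradient A X f \<circ> \<phi>)"
    using param_immersion.continuous_on_gradient_local[OF chart_immersion[OF A] C1_funD[OF assms A]]
    by (simp add: gradient_chart[OF A _ assms] cong: continuous_on_cong)
qed

subsection \<open>The volume measure\<close>

definition vol_density :: "(real^'n \<Rightarrow> 'm) \<Rightarrow> real^'n \<Rightarrow> real" where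
  "vol_density \<phi> y = sqrt (det (metric_coeff (X \<circ> \<phi>) y))"

definition chart_volume :: "(real^'n) set \<Rightarrow> (real^'n \<Rightarrow> 'm) \<Rightarrow> 'm set \<Rightarrow> ennreal" where
  "chart_volume V \<phi> E = (\<integral>\<^sup>+y\<in>{y\<in>V. \<phi> y \<in> E}. ennreal (vol_density \<phi> y) \<partial>lborel)"

lemma vol_density_pos: "(V, \<phi>) \<in> A \<Longrightarrow> y \<in> V \<Longrightarrow> 0 < vol_density \<phi> y"
  using param_immersion.det_metric_pos[OF chart_immersion] by (simp add: vol_density_def)

lemma C1_vol_density: "(V, \<phi>) \<in> A \<Longrightarrow> C1_on V (vol_density \<phi>)"
  unfolding vol_density_def[abs_def] using param_immersion.C1_volume[OF chart_immersion] .

lemma chart_vimage_borel: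
  assumes "(V, \<phi>) \<in> A" "E \<in> sets borel" shows "{y\<in>V. \<phi> y \<in> E} \<in> sets borel"
proof -
  have "\<phi> \<in> borel_measurable (restrict_space borel V)"
    using chart_continuous[OF assms(1)] by (rule borel_measurable_continuous_on_restrict)
  from measurable_sets[OF this assms(2)] have "\<phi> -` E \<inter> V \<in> sets (restrict_space borel V)"
    by (simp add: space_restrict_space)
  moreover have "V \<in> sets borel" using chart_props(1)[OF assms(1)] by simp
  ultimately have "\<phi> -` E \<inter> V \<in> sets borel"
    by (simp add: sets_restrict_space_iff)
  moreover have "\<phi> -` E \<inter> V = {y\<in>V. \<phi> y \<in> E}" by auto
  ultimately show ?thesis by simp
qed

lemma density_measurable:
  assumes "(V, \<phi>) \<in> A" "S \<in> sets borel" "S \<subseteq> V"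
  shows "(\<lambda>y. indicator S y * vol_density \<phi> y) \<in> borel_measurable borel"
proof -
  have "(\<lambda>y. indicator S y *\<^sub>R vol_density \<phi> y) \<in> borel_measurable borel"
    using C1_on_continuous_on[OF C1_vol_density[OF assms(1)]] assms(2,3)
    by (intro borel_measurable_continuous_on_indicator) (auto intro: continuous_on_subset)
  then show ?thesis by simp
qed

lemma chart_volume_alt:
  "chart_volume V \<phi> E = (\<integral>\<^sup>+y. ennreal (indicator {y\<in>V. \<phi> y \<in> E} y * vol_density \<phi> y) \<partial>lborel)"
  unfolding chart_volume_def by (intro nn_integral_cong) (simp add: indicator_def)

text \<open>The transition map carries the part of \<open>E\<close> seen in one chart bijectively
  onto the part seen in the other, and by \<open>volume_factor\<close> its Jacobian is the ratio of
  the two densities.\<close>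

lemma chart_volume_compat:
  assumes V: "(V, \<phi>) \<in> A" and W: "(W, \<psi>) \<in> A" and E: "E \<in> sets borel" "E \<subseteq> \<phi> ` V" "E \<subseteq> \<psi> ` W"
  shows "chart_volume V \<phi> E = chart_volume W \<psi> E"
proof -
  let ?S = "{z\<in>W. \<psi> z \<in> E}" and ?R = "{y\<in>V. \<phi> y \<in> E}"
  define \<tau> where "\<tau> = inv_into V \<phi> \<circ> \<psi>"
  interpret reparametrization V "X \<circ> \<phi>" W "X \<circ> \<psi>" "{z\<in>W. \<psi> z \<in> \<phi> ` V}" \<tau>
    unfolding \<tau>_def by (rule chart_change[OF V W])
  have \<phi>\<tau>: "\<phi> (\<tau> z) = \<psi> z" if "z \<in> ?S" for z
    using that E by (auto simp: \<tau>_def f_inv_into_f)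
  have SU: "z \<in> {z\<in>W. \<psi> z \<in> \<phi> ` V}" if "z \<in> ?S" for z using that E by auto
  have im: "\<tau> ` ?S = ?R"
  proof (intro set_eqI iffI)
    fix y assume y: "y \<in> ?R"
    then obtain z where "z \<in> W" "\<phi> y = \<psi> z" using E(3) by auto
    moreover have "\<tau> z = y"
      using y inv_into_f_f[OF chart_inj[OF V], of y] \<open>\<phi> y = \<psi> z\<close> by (simp add: \<tau>_def)
    moreover have "z \<in> ?S" using y \<open>z \<in> W\<close> \<open>\<phi> y = \<psi> z\<close> by simp
    ultimately show "y \<in> \<tau> ` ?S" by blast
  next
    fix y assume "y \<in> \<tau> ` ?S"
    then obtain z where "z \<in> ?S" "y = \<tau> z" by blast
    then show "y \<in> ?R" using \<phi>\<tau>[of z] \<tau>_in[OF SU, of z] by simp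
  qed
  have inj: "inj_on \<tau> ?S"
  proof (rule inj_onI)
    fix z z' assume z: "z \<in> ?S" "z' \<in> ?S" "\<tau> z = \<tau> z'"
    then have "\<psi> z = \<psi> z'" using \<phi>\<tau>[of z] \<phi>\<tau>[of z'] by simp
    then show "z = z'" using z by (intro inj_onD[OF chart_inj[OF W]]) auto
  qed
  have vf: "\<bar>det (matrix (T z))\<bar> * vol_density \<phi> (\<tau> z) = vol_density \<psi> z" if "z \<in> ?S" for z
    using volume_factor[OF SU[OF that]] by (simp add: vol_density_def)
  then have eq: "(\<lambda>z. indicator ?S z * (\<bar>det (matrix (T z))\<bar> * vol_density \<phi> (\<tau> z)))
    = (\<lambda>z. indicator ?S z * vol_density \<psi> z)"
    by (auto simp: fun_eq_iff indicator_def)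
  have "(\<integral>\<^sup>+y. ennreal (indicator (\<tau> ` ?S) y * vol_density \<phi> y) \<partial>lborel)
    = (\<integral>\<^sup>+z. ennreal (indicator ?S z * (\<bar>det (matrix (T z))\<bar> * vol_density \<phi> (\<tau> z))) \<partial>lborel)"
  proof (rule nn_integral_change_of_variables)
    show "?S \<in> sets borel" by (rule chart_vimage_borel[OF W E(1)])
    show "(\<tau> has_derivative T z) (at z)" if "z \<in> ?S" for z using \<tau>_deriv[OF SU[OF that]] .
    show "0 \<le> vol_density \<phi> y" if "y \<in> \<tau> ` ?S" for y
      using that vol_density_pos[OF V] unfolding im by (auto intro: less_imp_le)
    show "(\<lambda>y. indicator (\<tau> ` ?S) y * vol_density \<phi> y) \<in> borel_measurable borel"
      unfolding im by (rule density_measurable[OF V chart_vimage_borel[OF V E(1)]]) auto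
    show "(\<lambda>z. indicator ?S z * (\<bar>det (matrix (T z))\<bar> * vol_density \<phi> (\<tau> z))) \<in> borel_measurable borel"
      unfolding eq by (rule density_measurable[OF W chart_vimage_borel[OF W E(1)]]) auto
  qed (rule inj)
  then show ?thesis unfolding chart_volume_alt im fun_cong[OF eq] .
qed

lemma chart_volume_suminf:
  assumes V: "(V, \<phi>) \<in> A" and E: "range E \<subseteq> sets borel" "disjoint_family E"
  shows "(\<Sum>i. chart_volume V \<phi> (E i)) = chart_volume V \<phi> (\<Union>i. E i)"
proof -
  have ind: "(\<Sum>i. ennreal (indicator {y\<in>V. \<phi> y \<in> E i} y * vol_density \<phi> y))
      = ennreal (indicator {y\<in>V. \<phi> y \<in> (\<Union>i. E i)} y * vol_density \<phi> y)" for y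
  proof -
    have dis: "disjoint_family (\<lambda>i. {y\<in>V. \<phi> y \<in> E i})"
      using E(2) by (auto simp: disjoint_family_on_def)
    have "(\<Sum>i. ennreal (indicator {y\<in>V. \<phi> y \<in> E i} y * vol_density \<phi> y))
      = (\<Sum>i. indicator {y\<in>V. \<phi> y \<in> E i} y * ennreal (vol_density \<phi> y))"
      by (intro suminf_cong) (simp add: indicator_def)
    also have "\<dots> = indicator (\<Union>i. {y\<in>V. \<phi> y \<in> E i}) y * ennreal (vol_density \<phi> y)"
      by (simp add: suminf_indicator[OF dis])
    also have "\<dots> = ennreal (indicator {y\<in>V. \<phi> y \<in> (\<Union>i. E i)} y * vol_density \<phi> y)"
      by (auto simp: indicator_def)
    finally show ?thesis .
  qed
  have "(\<lambda>y. ennreal (indicator {y\<in>V. \<phi> y \<in> E i} y * vol_density \<phi> y)) \<in> borel_measurable lborel" for i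
    using density_measurable[OF V chart_vimage_borel[OF V, of "E i"]] E(1) by auto
  then show ?thesis
    unfolding chart_volume_alt ind[symmetric] by (rule nn_integral_suminf[symmetric])
qed

text \<open>Second countability enters here, through the Lindelof property of the cover by chart
  domains.\<close>

lemma countable_charts:
  obtains V :: "nat \<Rightarrow> (real^'n) set" and \<phi> where "\<And>k. (V k, \<phi> k) \<in> A" "(\<Union>k. \<phi> k ` V k) = UNIV"
proof -
  let ?F = "(\<lambda>(V, \<phi>). \<phi> ` V) ` A"
  obtain F where F: "F \<subseteq> ?F" "countable F" "\<Union>F = \<Union>?F"
    by (rule Lindelof[of ?F]) (use chart_props(2) in auto)
  have UF: "\<Union>F = UNIV" using F(3) atlas by (simp add: smooth_atlas_def)
  \<comment> \<open>A nonempty countable family can be enumerated by all natural numbers, with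
    repetitions if it is finite.\<close>
  then have ne: "F \<noteq> {}" by auto
  define U where "U = from_nat_into F"
  have U: "\<Union>(range U) = UNIV" "\<And>k. U k \<in> F"
    using UF range_from_nat_into[OF ne F(2)] from_nat_into[OF ne] by (auto simp: U_def)
  have "\<forall>k. \<exists>c\<in>A. U k = snd c ` fst c" using subsetD[OF F(1) U(2)] by (auto simp: image_iff case_prod_unfold)
  then obtain c where c: "\<And>k. c k \<in> A" "\<And>k. U k = snd (c k) ` fst (c k)" by metis
  show ?thesis by (rule that[of "fst \<circ> c" "snd \<circ> c"]) (use c U(1) in auto)
qed

definition is_volume :: "'m measure \<Rightarrow> bool" where
  "is_volume \<mu> \<longleftrightarrow> sets \<mu> = sets borel \<and>
     (\<forall>(V,\<phi>)\<in>A. \<forall>E\<in>sets borel. E \<subseteq> \<phi> ` V \<longrightarrow> emeasure \<mu> E = chart_volume V \<phi> E)"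

text \<open>Making the countable cover disjoint cuts a Borel set into pieces lying in single charts,
  where the measure is prescribed. The resulting formula gives uniqueness; taken as a definition it
  gives existence.\<close>

lemma is_volume_emeasure:
  assumes \<mu>: "is_volume \<mu>" and c: "\<And>k :: nat. (V k, \<phi> k) \<in> A" "(\<Union>k. \<phi> k ` V k) = UNIV" and E: "E \<in> sets borel"
  shows "emeasure \<mu> E = (\<Sum>k. chart_volume (V k) (\<phi> k) (E \<inter> disjointed (\<lambda>k. \<phi> k ` V k) k))"
proof -
  let ?D = "disjointed (\<lambda>k. \<phi> k ` V k)"
  have D: "?D k \<in> sets borel" for k
    using chart_props(2)[OF c(1)] by (auto simp: disjointed_def intro!: sets.finite_UN sets.Diff)
  have "E = (\<Union>k. E \<inter> ?D k)" using c(2) UN_disjointed_eq[of "\<lambda>k. \<phi> k ` V k"] by auto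
  then have "emeasure \<mu> E = emeasure \<mu> (\<Union>k. E \<inter> ?D k)" by simp
  also have "\<dots> = (\<Sum>k. emeasure \<mu> (E \<inter> ?D k))"
    using disjoint_family_disjointed[of "\<lambda>k. \<phi> k ` V k"] \<mu> D E
    by (intro suminf_emeasure[symmetric]) (auto simp: is_volume_def disjoint_family_on_def)
  also have "\<dots> = (\<Sum>k. chart_volume (V k) (\<phi> k) (E \<inter> ?D k))"
  proof (rule suminf_cong)
    fix k
    have "E \<inter> ?D k \<subseteq> \<phi> k ` V k" using disjointed_subset[of "\<lambda>k. \<phi> k ` V k"] by auto
    then show "emeasure \<mu> (E \<inter> ?D k) = chart_volume (V k) (\<phi> k) (E \<inter> ?D k)"
      using \<mu> c(1)[of k] D E by (auto simp: is_volume_def)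
  qed
  finally show ?thesis .
qed

lemma ex1_volume: "\<exists>!\<mu>. is_volume \<mu>"
proof -
  obtain V :: "nat \<Rightarrow> (real^'n) set" and \<phi> where c: "\<And>k. (V k, \<phi> k) \<in> A" "(\<Union>k. \<phi> k ` V k) = UNIV"
    by (rule countable_charts) blast
  let ?D = "disjointed (\<lambda>k. \<phi> k ` V k)"
  have D: "?D k \<in> sets borel" for k
    using chart_props(2)[OF c(1)] by (auto simp: disjointed_def intro!: sets.finite_UN sets.Diff)
  \<comment> \<open>Summing over the pieces by an integral against counting measure turns countable
    additivity into an exchange of sum and integral.\<close>
  define m where "m = (\<lambda>E. \<integral>\<^sup>+k. chart_volume (V k) (\<phi> k) (E \<inter> ?D k) \<partial>count_space UNIV)"
  define \<mu> where "\<mu> = measure_of UNIV (sets borel) m"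
  have sets: "sets \<mu> = sets borel"
    unfolding \<mu>_def by (metis sets.sets_measure_of_eq space_borel)
  have em: "emeasure \<mu> E = m E" if "E \<in> sets borel" for E
  proof (rule emeasure_measure_of[OF \<mu>_def])
    show "positive (sets \<mu>) m"
      by (simp add: positive_def m_def chart_volume_def)
    show "countably_additive (sets \<mu>) m"
    proof (rule countably_additiveI)
      fix E :: "nat \<Rightarrow> 'm set"
      assume E: "range E \<subseteq> sets \<mu>" "disjoint_family E"
      have "(\<Sum>i. m (E i)) = (\<integral>\<^sup>+k. (\<Sum>i. chart_volume (V k) (\<phi> k) (E i \<inter> ?D k)) \<partial>count_space UNIV)"
        unfolding m_def by (rule nn_integral_suminf[symmetric]) simp
      also have "\<dots> = m (\<Union>i. E i)"
        unfolding m_def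
      proof (rule nn_integral_cong)
        fix k
        have "(\<Sum>i. chart_volume (V k) (\<phi> k) (E i \<inter> ?D k)) = chart_volume (V k) (\<phi> k) (\<Union>i. E i \<inter> ?D k)"
          using E D sets by (intro chart_volume_suminf c) (auto simp: disjoint_family_on_def)
        then show "(\<Sum>i. chart_volume (V k) (\<phi> k) (E i \<inter> ?D k)) = chart_volume (V k) (\<phi> k) ((\<Union>i. E i) \<inter> ?D k)"
          by simp
      qed
      finally show "(\<Sum>i. m (E i)) = m (\<Union>i. E i)" .
    qed
  qed (use that sets in auto)
  have "is_volume \<mu>"
    unfolding is_volume_def
  \<comment> \<open>A set inside a chart \<open>W\<close> meets many pieces of the cover;
    \<open>chart_volume_compat\<close> moves each intersection to \<open>W\<close>, where they are
    reassembled.\<close>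
  proof (intro conjI ballI, rule sets, clarify)
    fix W \<psi> E assume W: "(W, \<psi>) \<in> A" and E: "E \<in> sets borel" "E \<subseteq> \<psi> ` W"
    have "emeasure \<mu> E = (\<integral>\<^sup>+k. chart_volume W \<psi> (E \<inter> ?D k) \<partial>count_space UNIV)"
      unfolding em[OF E(1)] m_def
    proof (rule nn_integral_cong)
      fix k
      show "chart_volume (V k) (\<phi> k) (E \<inter> ?D k) = chart_volume W \<psi> (E \<inter> ?D k)"
        using E D disjointed_subset[of "\<lambda>k. \<phi> k ` V k" k] by (intro chart_volume_compat c W) auto
    qed
    also have "\<dots> = (\<Sum>k. chart_volume W \<psi> (E \<inter> ?D k))"
      by (rule nn_integral_count_space_nat)
    also have "\<dots> = chart_volume W \<psi> (\<Union>k. E \<inter> ?D k)"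
    proof (rule chart_volume_suminf[OF W])
      show "disjoint_family (\<lambda>k. E \<inter> ?D k)"
        using disjoint_family_disjointed[of "\<lambda>k. \<phi> k ` V k"] unfolding disjoint_family_on_def by blast
    qed (use E D in auto)
    also have "(\<Union>k. E \<inter> ?D k) = E" using c(2) UN_disjointed_eq[of "\<lambda>k. \<phi> k ` V k"] by auto
    finally show "emeasure \<mu> E = chart_volume W \<psi> E" .
  qed
  moreover have "\<mu>1 = \<mu>2" if "is_volume \<mu>1" "is_volume \<mu>2" for \<mu>1 \<mu>2
    using is_volume_emeasure[OF that(1) c] is_volume_emeasure[OF that(2) c] that
    by (intro measure_eqI) (auto simp: is_volume_def)
  ultimately show ?thesis by blast
qed

abbreviation "\<mu> \<equiv> volume_measure A X"

lemma is_volume_measure: "is_volume \<mu>"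
proof -
  have "volume_measure A X = (THE \<mu>. is_volume \<mu>)"
    unfolding volume_measure_def is_volume_def chart_volume_def vol_density_def ..
  then show ?thesis using theI'[OF ex1_volume] by simp
qed

lemma sets_volume [measurable_cong, simp]: "sets \<mu> = sets borel"
  using is_volume_measure by (simp add: is_volume_def)

lemma space_volume [simp]: "space \<mu> = UNIV"
  using sets_eq_imp_space_eq[OF sets_volume] by simp

lemma emeasure_volume:
  "(V, \<phi>) \<in> A \<Longrightarrow> E \<in> sets borel \<Longrightarrow> E \<subseteq> \<phi> ` V \<Longrightarrow> emeasure \<mu> E = chart_volume V \<phi> E"
  using is_volume_measure by (auto simp: is_volume_def)

text \<open>A push-forward requires a total measurable map, so the chart is extended by an arbitrary
  constant \<open>p0\<close>; the density vanishes outside \<open>V\<close>, so the constant carries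
  no mass.\<close>

lemma volume_chart_distr:
  fixes p0 :: 'm
  assumes V: "(V, \<phi>) \<in> A"
  defines "\<phi>' \<equiv> (\<lambda>y. if y \<in> V then \<phi> y else p0)"
  shows "\<phi>' \<in> borel_measurable borel"
    and "density \<mu> (indicator (\<phi> ` V)) = distr (density lborel (\<lambda>y. ennreal (indicator V y * vol_density \<phi> y))) borel \<phi>'"
proof -
  show m: "\<phi>' \<in> borel_measurable borel"
    unfolding \<phi>'_def
    by (subst measurable_If_restrict_space_iff) 
      (use chart_props(1)[OF V] in \<open>auto intro: borel_measurable_continuous_on_restrict[OF chart_continuous[OF V]]\<close>)
  have d: "(\<lambda>y. ennreal (indicator V y * vol_density \<phi> y)) \<in> borel_measurable lborel"
    using density_measurable[OF V] chart_props(1)[OF V] by auto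
  have oV: "\<phi> ` V \<in> sets borel" using chart_props(2)[OF V] by simp
  show "density \<mu> (indicator (\<phi> ` V)) = distr (density lborel (\<lambda>y. ennreal (indicator V y * vol_density \<phi> y))) borel \<phi>'"
  proof (rule measure_eqI)
    fix E assume "E \<in> sets (density \<mu> (indicator (\<phi> ` V)))"
    then have E: "E \<in> sets borel" by simp
    have "emeasure (density \<mu> (indicator (\<phi> ` V))) E = emeasure \<mu> (E \<inter> \<phi> ` V)"
    proof -
      have "emeasure (density \<mu> (indicator (\<phi> ` V))) E = (\<integral>\<^sup>+p. indicator (\<phi> ` V) p * indicator E p \<partial>\<mu>)"
        using E oV by (simp add: emeasure_density)
      also have "\<dots> = (\<integral>\<^sup>+p. indicator (E \<inter> \<phi> ` V) p \<partial>\<mu>)"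
        by (intro nn_integral_cong) (auto simp: indicator_def)
      finally show ?thesis using E oV by simp
    qed
    also have "\<dots> = chart_volume V \<phi> (E \<inter> \<phi> ` V)"
      using E oV by (intro emeasure_volume V) auto
    also have "\<dots> = (\<integral>\<^sup>+y. ennreal (indicator V y * vol_density \<phi> y) * indicator (\<phi>' -` E) y \<partial>lborel)"
      unfolding chart_volume_alt by (intro nn_integral_cong) (auto simp: indicator_def \<phi>'_def)
    also have "\<dots> = emeasure (density lborel (\<lambda>y. ennreal (indicator V y * vol_density \<phi> y))) (\<phi>' -` E)"
      using d measurable_sets[OF m E] by (simp add: emeasure_density)
    also have "\<dots> = emeasure (distr (density lborel (\<lambda>y. ennreal (indicator V y * vol_density \<phi> y))) borel \<phi>') E"
      using m E by (subst emeasure_distr) auto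
    finally show "emeasure (density \<mu> (indicator (\<phi> ` V))) E
      = emeasure (distr (density lborel (\<lambda>y. ennreal (indicator V y * vol_density \<phi> y))) borel \<phi>') E" .
  qed simp
qed

text \<open>The pulled-back integrand is a separate total function \<open>g\<close>, so that a
  coordinate divergence can be supplied in the form in which its integral is known.\<close>

lemma integral_chart:
  fixes h :: "'m \<Rightarrow> real"
  assumes V: "(V, \<phi>) \<in> A" and h: "h \<in> borel_measurable borel" and out: "\<And>p. p \<notin> \<phi> ` V \<Longrightarrow> h p = 0"
    and g: "integrable lborel g" "(\<integral>y. g y \<partial>lborel) = r"
    and gV: "\<And>y. y \<in> V \<Longrightarrow> g y = vol_density \<phi> y * h (\<phi> y)" and g0: "\<And>y. y \<notin> V \<Longrightarrow> g y = 0"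
  shows "integrable \<mu> h" and "(\<integral>p. h p \<partial>\<mu>) = r"
proof -
  define \<phi>' where "\<phi>' = (\<lambda>y. if y \<in> V then \<phi> y else undefined)"
  note distr = volume_chart_distr[OF V, of undefined, folded \<phi>'_def]
  have d: "(\<lambda>y. indicator V y * vol_density \<phi> y) \<in> borel_measurable borel"
    using density_measurable[OF V] chart_props(1)[OF V] by auto
  have oV: "\<phi> ` V \<in> sets borel" using chart_props(2)[OF V] by simp
  have dens: "density \<mu> (\<lambda>p. ennreal (indicator (\<phi> ` V) p)) = density \<mu> (indicator (\<phi> ` V))"
    by (simp add: ennreal_indicator)
  have hm: "(\<lambda>p. indicator (\<phi> ` V) p * h p) = h" using out by (auto simp: indicator_def fun_eq_iff)
  have gm: "(\<lambda>y. indicator V y * vol_density \<phi> y * h (\<phi>' y)) = g"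
    using gV g0 by (auto simp: fun_eq_iff indicator_def \<phi>'_def)
  have nn: "AE y in lborel. 0 \<le> indicator V y * vol_density \<phi> y"
    using vol_density_pos[OF V] by (auto simp: indicator_def intro!: AE_I2 less_imp_le)
  have mm: "(\<lambda>y. h (\<phi>' y)) \<in> borel_measurable borel"
    using measurable_compose[OF distr(1) h] .
  have "integrable \<mu> h \<longleftrightarrow> integrable (density \<mu> (\<lambda>p. ennreal (indicator (\<phi> ` V) p))) h"
    using h oV by (subst integrable_density) (auto simp: hm)
  also have "\<dots> \<longleftrightarrow> integrable (density lborel (\<lambda>y. ennreal (indicator V y * vol_density \<phi> y))) (\<lambda>y. h (\<phi>' y))"
    unfolding dens distr(2) using h distr(1) by (subst integrable_distr_eq) auto
  also have "\<dots> \<longleftrightarrow> integrable lborel g"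
    using d nn mm by (subst integrable_density) (auto simp: gm)
  finally show "integrable \<mu> h" using g(1) by simp
  have "(\<integral>p. h p \<partial>\<mu>) = (\<integral>p. h p \<partial>density \<mu> (\<lambda>p. ennreal (indicator (\<phi> ` V) p)))"
    using h oV by (subst integral_density) (auto simp: hm)
  also have "\<dots> = (\<integral>y. h (\<phi>' y) \<partial>density lborel (\<lambda>y. ennreal (indicator V y * vol_density \<phi> y)))"
    unfolding dens distr(2) using h distr(1) by (subst integral_distr) auto
  also have "\<dots> = (\<integral>y. g y \<partial>lborel)"
    using d nn mm by (subst integral_density) (auto simp: gm)
  finally show "(\<integral>p. h p \<partial>\<mu>) = r" using g(2) by simp
qed

subsection \<open>The divergence theorem\<close>

text \<open>The divergence of \<open>f\<close> times the tangential part of the position vector.\<close>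

definition position_div :: "('m \<Rightarrow> real) \<Rightarrow> 'm \<Rightarrow> real" where
  "position_div f p = gradient A X f p \<bullet> (X p - normal_part A X p (X p))
     + f p * (real CARD('n) - X p \<bullet> mean_curvature A X p)"

lemma position_div_local:
  assumes "(V, \<phi>) \<in> A" "y \<in> V" "C1_fun A f"
  shows "position_div f (\<phi> y) = gradient_local (X \<circ> \<phi>) (f \<circ> \<phi>) y \<bullet> tangential_local (X \<circ> \<phi>) y ((X \<circ> \<phi>) y)
    + (f \<circ> \<phi>) y * (real CARD('n) - (X \<circ> \<phi>) y \<bullet> mean_curv_local (X \<circ> \<phi>) y)"
  unfolding position_div_def gradient_chart[OF assms] normal_part_chart[OF assms(1,2)]
    mean_curvature_chart[OF assms(1,2)]
  by (simp add: normal_local_def)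

lemma chart_derivative:
  assumes "(V, \<phi>) \<in> A" "y \<in> V" "C1_fun A f"
  shows "((f \<circ> \<phi>) has_derivative frechet_derivative (f \<circ> \<phi>) (at y)) (at y)"
  using C1_on_has_derivative[OF C1_funD[OF assms(3,1)] assms(2)] .

text \<open>Here the gradient term is a directional derivative along the coordinates of the
  tangential position, a form in which linearity in \<open>f\<close> and locality are
  evident.\<close>

lemma position_div_chart:
  assumes "(V, \<phi>) \<in> A" "y \<in> V" "C1_fun A f"
  shows "position_div f (\<phi> y) = frechet_derivative (f \<circ> \<phi>) (at y) (\<chi> j. param_immersion.coord (X \<circ> \<phi>) j y)
    + f (\<phi> y) * (real CARD('n) - X (\<phi> y) \<bullet> mean_curvature A X (\<phi> y))"
proof -
  interpret P: param_immersion V "X \<circ> \<phi>" using assms(1) by (rule chart_immersion)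
  show ?thesis
    unfolding position_div_local[OF assms] P.tangential_local_coords[OF assms(2)]
      P.gradient_local_inner[OF assms(2) chart_derivative[OF assms]] mean_curvature_chart[OF assms(1,2)]
    by simp
qed

lemma position_div_sum:
  assumes f: "\<And>i. i \<in> I \<Longrightarrow> C1_fun A (f i)"
  shows "position_div (\<lambda>p. \<Sum>i\<in>I. f i p) p = (\<Sum>i\<in>I. position_div (f i) p)"
proof -
  obtain V \<phi> y where c: "(V, \<phi>) \<in> A" "y \<in> V" "p = \<phi> y" by (rule chart_cover)
  have "((\<lambda>z. \<Sum>i\<in>I. (f i \<circ> \<phi>) z) has_derivative (\<lambda>v. \<Sum>i\<in>I. frechet_derivative (f i \<circ> \<phi>) (at y) v)) (at y)"
    by (intro has_derivative_sum chart_derivative[OF c(1,2)] f)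
  then have "frechet_derivative ((\<lambda>p. \<Sum>i\<in>I. f i p) \<circ> \<phi>) (at y)
      = (\<lambda>v. \<Sum>i\<in>I. frechet_derivative (f i \<circ> \<phi>) (at y) v)"
    unfolding o_def by (metis frechet_derivative_at)
  moreover have "C1_fun A (\<lambda>p. \<Sum>i\<in>I. f i p)" by (intro C1_fun_sum f)
  ultimately show ?thesis
    unfolding c(3) using f
    by (simp add: position_div_chart[OF c(1,2)] sum.distrib sum_distrib_right)
qed

lemma position_div_eq_0:
  assumes f: "C1_fun A f" and S: "open S" "p \<in> S" "\<And>q. q \<in> S \<Longrightarrow> f q = 0"
  shows "position_div f p = 0"
proof -
  obtain V \<phi> y where c: "(V, \<phi>) \<in> A" "y \<in> V" "p = \<phi> y" by (rule chart_cover)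
  have "open (\<phi> -` S \<inter> V)"
    using chart_continuous[OF c(1)] continuous_on_open_vimage[OF chart_props(1)[OF c(1)]] S(1) by blast
  then have "frechet_derivative (f \<circ> \<phi>) (at y) = (\<lambda>_. 0)"
    by (rule frechet_derivative_eq_0) (use S c in auto)
  then show ?thesis
    unfolding c(3) position_div_chart[OF c(1,2) f] using S c by simp
qed

lemma position_div_measurable:
  assumes "C1_fun A f" shows "position_div f \<in> borel_measurable borel"
proof (rule borel_measurable_continuous_onI)
  show "continuous_on UNIV (position_div f)"
    unfolding position_div_def
    by (intro continuous_on_add continuous_on_inner continuous_on_diff continuous_on_mult continuous_on_const
        continuous_gradient continuous_X continuous_normal_position continuous_mean_curvature
        C1_fun_continuous assms)
qed

text \<open>In the chart, divergence times density is a sum of partial derivatives of compactly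
  supported functions, each of integral zero.\<close>

lemma divergence_theorem_chart:
  assumes V: "(V, \<phi>) \<in> A" and C: "compact C" "C \<subseteq> V" and f: "C1_fun A f"
    and out: "\<And>p. p \<notin> \<phi> ` C \<Longrightarrow> f p = 0"
  shows "integrable \<mu> (position_div f)" and "(\<integral>p. position_div f p \<partial>\<mu>) = 0"
proof -
  interpret P: param_immersion V "X \<circ> \<phi>" using V by (rule chart_immersion)
  have oV: "open V" by (rule chart_props(1)[OF V])
  have clC: "closed (\<phi> ` C)"
    using C chart_continuous[OF V] by (intro compact_imp_closed compact_continuous_image) (auto intro: continuous_on_subset)
  have outV: "f (\<phi> y) = 0" if "y \<in> V" "y \<notin> C" for y
    using that C(2) chart_inj[OF V] by (intro out) (auto simp: inj_on_def)
  \<comment> \<open>This function is C^1 on \<open>V\<close> and zero off the compact set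
    \<open>C\<close>. These two open sets cover the space, so the extension by zero is C^1
    everywhere.\<close>
  define h where "h = (\<lambda>j y. if y \<in> V then f (\<phi> y) * (vol_density \<phi> y * P.coord j y) else 0)"
  have h0: "h j y = 0" if "y \<notin> C" for j y
    using that outV by (simp add: h_def)
  have "C1_on (V \<union> - C) (h j)" for j
  proof (rule C1_on_Un)
    have "C1_on V (\<lambda>y. (f \<circ> \<phi>) y * (vol_density \<phi> y * P.coord j y))"
      by (intro C1_on_mult C1_funD[OF f V] C1_vol_density[OF V] P.C1_coord)
    then show "C1_on V (h j)" by (rule C1_on_cong[OF _ oV]) (simp add: h_def)
    show "open (- C)" using C(1) by (simp add: compact_imp_closed open_Compl)
    then show "C1_on (- C) (h j)" by (rule C1_on_cong[OF C1_on_const[of _ 0]]) (simp add: h0)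
  qed (rule oV)
  moreover have "V \<union> - C = UNIV" using C(2) by auto
  ultimately have h: "C1_on UNIV (h j)" for j by simp
  note int = integral_derivative_eq_0[OF h C(1) h0]
  let ?g = "\<lambda>y. \<Sum>j\<in>UNIV. frechet_derivative (h j) (at y) (axis j 1)"
  have gV: "?g y = vol_density \<phi> y * position_div f (\<phi> y)" if y: "y \<in> V" for y
  proof -
    have "frechet_derivative (h j) (at y) (axis j 1)
      = pderiv_vec j (\<lambda>y. (f \<circ> \<phi>) y * (sqrt (det (metric_coeff (X \<circ> \<phi>) y)) * P.coord j y)) y" for j
    proof -
      have "((\<lambda>y. (f \<circ> \<phi>) y * (sqrt (det (metric_coeff (X \<circ> \<phi>) y)) * P.coord j y))
        has_derivative frechet_derivative (h j) (at y)) (at y)"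
        by (rule has_derivative_transform_within_open[OF C1_on_has_derivative[OF h] oV y])
          (simp_all add: h_def vol_density_def)
      from pderiv_vec_eqI[OF this] show ?thesis by simp
    qed
    then show ?thesis
      using P.divergence_identity_scaled[OF y C1_funD[OF f V]]
      by (simp add: position_div_local[OF V y f] vol_density_def)
  qed
  have g0: "?g y = 0" if "y \<notin> V" for y
  proof -
    have "frechet_derivative (h j) (at y) = (\<lambda>_. 0)" for j
      by (rule frechet_derivative_eq_0[of "- C"]) (use that C h0 in \<open>auto simp: compact_imp_closed open_Compl\<close>)
    then show ?thesis by simp
  qed
  have pd0: "position_div f p = 0" if "p \<notin> \<phi> ` V" for p
    by (rule position_div_eq_0[OF f, of "- \<phi> ` C"]) (use that clC C(2) out in \<open>auto simp: open_Compl\<close>)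
  have ig: "integrable lborel ?g" "(\<integral>y. ?g y \<partial>lborel) = 0"
    using int by (simp_all add: Bochner_Integration.integral_sum)
  show "integrable \<mu> (position_div f)" and "(\<integral>p. position_div f p \<partial>\<mu>) = 0"
    using integral_chart[OF V position_div_measurable[OF f] pd0 ig gV g0] by auto
qed

text \<open>The squared positive part of r^2 - |z - y|^2 is transplanted from one chart and extended
  by zero. In any other chart it is C^1 on the overlap by smoothness of the transition map, and zero
  off the image of the ball, which is closed because the manifold is Hausdorff.\<close>

lemma chart_bump:
  obtains b :: "'m \<Rightarrow> real" and U V \<phi> C where "C1_fun A b" "\<And>q. 0 \<le> b q" "open U" "p \<in> U" "\<And>q. q \<in> U \<Longrightarrow> 0 < b q"
    "(V, \<phi>) \<in> A" "compact C" "C \<subseteq> V" "\<And>q. q \<notin> \<phi> ` C \<Longrightarrow> b q = 0"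
proof -
  obtain V \<phi> y where V: "(V, \<phi>) \<in> A" and y: "y \<in> V" "p = \<phi> y" by (rule chart_cover)
  obtain r where r: "r > 0" "cball y r \<subseteq> V"
    using chart_props(1)[OF V] y(1) by (auto simp: open_contains_cball)
  define \<beta> where "\<beta> = (\<lambda>z. (max 0 (r\<^sup>2 - (z - y) \<bullet> (z - y)))\<^sup>2)"
  define b where "b = (\<lambda>q. if q \<in> \<phi> ` V then \<beta> (inv_into V \<phi> q) else 0)"
  have \<beta>0: "\<beta> z = 0" if "z \<notin> cball y r" for z
  proof -
    have "r < norm (z - y)" using that by (simp add: dist_norm norm_minus_commute)
    then have "r\<^sup>2 \<le> (z - y) \<bullet> (z - y)"
      using r(1) by (simp add: power_mono less_imp_le flip: power2_norm_eq_inner)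
    then show ?thesis by (simp add: \<beta>_def)
  qed
  have \<beta>pos: "0 < \<beta> z" if "z \<in> ball y r" for z
  proof -
    have "norm (z - y) < r" using that by (simp add: dist_norm norm_minus_commute)
    then have "(z - y) \<bullet> (z - y) < r\<^sup>2"
      by (simp add: power_strict_mono flip: power2_norm_eq_inner)
    then show ?thesis by (simp add: \<beta>_def)
  qed
  have b\<phi>: "b (\<phi> z) = \<beta> z" if "z \<in> V" for z
    using that chart_inj[OF V] by (simp add: b_def)
  have b0: "b q = 0" if "q \<notin> \<phi> ` cball y r" for q
  proof (cases "q \<in> \<phi> ` V")
    case True
    then obtain z where z: "z \<in> V" "q = \<phi> z" by blast
    then have "z \<notin> cball y r" using that by blast
    then show ?thesis using z b\<phi> \<beta>0 by simp
  qed (simp add: b_def)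
  have cl: "closed (\<phi> ` cball y r)"
    using r(2) chart_continuous[OF V]
    by (intro compact_imp_closed compact_continuous_image) (auto intro: continuous_on_subset)
  have "C1_fun A b"
    unfolding C1_fun_def
  proof (clarify)
    fix W \<psi> assume W: "(W, \<psi>) \<in> A"
    let ?U = "{z\<in>W. \<psi> z \<in> \<phi> ` V}" and ?Z = "\<psi> -` (- \<phi> ` cball y r) \<inter> W"
    interpret reparametrization V "X \<circ> \<phi>" W "X \<circ> \<psi>" ?U "inv_into V \<phi> \<circ> \<psi>"
      by (rule chart_change[OF V W])
    have "C1_on (?U \<union> ?Z) (b \<circ> \<psi>)"
    proof (rule C1_on_Un)
      have "C1_on ?U (\<lambda>z. \<beta> ((inv_into V \<phi> \<circ> \<psi>) z))"
        unfolding \<beta>_def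
        by (intro C1_on_square_pos_part C1_on_diff C1_on_inner C1_on_const smooth_on_imp_C1_on[OF smooth_\<tau>])
      then show "C1_on ?U (b \<circ> \<psi>)" by (rule C1_on_cong[OF _ open_U]) (simp add: b_def)
      show oZ: "open ?Z"
        using chart_continuous[OF W] continuous_on_open_vimage[OF chart_props(1)[OF W]] cl
        by (meson open_Compl)
      show "C1_on ?Z (b \<circ> \<psi>)"
        by (rule C1_on_cong[OF C1_on_const[of _ 0] oZ]) (simp add: b0)
    qed (rule open_U)
    moreover have "?U \<union> ?Z = W" using image_mono[OF r(2), of \<phi>] by auto
    ultimately show "C1_on W (b \<circ> \<psi>)" by simp
  qed
  then show ?thesis
  proof (rule that)
    have sub: "ball y r \<subseteq> V" using r(2) ball_subset_cball by blast
    show "open (\<phi> ` ball y r)" using chart_open_image[OF V open_ball sub] .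
    show "p \<in> \<phi> ` ball y r" using y r(1) by auto
    show "0 < b q" if "q \<in> \<phi> ` ball y r" for q
      using that sub \<beta>pos b\<phi> by auto
    show "0 \<le> b q" for q by (simp add: b_def \<beta>_def)
  qed (use V r(2) b0 in auto)
qed

text \<open>Within a chart, the set where \<open>g\<close> is nonzero and the complement of
  \<open>K\<close> are open and cover; on the second the quotient is constantly 0.\<close>

lemma C1_fun_divide:
  assumes f: "C1_fun A f" and g: "C1_fun A g" and K: "closed K"
    and out: "\<And>p. p \<notin> K \<Longrightarrow> f p = 0" and nz: "\<And>p. p \<in> K \<Longrightarrow> g p \<noteq> 0"
  shows "C1_fun A (\<lambda>p. f p / g p)"
  unfolding C1_fun_def
proof clarify
  fix V \<phi> assume V: "(V, \<phi>) \<in> A"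
  let ?S = "(g \<circ> \<phi>) -` (- {0}) \<inter> V" and ?Z = "\<phi> -` (- K) \<inter> V"
  note vim = continuous_on_open_vimage[OF chart_props(1)[OF V]]
  have "C1_on (?S \<union> ?Z) ((\<lambda>p. f p / g p) \<circ> \<phi>)"
  proof (rule C1_on_Un)
    have "C1_on ?S (\<lambda>y. (f \<circ> \<phi>) y / (g \<circ> \<phi>) y)"
      by (intro C1_on_divide C1_on_subset[OF C1_funD[OF f V]] C1_on_subset[OF C1_funD[OF g V]]) auto
    then show "C1_on ?S ((\<lambda>p. f p / g p) \<circ> \<phi>)" by (simp add: o_def)
    show "open ?S"
      using vim[of "g \<circ> \<phi>"] C1_on_continuous_on[OF C1_funD[OF g V]] by blast
    show oZ: "open ?Z"
      using vim[of \<phi>] chart_continuous[OF V] K by (meson open_Compl)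
    show "C1_on ?Z ((\<lambda>p. f p / g p) \<circ> \<phi>)"
      by (rule C1_on_cong[OF C1_on_const[of _ 0] oZ]) (simp add: out)
  qed
  moreover have "?S \<union> ?Z = V" using nz by auto
  ultimately show "C1_on V ((\<lambda>p. f p / g p) \<circ> \<phi>)" by simp
qed

theorem divergence_theorem:
  assumes f: "C1_fun A f" and K: "compact K" and out: "\<And>p. p \<notin> K \<Longrightarrow> f p = 0"
  shows "integrable \<mu> (position_div f)" and "(\<integral>p. position_div f p \<partial>\<mu>) = 0"
proof -
  have "\<forall>p. \<exists>b U. C1_fun A b \<and> (\<forall>q. 0 \<le> b q) \<and> open U \<and> p \<in> U \<and> (\<forall>q\<in>U. 0 < b q) \<and>
    (\<exists>V \<phi> C. (V, \<phi>) \<in> A \<and> compact C \<and> C \<subseteq> V \<and> (\<forall>q. q \<notin> \<phi> ` C \<longrightarrow> b q = 0))"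
  proof
    fix p
    obtain b :: "'m \<Rightarrow> real" and U V \<phi> C where "C1_fun A b" "\<And>q. 0 \<le> b q" "open U" "p \<in> U" "\<And>q. q \<in> U \<Longrightarrow> 0 < b q"
    "(V, \<phi>) \<in> A" "compact C" "C \<subseteq> V" "\<And>q. q \<notin> \<phi> ` C \<Longrightarrow> b q = 0"
      by (rule chart_bump[of p]) blast
    then show "\<exists>b U. C1_fun A b \<and> (\<forall>q. 0 \<le> b q) \<and> open U \<and> p \<in> U \<and> (\<forall>q\<in>U. 0 < b q) \<and>
    (\<exists>V \<phi> C. (V, \<phi>) \<in> A \<and> compact C \<and> C \<subseteq> V \<and> (\<forall>q. q \<notin> \<phi> ` C \<longrightarrow> b q = 0))"
      by blast
  qed
  then obtain b U where b: "\<And>p. C1_fun A (b p)" "\<And>p q. 0 \<le> b p q" and U: "\<And>p. open (U p)" "\<And>p. p \<in> U p"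
    and bU: "\<And>p q. q \<in> U p \<Longrightarrow> 0 < b p q"
    and supp: "\<And>p. \<exists>V \<phi> C. (V, \<phi>) \<in> A \<and> compact C \<and> C \<subseteq> V \<and> (\<forall>q. q \<notin> \<phi> ` C \<longrightarrow> b p q = 0)"
    by metis
  have "K \<subseteq> (\<Union>p. U p)" using U(2) by blast
  then obtain P where P: "finite P" "K \<subseteq> (\<Union>p\<in>P. U p)"
    using compactE_image[OF K, of UNIV U] U(1) by metis
  \<comment> \<open>instead of a partition of unity: \<open>f / \<beta>\<close> is of class \<open>C\<^sup>1\<close> and is localized by the bumps \<open>b p\<close>\<close>
  define \<beta> where "\<beta> = (\<lambda>q. \<Sum>p\<in>P. b p q)"
  have \<beta>: "\<beta> q \<noteq> 0" if "q \<in> K" for q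
  proof -
    obtain p where "p \<in> P" "q \<in> U p" using subsetD[OF P(2) \<open>q \<in> K\<close>] by blast
    then have "0 < \<beta> q" unfolding \<beta>_def using b(2) bU P(1) by (intro sum_pos2[of P p]) auto
    then show ?thesis by simp
  qed
  have v: "C1_fun A (\<lambda>q. f q / \<beta> q)"
    using K \<beta> out unfolding \<beta>_def by (intro C1_fun_divide[OF f _ compact_imp_closed] C1_fun_sum b) auto
  let ?f = "\<lambda>p q. b p q * (f q / \<beta> q)"
  have C1f: "C1_fun A (?f p)" for p by (intro C1_fun_mult b v)
  have f_eq: "f = (\<lambda>q. \<Sum>p\<in>P. ?f p q)"
  proof
    fix q
    have "(\<Sum>p\<in>P. ?f p q) = \<beta> q * (f q / \<beta> q)"
      by (simp only: \<beta>_def sum_distrib_right)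
    \<comment> \<open>Off \<open>K\<close> both sides are 0, even where \<beta> vanishes.\<close>
    then show "f q = (\<Sum>p\<in>P. ?f p q)" using \<beta>[of q] out[of q] by (cases "q \<in> K") auto
  qed
  have "position_div f = position_div (\<lambda>q. \<Sum>p\<in>P. ?f p q)"
    by (rule arg_cong[OF f_eq])
  also have "\<dots> = (\<lambda>q. \<Sum>p\<in>P. position_div (?f p) q)"
    by (rule ext, rule position_div_sum[OF C1f])
  finally have eq: "position_div f = (\<lambda>q. \<Sum>p\<in>P. position_div (?f p) q)" .
  have "integrable \<mu> (position_div (?f p)) \<and> (\<integral>q. position_div (?f p) q \<partial>\<mu>) = 0" for p
  proof -
    obtain V \<phi> C where c: "(V, \<phi>) \<in> A" "compact C" "C \<subseteq> V" "\<And>q. q \<notin> \<phi> ` C \<Longrightarrow> b p q = 0"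
      using supp[of p] by blast
    have "?f p q = 0" if "q \<notin> \<phi> ` C" for q using c(4)[OF that] by simp
    from divergence_theorem_chart[OF c(1,2,3) C1f this] show ?thesis by blast
  qed
  then show "integrable \<mu> (position_div f)" and "(\<integral>p. position_div f p \<partial>\<mu>) = 0"
    unfolding eq by (simp_all add: Bochner_Integration.integral_sum)
qed

end

section \<open>The weighted inequality\<close>

text \<open>The integrals of \<open>a\<close> and \<open>b\<close> may be infinite, so integrals of
  differences are avoided. The positive and negative parts of \<Phi> are put on opposite sides;
  their integrals are finite and equal, and can be cancelled.\<close>

lemma nn_integral_mono_null_integral:
  fixes \<Phi> a b :: "'a \<Rightarrow> real"
  assumes \<Phi>: "integrable M \<Phi>" "(\<integral>x. \<Phi> x \<partial>M) = 0"
    and [measurable]: "a \<in> borel_measurable M" "b \<in> borel_measurable M"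
    and nonneg: "\<And>x. 0 \<le> a x" "\<And>x. 0 \<le> b x" and le: "\<And>x. \<Phi> x + a x \<le> b x"
  shows "(\<integral>\<^sup>+x. a x \<partial>M) \<le> (\<integral>\<^sup>+x. b x \<partial>M)"
proof -
  have [measurable]: "\<Phi> \<in> borel_measurable M" using \<Phi>(1) by auto
  let ?p = "\<integral>\<^sup>+x. ennreal (\<Phi> x) \<partial>M" and ?n = "\<integral>\<^sup>+x. ennreal (- \<Phi> x) \<partial>M"
  have fin: "?p < \<infinity>" "?n < \<infinity>"
    using \<Phi>(1) by (auto simp: real_integrable_def top.not_eq_extremum)
  have "enn2real ?p = enn2real ?n"
    using real_lebesgue_integral_def[OF \<Phi>(1)] \<Phi>(2) by simp
  then have eq: "?p = ?n" using fin by (metis ennreal_enn2real infinity_ennreal_def)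
  have "(\<integral>\<^sup>+x. a x \<partial>M) + ?p = (\<integral>\<^sup>+x. ennreal (a x) + ennreal (\<Phi> x) \<partial>M)"
    by (rule nn_integral_add[symmetric]) auto
  also have "\<dots> \<le> (\<integral>\<^sup>+x. ennreal (b x) + ennreal (- \<Phi> x) \<partial>M)"
  proof (rule nn_integral_mono)
    fix x
    have "ennreal (a x) + ennreal (\<Phi> x) = ennreal (a x + max 0 (\<Phi> x))"
      using nonneg by (simp add: ennreal_plus max_def ennreal_neg)
    also have "\<dots> \<le> ennreal (b x + max 0 (- \<Phi> x))"
      using le[of x] by (intro ennreal_leI) (auto simp: max_def)
    also have "\<dots> = ennreal (b x) + ennreal (- \<Phi> x)"
      using nonneg by (simp add: ennreal_plus max_def ennreal_neg)
    finally show "ennreal (a x) + ennreal (\<Phi> x) \<le> ennreal (b x) + ennreal (- \<Phi> x)" .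
  qed
  also have "\<dots> = (\<integral>\<^sup>+x. b x \<partial>M) + ?n" by (rule nn_integral_add) auto
  finally show ?thesis using eq fin by (auto simp: ennreal_add_left_cancel_le add.commute)
qed

text \<open>The argument stands for |x|^2. The square makes the function C^1 across
  \<open>s = R\<^sup>2\<close>.\<close>

definition cutoff :: "real \<Rightarrow> real \<Rightarrow> real" where
  "cutoff R s = (max 0 (1 - s / R\<^sup>2))\<^sup>2"

lemma cutoff_bounds: "0 \<le> s \<Longrightarrow> 0 \<le> cutoff R s" "0 \<le> s \<Longrightarrow> cutoff R s \<le> 1"
  by (auto simp: cutoff_def power_le_one)

lemma cutoff_eq_0: "0 < R \<Longrightarrow> R\<^sup>2 \<le> s \<Longrightarrow> cutoff R s = 0"
  by (simp add: cutoff_def field_simps)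

lemma cutoff_tendsto: "(\<lambda>k. cutoff (real (Suc k)) s) \<longlonglongrightarrow> 1"
proof -
  have "(\<lambda>k. inverse (real (Suc k))) \<longlonglongrightarrow> 0" by (rule LIMSEQ_inverse_real_of_nat)
  then have "(\<lambda>k. (max 0 (1 - s * (inverse (real (Suc k)))\<^sup>2))\<^sup>2) \<longlonglongrightarrow> (max 0 (1 - s * 0\<^sup>2))\<^sup>2"
    by (intro tendsto_intros)
  then show ?thesis by (simp add: cutoff_def divide_inverse power_inverse)
qed

definition weight :: "real \<Rightarrow> real \<Rightarrow> real \<Rightarrow> real" where
  "weight t R s = exp (s / (4 * t)) * cutoff R s"

text \<open>The derivative of \<open>weight\<close> in \<open>s\<close>, arranged so that the share
  of the Gaussian is a multiple of \<open>weight\<close> and the share of the cutoff has a visible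
  sign.\<close>

definition weight' :: "real \<Rightarrow> real \<Rightarrow> real \<Rightarrow> real" where
  "weight' t R s = weight t R s / (4 * t) - exp (s / (4 * t)) * (2 * max 0 (1 - s / R\<^sup>2)) / R\<^sup>2"

lemma weight_deriv:
  assumes "t \<noteq> 0" "0 < R"
  shows "(weight t R has_real_derivative weight' t R s) (at s)"
proof -
  have "((\<lambda>s. 1 - s / R\<^sup>2) has_real_derivative 0 - 1 / R\<^sup>2) (at s)"
    by (intro DERIV_diff DERIV_const DERIV_cdivide DERIV_ident)
  then have "((\<lambda>s. 1 - s / R\<^sup>2) has_real_derivative - 1 / R\<^sup>2) (at s)" by simp
  from DERIV_chain2[OF has_real_derivative_square_pos_part this]
  have c: "(cutoff R has_real_derivative 2 * max 0 (1 - s / R\<^sup>2) * (- 1 / R\<^sup>2)) (at s)"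
    unfolding cutoff_def[abs_def] .
  have "((\<lambda>s. exp (s / (4 * t))) has_real_derivative exp (s / (4 * t)) * (1 / (4 * t))) (at s)"
    using assms(1) by (auto intro!: derivative_eq_intros)
  from DERIV_mult[OF this c] show ?thesis
    unfolding weight_def[abs_def] weight'_def cutoff_def by (simp add: algebra_simps)
qed

lemma C1_on_weight: "t \<noteq> 0 \<Longrightarrow> 0 < R \<Longrightarrow> C1_on S (weight t R)"
  by (rule C1_on_real[OF weight_deriv])
    (auto simp: weight'_def weight_def cutoff_def intro!: continuous_intros)

text \<open>Monotonicity of the cutoff enters only here.\<close>

lemma weight'_le: "weight' t R s \<le> weight t R s / (4 * t)"
  by (simp add: weight'_def)

section \<open>Pointwise estimate and removal of the cutoff\<close>

context immersed_manifold
begin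

lemma C1_fun_weight:
  assumes "t \<noteq> 0" "0 < R" shows "C1_fun A (\<lambda>p. weight t R (X p \<bullet> X p))"
  unfolding C1_fun_def
proof clarify
  fix V \<phi> assume V: "(V, \<phi>) \<in> A"
  have "C1_on V (\<lambda>y. (X \<circ> \<phi>) y \<bullet> (X \<circ> \<phi>) y)"
    by (intro C1_on_inner param_immersion.C1_X[OF chart_immersion[OF V]])
  from C1_on_compose[OF this C1_on_weight[OF assms, of UNIV]]
  show "C1_on V ((\<lambda>p. weight t R (X p \<bullet> X p)) \<circ> \<phi>)" by (simp add: o_def)
qed

lemma normal_position_orthogonal:
  "normal_part A X p (X p) \<bullet> (X p - normal_part A X p (X p)) = 0"
  "mean_curvature A X p \<bullet> (X p - normal_part A X p (X p)) = 0"
proof -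
  obtain V \<phi> y where c: "(V, \<phi>) \<in> A" "y \<in> V" "p = \<phi> y" by (rule chart_cover)
  interpret P: param_immersion V "X \<circ> \<phi>" using c(1) by (rule chart_immersion)
  have T: "X p - normal_part A X p (X p) = tangential_local (X \<circ> \<phi>) y (X (\<phi> y))"
    by (simp add: c normal_part_chart[OF c(1,2)] normal_local_def)
  show "normal_part A X p (X p) \<bullet> (X p - normal_part A X p (X p)) = 0"
    unfolding T using P.normal_local_tangential_inner[OF c(2)] by (simp add: c(3) normal_part_chart[OF c(1,2)])
  show "mean_curvature A X p \<bullet> (X p - normal_part A X p (X p)) = 0"
    unfolding T using P.mean_curv_local_normal[OF c(2)] by (simp add: c(3) mean_curvature_chart[OF c(1,2)])
qed

text \<open>Along the tangential part T the derivative of |x|^2 is 2 x \<bullet> T, which equals 2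
  |T|^2 as the normal part is orthogonal to T; hence the factor in the last term.\<close>

lemma gradient_weight:
  assumes t: "t \<noteq> 0" and R: "0 < R" and u: "C1_fun A u"
  defines "s \<equiv> \<lambda>p. X p \<bullet> X p" and "T \<equiv> \<lambda>p. X p - normal_part A X p (X p)"
  shows "gradient A X (\<lambda>p. (u p)\<^sup>2 * weight t R (s p)) p \<bullet> T p
    = 2 * u p * (gradient A X u p \<bullet> T p) * weight t R (s p)
      + 2 * (u p)\<^sup>2 * weight' t R (s p) * (T p \<bullet> T p)"
proof -
  obtain V \<phi> y where c: "(V, \<phi>) \<in> A" "y \<in> V" "p = \<phi> y" by (rule chart_cover)
  interpret P: param_immersion V "X \<circ> \<phi>" using c(1) by (rule chart_immersion)
  let ?f = "\<lambda>p. (u p)\<^sup>2 * weight t R (s p)" and ?w = "\<chi> j. P.coord j y"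
  have C1f: "C1_fun A ?f"
    unfolding power2_eq_square s_def by (intro C1_fun_mult u C1_fun_weight t R)
  have T: "T p = P.L y ?w"
    using P.tangential_local_coords[OF c(2)]
    by (simp add: T_def c(3) normal_part_chart[OF c(1,2)] normal_local_def)
  have XT: "X p \<bullet> T p = T p \<bullet> T p"
    using normal_position_orthogonal(1)[of p] by (simp add: T_def inner_diff_left)
  have du: "(u \<circ> \<phi> has_derivative frechet_derivative (u \<circ> \<phi>) (at y)) (at y)"
    by (rule chart_derivative[OF c(1,2) u])
  have ds: "((\<lambda>y. (X \<circ> \<phi>) y \<bullet> (X \<circ> \<phi>) y) has_derivative (\<lambda>v. 2 * ((X \<circ> \<phi>) y \<bullet> P.L y v))) (at y)"
    using has_derivative_inner[OF P.X_deriv[OF c(2)] P.X_deriv[OF c(2)]] by (simp add: inner_commute)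
  have dw: "((\<lambda>y. weight t R (s (\<phi> y))) has_derivative
      (\<lambda>v. 2 * ((X \<circ> \<phi>) y \<bullet> P.L y v) * weight' t R (s (\<phi> y)))) (at y)"
    using DERIV_compose_FDERIV[OF weight_deriv[OF t R] ds] by (simp add: s_def)
  have "((\<lambda>y. (u \<circ> \<phi>) y * (u \<circ> \<phi>) y * weight t R (s (\<phi> y))) has_derivative
    (\<lambda>v. (u \<circ> \<phi>) y * (u \<circ> \<phi>) y * (2 * ((X \<circ> \<phi>) y \<bullet> P.L y v) * weight' t R (s (\<phi> y)))
      + ((u \<circ> \<phi>) y * frechet_derivative (u \<circ> \<phi>) (at y) v + frechet_derivative (u \<circ> \<phi>) (at y) v * (u \<circ> \<phi>) y)
        * weight t R (s (\<phi> y)))) (at y)"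
    by (intro has_derivative_mult du dw)
  then have df: "(?f \<circ> \<phi> has_derivative
    (\<lambda>v. (u \<circ> \<phi>) y * (u \<circ> \<phi>) y * (2 * ((X \<circ> \<phi>) y \<bullet> P.L y v) * weight' t R (s (\<phi> y)))
      + ((u \<circ> \<phi>) y * frechet_derivative (u \<circ> \<phi>) (at y) v + frechet_derivative (u \<circ> \<phi>) (at y) v * (u \<circ> \<phi>) y)
        * weight t R (s (\<phi> y)))) (at y)"
    by (simp add: o_def power2_eq_square)
  have gu: "gradient A X u p \<bullet> T p = frechet_derivative (u \<circ> \<phi>) (at y) ?w"
    unfolding T using P.gradient_local_inner[OF c(2) du] by (simp add: c(3) gradient_chart[OF c(1,2) u])
  have "gradient A X ?f p = gradient_local (X \<circ> \<phi>) (?f \<circ> \<phi>) y"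
    unfolding c(3) by (rule gradient_chart[OF c(1,2) C1f])
  then have "gradient A X ?f p \<bullet> T p = gradient_local (X \<circ> \<phi>) (?f \<circ> \<phi>) y \<bullet> P.L y ?w"
    by (simp only: T)
  also have "\<dots> = u p * u p * (2 * (X p \<bullet> T p) * weight' t R (s p))
      + (u p * (gradient A X u p \<bullet> T p) + (gradient A X u p \<bullet> T p) * u p) * weight t R (s p)"
    unfolding P.gradient_local_inner[OF c(2) df] gu unfolding T by (simp only: c(3) o_apply)
  also have "\<dots> = 2 * u p * (gradient A X u p \<bullet> T p) * weight t R (s p)
      + 2 * (u p)\<^sup>2 * weight' t R (s p) * (T p \<bullet> T p)"
    by (simp add: XT power2_eq_square algebra_simps)
  finally show ?thesis .
qed

lemma pointwise_bound:
  assumes t: "t < 0" and R: "0 < R" and u: "C1_fun A u"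
  defines "\<theta> \<equiv> \<lambda>p. weight t R (X p \<bullet> X p)"
    and "\<delta> \<equiv> \<lambda>p. mean_curvature A X p + (1 / (2 * t)) *\<^sub>R normal_part A X p (X p)"
  shows "position_div (\<lambda>p. (u p)\<^sup>2 * \<theta> p) p + \<theta> p * ((u p)\<^sup>2 * (norm (X p))\<^sup>2 / (- 4 * t))
    \<le> \<theta> p * (real CARD('n) * (u p)\<^sup>2 + (- t) * (4 * (norm (gradient A X u p))\<^sup>2 + (u p)\<^sup>2 * (norm (\<delta> p))\<^sup>2))"
proof -
  define N where "N = normal_part A X p (X p)"
  define T where "T = X p - N"
  define g where "g = gradient A X u p"
  define H where "H = mean_curvature A X p"
  define a where "a = u p"
  define d where "d = \<delta> p"
  define \<tau> where "\<tau> = - t"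
  define th where "th = \<theta> p"
  have \<tau>: "\<tau> > 0" "t = - \<tau>" using t by (auto simp: \<tau>_def)
  have NT: "N \<bullet> T = 0" and HT: "H \<bullet> T = 0"
    using normal_position_orthogonal[of p] by (auto simp: N_def T_def H_def)
  have X: "X p = T + N" by (simp add: T_def)
  have xx: "X p \<bullet> X p = T \<bullet> T + N \<bullet> N"
    using NT by (simp add: X inner_add_left inner_add_right inner_commute)
  \<comment> \<open>The sign changes because 1 / 2t = -1 / 2\<tau>.\<close>
  have H: "H = d + (1 / (2 * \<tau>)) *\<^sub>R N"
    by (simp add: d_def \<delta>_def H_def N_def \<tau>)
  \<comment> \<open>Since H is normal, only the normal part of the position is seen.\<close>
  have XH: "X p \<bullet> H = N \<bullet> d + N \<bullet> N / (2 * \<tau>)"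
    using HT by (simp add: X inner_add_left inner_commute[of T]) (simp add: H inner_add_right)
  have th: "0 \<le> th"
    by (simp add: th_def \<theta>_def weight_def cutoff_bounds)
  have W: "weight' t R (X p \<bullet> X p) * (T \<bullet> T) \<le> - th / (4 * \<tau>) * (T \<bullet> T)"
    using weight'_le[of t R "X p \<bullet> X p"] by (intro mult_right_mono) (auto simp: th_def \<theta>_def \<tau>)
  have pd: "position_div (\<lambda>p. (u p)\<^sup>2 * \<theta> p) p = 2 * a * (g \<bullet> T) * th
      + 2 * a\<^sup>2 * (weight' t R (X p \<bullet> X p) * (T \<bullet> T)) + a\<^sup>2 * th * (real CARD('n) - X p \<bullet> H)"
    unfolding position_div_def \<theta>_def
    using gradient_weight[OF _ R u, of t p] t
    by (simp add: N_def[symmetric] T_def[symmetric] g_def H_def a_def th_def \<theta>_def mult.assoc)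
  have "2 * a\<^sup>2 * (weight' t R (X p \<bullet> X p) * (T \<bullet> T)) \<le> 2 * a\<^sup>2 * (- th / (4 * \<tau>) * (T \<bullet> T))"
    by (rule mult_left_mono[OF W]) simp
  then have 1: "position_div (\<lambda>p. (u p)\<^sup>2 * \<theta> p) p
      \<le> th * (2 * a * (g \<bullet> T) - a\<^sup>2 * (T \<bullet> T) / (2 * \<tau>) + a\<^sup>2 * (real CARD('n) - N \<bullet> d - N \<bullet> N / (2 * \<tau>)))"
  proof -
    assume "2 * a\<^sup>2 * (weight' t R (X p \<bullet> X p) * (T \<bullet> T)) \<le> 2 * a\<^sup>2 * (- th / (4 * \<tau>) * (T \<bullet> T))"
    moreover have "th * (2 * a * (g \<bullet> T) - a\<^sup>2 * (T \<bullet> T) / (2 * \<tau>) + a\<^sup>2 * (real CARD('n) - N \<bullet> d - N \<bullet> N / (2 * \<tau>)))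
      = 2 * a * (g \<bullet> T) * th + 2 * a\<^sup>2 * (- th / (4 * \<tau>) * (T \<bullet> T))
        + a\<^sup>2 * th * (real CARD('n) - (N \<bullet> d + N \<bullet> N / (2 * \<tau>)))"
      by (simp add: algebra_simps)
    ultimately show ?thesis unfolding pd XH by linarith
  qed
  \<comment> \<open>The factor \<open>4 * \<tau>\<close> is chosen so that the square uses a^2 |T|^2
    / 4\<tau>, exactly half of the available a^2 |T|^2 / 2\<tau>.\<close>
  have sq1: "2 * a * (g \<bullet> T) \<le> a\<^sup>2 * (T \<bullet> T) / (4 * \<tau>) + 4 * \<tau> * (g \<bullet> g)"
  proof -
    have "0 \<le> (a *\<^sub>R T - (4 * \<tau>) *\<^sub>R g) \<bullet> (a *\<^sub>R T - (4 * \<tau>) *\<^sub>R g) / (4 * \<tau>)"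
      using \<tau>(1) by simp
    also have "\<dots> = a\<^sup>2 * (T \<bullet> T) / (4 * \<tau>) + 4 * \<tau> * (g \<bullet> g) - 2 * a * (g \<bullet> T)"
      using \<tau>(1) by (simp add: inner_diff_left inner_diff_right inner_commute[of T g] power2_eq_square field_simps)
    finally show ?thesis by simp
  qed
  \<comment> \<open>Here \<open>2 * \<tau>\<close> leaves |N|^2 / 4\<tau>, the same fraction as for
    T, so that both remainders add up to a multiple of |x|^2.\<close>
  have sq2: "- (N \<bullet> d) \<le> N \<bullet> N / (4 * \<tau>) + \<tau> * (d \<bullet> d)"
  proof -
    have "0 \<le> (N + (2 * \<tau>) *\<^sub>R d) \<bullet> (N + (2 * \<tau>) *\<^sub>R d) / (4 * \<tau>)"
      using \<tau>(1) by simp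
    also have "\<dots> = N \<bullet> N / (4 * \<tau>) + \<tau> * (d \<bullet> d) + N \<bullet> d"
      using \<tau>(1) by (simp add: inner_add_left inner_add_right inner_commute[of d N] field_simps)
    finally show ?thesis by simp
  qed
  have sq2': "- a\<^sup>2 * (N \<bullet> d) \<le> a\<^sup>2 * (N \<bullet> N) / (4 * \<tau>) + \<tau> * a\<^sup>2 * (d \<bullet> d)"
    using mult_left_mono[OF sq2, of "a\<^sup>2"] by (simp add: algebra_simps)
  have "2 * a * (g \<bullet> T) - a\<^sup>2 * (T \<bullet> T) / (2 * \<tau>) + a\<^sup>2 * (real CARD('n) - N \<bullet> d - N \<bullet> N / (2 * \<tau>))
      + a\<^sup>2 * (X p \<bullet> X p) / (4 * \<tau>)
    \<le> real CARD('n) * a\<^sup>2 + \<tau> * (4 * (g \<bullet> g) + a\<^sup>2 * (d \<bullet> d))"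
  proof -
    have "a\<^sup>2 * (T \<bullet> T) / (2 * \<tau>) = 2 * (a\<^sup>2 * (T \<bullet> T) / (4 * \<tau>))"
      "a\<^sup>2 * (N \<bullet> N / (2 * \<tau>)) = 2 * (a\<^sup>2 * (N \<bullet> N) / (4 * \<tau>))"
      "a\<^sup>2 * (X p \<bullet> X p) / (4 * \<tau>) = a\<^sup>2 * (T \<bullet> T) / (4 * \<tau>) + a\<^sup>2 * (N \<bullet> N) / (4 * \<tau>)"
      unfolding xx by (simp_all add: distrib_left add_divide_distrib)
    moreover have "a\<^sup>2 * (real CARD('n) - N \<bullet> d - N \<bullet> N / (2 * \<tau>))
      = real CARD('n) * a\<^sup>2 + (- a\<^sup>2 * (N \<bullet> d)) - a\<^sup>2 * (N \<bullet> N / (2 * \<tau>))"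
      by (simp add: algebra_simps)
    moreover have "\<tau> * (4 * (g \<bullet> g) + a\<^sup>2 * (d \<bullet> d)) = 4 * \<tau> * (g \<bullet> g) + \<tau> * a\<^sup>2 * (d \<bullet> d)"
      by (simp add: algebra_simps)
    ultimately show ?thesis using sq1 sq2' by linarith
  qed
  from mult_left_mono[OF this th] 1
  have "position_div (\<lambda>p. (u p)\<^sup>2 * \<theta> p) p + th * (a\<^sup>2 * (X p \<bullet> X p) / (4 * \<tau>))
     \<le> th * (real CARD('n) * a\<^sup>2 + \<tau> * (4 * (g \<bullet> g) + a\<^sup>2 * (d \<bullet> d)))"
    by (simp add: distrib_left)
  then show ?thesis
    by (simp add: a_def g_def d_def th_def \<tau>_def power2_norm_eq_inner)
qed

theorem gaussian_weighted_bound: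
  assumes t: "t < 0" and u: "C1_fun A u" and proper: "\<And>R. compact {p. norm (X p) \<le> R}"
  defines "w \<equiv> \<lambda>p. exp ((norm (X p))\<^sup>2 / (4 * t))"
    and "\<delta> \<equiv> \<lambda>p. mean_curvature A X p + (1 / (2 * t)) *\<^sub>R normal_part A X p (X p)"
  shows "ennreal (1 / (- t)) * (\<integral>\<^sup>+p. ennreal ((norm (X p))\<^sup>2 * (u p)\<^sup>2 * w p) \<partial>\<mu>)
    \<le> ennreal (4 * real CARD('n)) * (\<integral>\<^sup>+p. ennreal ((u p)\<^sup>2 * w p) \<partial>\<mu>)
      + ennreal (- 4 * t) * (\<integral>\<^sup>+p. ennreal ((4 * (norm (gradient A X u p))\<^sup>2 + (u p)\<^sup>2 * (norm (\<delta> p))\<^sup>2) * w p) \<partial>\<mu>)"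
proof -
  define \<theta> where "\<theta> = (\<lambda>k p. weight t (real (Suc k)) (X p \<bullet> X p))"
  define e where "e = (\<lambda>p. 4 * (norm (gradient A X u p))\<^sup>2 + (u p)\<^sup>2 * (norm (\<delta> p))\<^sup>2)"
  \<comment> \<open>\<open>l\<close> and \<open>b\<close> are a quarter of the two sides, as
    delivered by \<open>pointwise_bound\<close>; the factor 4 is restored after the limit.\<close>
  define l where "l = (\<lambda>p. (norm (X p))\<^sup>2 * (u p)\<^sup>2 / (- 4 * t))"
  define b where "b = (\<lambda>p. real CARD('n) * (u p)\<^sup>2 + (- t) * e p)"
  have c: "continuous_on UNIV u" "continuous_on UNIV (\<lambda>p. norm (X p))" "continuous_on UNIV e"
    unfolding e_def \<delta>_def
    by (intro continuous_on_add continuous_on_mult continuous_on_norm continuous_on_power continuous_on_scaleR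
        continuous_on_const C1_fun_continuous[OF u] continuous_X continuous_gradient[OF u]
        continuous_mean_curvature continuous_normal_position)+
  have [measurable]: "u \<in> borel_measurable borel" "(\<lambda>p. norm (X p)) \<in> borel_measurable borel"
    "e \<in> borel_measurable borel"
    using c by (auto intro: borel_measurable_continuous_onI)
  have [measurable]: "w \<in> borel_measurable borel" "l \<in> borel_measurable borel" "b \<in> borel_measurable borel"
    unfolding w_def l_def b_def by measurable
  have \<theta>C1: "C1_fun A (\<theta> k)" for k
    unfolding \<theta>_def using t by (intro C1_fun_weight) auto
  have [measurable]: "\<theta> k \<in> borel_measurable borel" for k
    by (rule borel_measurable_continuous_onI[OF C1_fun_continuous[OF \<theta>C1]])
  have \<theta>: "0 \<le> \<theta> k p" "\<theta> k p \<le> w p" for k p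
    unfolding \<theta>_def w_def weight_def power2_norm_eq_inner
    using cutoff_bounds[of "X p \<bullet> X p" "real (Suc k)"] by (auto simp: mult_left_le)
  have e0: "0 \<le> e p" for p by (simp add: e_def)
  have l0: "0 \<le> l p" for p
    unfolding l_def using t by (intro divide_nonneg_pos mult_nonneg_nonneg) auto
  have b0: "0 \<le> b p" for p
    unfolding b_def using t e0[of p] by (intro add_nonneg_nonneg mult_nonneg_nonneg) auto
  have bound: "(\<integral>\<^sup>+p. ennreal (\<theta> k p * l p) \<partial>\<mu>) \<le> (\<integral>\<^sup>+p. ennreal (w p * b p) \<partial>\<mu>)" for k
  proof (rule nn_integral_mono_null_integral)
    let ?f = "\<lambda>p. (u p)\<^sup>2 * \<theta> k p"
    have f: "C1_fun A ?f" unfolding power2_eq_square by (intro C1_fun_mult u \<theta>C1)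
    have out: "?f p = 0" if "p \<notin> {p. norm (X p) \<le> real (Suc k)}" for p
    proof -
      have "(real (Suc k))\<^sup>2 \<le> X p \<bullet> X p"
        using that unfolding power2_norm_eq_inner[symmetric] by (intro power_mono) auto
      then show ?thesis by (simp add: \<theta>_def weight_def cutoff_eq_0)
    qed
    show "integrable \<mu> (position_div ?f)" "(\<integral>p. position_div ?f p \<partial>\<mu>) = 0"
      using divergence_theorem[OF f proper out] by auto
    fix p
    have "position_div ?f p + \<theta> k p * l p \<le> \<theta> k p * b p"
      using pointwise_bound[OF t _ u, of "real (Suc k)" p]
      unfolding \<theta>_def[symmetric] \<delta>_def[symmetric] by (simp add: l_def b_def e_def \<theta>_def \<delta>_def mult.commute)
    also have "\<dots> \<le> w p * b p" by (rule mult_right_mono[OF \<theta>(2) b0])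
    finally show "position_div ?f p + \<theta> k p * l p \<le> w p * b p" .
    show "0 \<le> \<theta> k p * l p" "0 \<le> w p * b p" using \<theta> l0 b0 by (auto simp: w_def)
  qed measurable
  have lim: "(\<lambda>k. ennreal (\<theta> k p * l p)) \<longlonglongrightarrow> ennreal (w p * l p)" for p
  proof (rule tendsto_ennrealI)
    have "(\<lambda>k. exp (X p \<bullet> X p / (4 * t)) * cutoff (real (Suc k)) (X p \<bullet> X p) * l p)
       \<longlonglongrightarrow> exp (X p \<bullet> X p / (4 * t)) * 1 * l p"
      by (intro tendsto_intros cutoff_tendsto)
    then show "(\<lambda>k. \<theta> k p * l p) \<longlonglongrightarrow> w p * l p"
      by (simp add: \<theta>_def w_def weight_def power2_norm_eq_inner)
  qed
  have "(\<integral>\<^sup>+p. ennreal (w p * l p) \<partial>\<mu>) = (\<integral>\<^sup>+p. liminf (\<lambda>k. ennreal (\<theta> k p * l p)) \<partial>\<mu>)"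
    using lim_imp_Liminf[OF sequentially_bot lim] by simp
  also have "\<dots> \<le> liminf (\<lambda>k. \<integral>\<^sup>+p. ennreal (\<theta> k p * l p) \<partial>\<mu>)"
    by (rule nn_integral_liminf) measurable
  also have "\<dots> \<le> liminf (\<lambda>k. \<integral>\<^sup>+p. ennreal (w p * b p) \<partial>\<mu>)"
    by (rule Liminf_mono) (simp add: bound)
  also have "\<dots> = (\<integral>\<^sup>+p. ennreal (w p * b p) \<partial>\<mu>)" by (simp add: Liminf_const)
  finally have main: "(\<integral>\<^sup>+p. ennreal (w p * l p) \<partial>\<mu>) \<le> (\<integral>\<^sup>+p. ennreal (w p * b p) \<partial>\<mu>)" .
  have "ennreal (1 / (- t)) * (\<integral>\<^sup>+p. ennreal ((norm (X p))\<^sup>2 * (u p)\<^sup>2 * w p) \<partial>\<mu>)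
    = (\<integral>\<^sup>+p. ennreal 4 * ennreal (w p * l p) \<partial>\<mu>)"
  proof (subst nn_integral_cmult[symmetric])
    show "(\<integral>\<^sup>+p. ennreal (1 / (- t)) * ennreal ((norm (X p))\<^sup>2 * (u p)\<^sup>2 * w p) \<partial>\<mu>)
      = (\<integral>\<^sup>+p. ennreal 4 * ennreal (w p * l p) \<partial>\<mu>)"
    proof (rule nn_integral_cong)
      fix p
      have "ennreal (1 / (- t)) * ennreal ((norm (X p))\<^sup>2 * (u p)\<^sup>2 * w p)
        = ennreal (1 / (- t) * ((norm (X p))\<^sup>2 * (u p)\<^sup>2 * w p))"
        using t by (intro ennreal_mult[symmetric]) (auto simp: w_def)
      also have "1 / (- t) * ((norm (X p))\<^sup>2 * (u p)\<^sup>2 * w p) = 4 * (w p * l p)"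
        using t by (simp add: l_def field_simps)
      also have "ennreal \<dots> = ennreal 4 * ennreal (w p * l p)"
        using l0[of p] by (intro ennreal_mult) (auto simp: w_def)
      finally show "ennreal (1 / (- t)) * ennreal ((norm (X p))\<^sup>2 * (u p)\<^sup>2 * w p)
        = ennreal 4 * ennreal (w p * l p)" .
    qed
  qed measurable
  also have "\<dots> = ennreal 4 * (\<integral>\<^sup>+p. ennreal (w p * l p) \<partial>\<mu>)"
    by (rule nn_integral_cmult) measurable
  also have "\<dots> \<le> ennreal 4 * (\<integral>\<^sup>+p. ennreal (w p * b p) \<partial>\<mu>)"
    by (rule mult_left_mono[OF main]) simp
  also have "\<dots> = (\<integral>\<^sup>+p. ennreal 4 * ennreal (w p * b p) \<partial>\<mu>)"
    by (rule nn_integral_cmult[symmetric]) measurable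
  also have "\<dots> = (\<integral>\<^sup>+p. ennreal (4 * real CARD('n)) * ennreal ((u p)\<^sup>2 * w p)
      + ennreal (- 4 * t) * ennreal (e p * w p) \<partial>\<mu>)"
  proof (rule nn_integral_cong)
    fix p
    have w: "0 \<le> w p" by (simp add: w_def)
    have "0 \<le> (u p)\<^sup>2 * w p" "0 \<le> e p * w p" "0 \<le> - 4 * t" using w e0 t by auto
    then have n1: "0 \<le> 4 * real CARD('n) * ((u p)\<^sup>2 * w p)" and n2: "0 \<le> - 4 * t * (e p * w p)"
      by (simp_all only: mult_nonneg_nonneg of_nat_0_le_iff zero_le_numeral)
    have "ennreal 4 * ennreal (w p * b p) = ennreal (4 * (w p * b p))"
      using w b0 by (intro ennreal_mult[symmetric]) auto
    also have "4 * (w p * b p) = 4 * real CARD('n) * ((u p)\<^sup>2 * w p) + - 4 * t * (e p * w p)"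
      by (simp add: b_def algebra_simps)
    also have "ennreal \<dots> = ennreal (4 * real CARD('n) * ((u p)\<^sup>2 * w p)) + ennreal (- 4 * t * (e p * w p))"
      by (rule ennreal_plus[OF n1 n2])
    also have "\<dots> = ennreal (4 * real CARD('n)) * ennreal ((u p)\<^sup>2 * w p) + ennreal (- 4 * t) * ennreal (e p * w p)"
      using t by (intro arg_cong2[where f = "(+)"] ennreal_mult') auto
    finally show "ennreal 4 * ennreal (w p * b p)
      = ennreal (4 * real CARD('n)) * ennreal ((u p)\<^sup>2 * w p) + ennreal (- 4 * t) * ennreal (e p * w p)" .
  qed
  also have "\<dots> = ennreal (4 * real CARD('n)) * (\<integral>\<^sup>+p. ennreal ((u p)\<^sup>2 * w p) \<partial>\<mu>)
      + ennreal (- 4 * t) * (\<integral>\<^sup>+p. ennreal (e p * w p) \<partial>\<mu>)"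
    by (subst nn_integral_add) (auto simp: nn_integral_cmult)
  finally show ?thesis unfolding e_def .
qed

end

theorem lemma4p14:
  fixes A :: "('m::{t2_space,second_countable_topology}, 'n::finite) atlas"
    and F :: "real \<Rightarrow> 'm \<Rightarrow> real^'N::finite"
    and u :: "'m \<Rightarrow> real"
    and t :: real
  assumes "ancient_mcf A F"
    and "finite_entropy A F"
    and "t < 0"
    and "smooth_fun A u"
  defines "M \<equiv> volume_measure A (F t)"
    and "\<phi> \<equiv> shrinker_defect A F t"
  shows "ennreal (1 / (- t)) *
           (\<integral>\<^sup>+p. ennreal ((norm (F t p))\<^sup>2 * (u p)\<^sup>2 * exp ((norm (F t p))\<^sup>2 / (4 * t))) \<partial>M)
         \<le> ennreal (4 * real CARD('n)) *
             (\<integral>\<^sup>+p. ennreal ((u p)\<^sup>2 * exp ((norm (F t p))\<^sup>2 / (4 * t))) \<partial>M)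
           + ennreal (- 4 * t) *
             (\<integral>\<^sup>+p. ennreal ((4 * (norm (gradient A (F t) u p))\<^sup>2 + (u p)\<^sup>2 * (norm (\<phi> p))\<^sup>2) *
                exp ((norm (F t p))\<^sup>2 / (4 * t))) \<partial>M)"
proof -
  interpret immersed_manifold A "F t"
    using assms(1,3) by unfold_locales (auto simp: ancient_mcf_def)
  \<comment> \<open>Properness on the degenerate time interval [t, t] gives a compact subset of
    space-time; projecting it to the parameter manifold yields compact sublevel sets of |x|.\<close>
  have "compact {p. norm (F t p) \<le> R}" for R
  proof -
    have "compact {(s, p). s \<in> {t..t} \<and> F s p \<in> cball 0 R}"
      using assms(1,3) unfolding ancient_mcf_def by blast
    then have "compact (snd ` {(s, p). s \<in> {t..t} \<and> F s p \<in> cball 0 R})"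
      by (intro compact_continuous_image continuous_intros)
    also have "snd ` {(s, p). s \<in> {t..t} \<and> F s p \<in> cball 0 R} = {p. norm (F t p) \<le> R}"
      by (force simp: image_iff)
    finally show ?thesis .
  qed
  from gaussian_weighted_bound[OF assms(3) smooth_fun_imp_C1_fun[OF assms(4)] this]
  show ?thesis unfolding M_def \<phi>_def shrinker_defect_def .
qed

end
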